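(* Let $H$ be a real Hilbert space and let $A$ be a self-adjoint linear operator on $H$ with dense domain $D(A)$ such that $$\nu:=\inf\{\langle Au,u\rangle: u\in D(A),\ |u|=1\}>0 .$$ Let $p\in[0,1]$, $(u_0,u_1)\in D(A)\times D(A^{1/2})$, and $\varepsilon_0>0$. Let $c_\varepsilon:[0,+\infty)\to(0,+\infty)$, with $\varepsilon\in(0,\varepsilon_0)$, be a family of functions of class $C^1$ for which there are constants $\mu>0$, $M_3$, $M_4$ such that $$\mu\le c_\varepsilon(t)\le M_3,\qquad |c_\varepsilon'(t)|\le\frac{M_4}{(1+t)^p}\qquad\forall t\ge 0,\ \forall\varepsilon\in(0,\varepsilon_0).$$ Then, for every $\varepsilon\in(0,\varepsilon_0)$, the problem $$\varepsilon u_\varepsilon''(t)+\frac{1}{(1+t)^p}u_\varepsilon'(t)+c_\varepsilon(t)Au_\varepsilon(t)=0\quad\forall t\ge 0,\qquad u_\varepsilon(0)=u_0,\quad u_\varepsilon'(0)=u_1,$$ has a unique global solution $u_\varepsilon\in C^2([0,+\infty);H)\cap C^1([0,+\infty);D(A^{1/2}))\cap C^0([0,+\infty);D(A))$. Moreover the function $$\Gamma_\varepsilon(t):=|u_\varepsilon(t)|^2+|A^{1/2}u_\varepsilon(t)|^2+|Au_\varepsilon(t)|^2+|u_\varepsilon'(t)|^2+\varepsilon|A^{1/2}u_\varepsilon'(t)|^2$$ satisfies the following decay estimates. - If $p=0$: for every $\beta<2\mu\nu$ there exist $\varepsilon_1\in(0,\varepsilon_0]$ and $C$ such that $\Gamma_\varepsilon(t)\le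 Ce^{-\beta t}$ for all $t\ge 0$ and all $\varepsilon\in(0,\varepsilon_1)$. - If $p\in(0,1)$: for every $\beta>0$ there exist $\varepsilon_1\in(0,\varepsilon_0]$ and $C$ such that $\Gamma_\varepsilon(t)\le Ce^{-\beta(1+t)^{1-p}}$ for all $t\ge 0$ and all $\varepsilon\in(0,\varepsilon_1)$. - If $p=1$: for every $\beta>0$ there exist $\varepsilon_1\in(0,\varepsilon_0]$ and $C$ such that $\Gamma_\varepsilon(t)\le \dfrac{C}{(1+t)^\beta}$ for all $t\ge 0$ and all $\varepsilon\in(0,\varepsilon_1)$. (The constants $C$ and $\varepsilon_1$ may depend on $\beta$; $C$ does not depend on $\varepsilon$ or $t$.)
   Context: $|x|$ and $\langle x,y\rangle$ denote the norm and scalar product of $H$. The operator $A$ may be unbounded; its powers $A^\alpha$ ($\alpha\ge 0$) are defined by the spectral theorem on domains $D(A^\alpha)$, endowed with the graph norm. *)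

theory Defs
  imports "HOL-Analysis.Analysis"
begin

text \<open>An unbounded operator on a real Hilbert space is given by its domain \<open>D\<close> and a function \<open>A\<close>
  whose values outside \<open>D\<close> are irrelevant.\<close>

definition linear_op :: "'h::real_vector set \<Rightarrow> ('h \<Rightarrow> 'h) \<Rightarrow> bool" where
  "linear_op D A \<longleftrightarrow> subspace D \<and>
     (\<forall>x\<in>D. \<forall>y\<in>D. A (x + y) = A x + A y) \<and> (\<forall>r. \<forall>x\<in>D. A (r *\<^sub>R x) = r *\<^sub>R A x)"

definition op_graph :: "'h set \<Rightarrow> ('h \<Rightarrow> 'h) \<Rightarrow> ('h \<times> 'h) set" where
  "op_graph D A = {(x, A x) | x. x \<in> D}"

definition adjoint_graph :: "'h::real_inner set \<Rightarrow> ('h \<Rightarrow> 'h) \<Rightarrow> ('h \<times> 'h) set" where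
  "adjoint_graph D A = {(y, z). \<forall>x\<in>D. A x \<bullet> y = x \<bullet> z}"

definition self_adjoint_op :: "'h::real_inner set \<Rightarrow> ('h \<Rightarrow> 'h) \<Rightarrow> bool" where
  "self_adjoint_op D A \<longleftrightarrow>
     linear_op D A \<and> closure D = UNIV \<and> adjoint_graph D A = op_graph D A"

text \<open>Taken in the extended reals, where the infimum is \<open>-\<infinity>\<close> for an operator unbounded from below
  and \<open>\<infinity>\<close> for the zero space; an infimum in \<open>real\<close> would be unspecified in both cases.\<close>

definition op_lower_bound :: "'h::real_inner set \<Rightarrow> ('h \<Rightarrow> 'h) \<Rightarrow> ereal" where
  "op_lower_bound D A = (INF u\<in>{u \<in> D. norm u = 1}. ereal (A u \<bullet> u))"


subsection \<open>Powers of a self-adjoint operator by the spectral theorem\<close>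

definition orthogonal_projection :: "('h::real_inner \<Rightarrow> 'h) \<Rightarrow> bool" where
  "orthogonal_projection P \<longleftrightarrow>
     bounded_linear P \<and> (\<forall>x. P (P x) = P x) \<and> (\<forall>x y. P x \<bullet> y = x \<bullet> P y)"

definition resolution_of_identity :: "(real \<Rightarrow> 'h::real_inner \<Rightarrow> 'h) \<Rightarrow> bool" where
  "resolution_of_identity E \<longleftrightarrow>
     (\<forall>l. orthogonal_projection (E l)) \<and>
     (\<forall>l m x. l \<le> m \<longrightarrow> E l (E m x) = E l x \<and> E m (E l x) = E l x) \<and>
     (\<forall>l x. ((\<lambda>m. E m x) \<longlongrightarrow> E l x) (at_right l)) \<and>
     (\<forall>x. ((\<lambda>l. E l x) \<longlongrightarrow> 0) at_bot) \<and>
     (\<forall>x. ((\<lambda>l. E l x) \<longlongrightarrow> x) at_top)"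

text \<open>The Lebesgue-Stieltjes measure \<open>d\<langle>E\<^sub>l x, x\<rangle>\<close>.\<close>

definition spectral_measure :: "(real \<Rightarrow> 'h::real_inner \<Rightarrow> 'h) \<Rightarrow> 'h \<Rightarrow> real measure" where
  "spectral_measure E x = interval_measure (\<lambda>l. E l x \<bullet> x)"

definition spectral_dom :: "(real \<Rightarrow> 'h::real_inner \<Rightarrow> 'h) \<Rightarrow> (real \<Rightarrow> real) \<Rightarrow> 'h set" where
  "spectral_dom E f = {x. integrable (spectral_measure E x) (\<lambda>l. (f l)\<^sup>2)}"

text \<open>\<open>\<integral> f(l) d\<langle>E\<^sub>l x, y\<rangle>\<close> for \<open>x\<close> and \<open>y\<close> in \<^term>\<open>spectral_dom E f\<close>, the signed measure being
  expressed by polarization.\<close>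

definition spectral_form ::
  "(real \<Rightarrow> 'h::real_inner \<Rightarrow> 'h) \<Rightarrow> (real \<Rightarrow> real) \<Rightarrow> 'h \<Rightarrow> 'h \<Rightarrow> real" where
  "spectral_form E f x y =
     ((LINT l|spectral_measure E (x + y). f l) - (LINT l|spectral_measure E (x - y). f l)) / 4"

text \<open>\<open>\<integral> f dE\<close> on \<^term>\<open>spectral_dom E f\<close>; testing against \<open>y\<close> in this dense subspace determines
  the value.\<close>

definition spectral_op ::
  "(real \<Rightarrow> 'h::real_inner \<Rightarrow> 'h) \<Rightarrow> (real \<Rightarrow> real) \<Rightarrow> 'h \<Rightarrow> 'h" where
  "spectral_op E f x = (THE z. \<forall>y\<in>spectral_dom E f. z \<bullet> y = spectral_form E f x y)"

text \<open>\<open>A = \<integral> l dE\<^sub>l\<close>, including the equality of the domains.\<close>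

definition is_spectral_resolution ::
  "'h::real_inner set \<Rightarrow> ('h \<Rightarrow> 'h) \<Rightarrow> (real \<Rightarrow> 'h \<Rightarrow> 'h) \<Rightarrow> bool" where
  "is_spectral_resolution D A E \<longleftrightarrow> resolution_of_identity E \<and>
     D = spectral_dom E (\<lambda>l. l) \<and>
     (\<forall>x\<in>D. \<forall>y\<in>D. A x \<bullet> y = spectral_form E (\<lambda>l. l) x y)"

text \<open>By the spectral theorem a self-adjoint operator on a Hilbert space has exactly one spectral
  resolution, so the choice below is immaterial.\<close>

definition spectral_resolution ::
  "'h::real_inner set \<Rightarrow> ('h \<Rightarrow> 'h) \<Rightarrow> real \<Rightarrow> 'h \<Rightarrow> 'h" where
  "spectral_resolution D A = (SOME E. is_spectral_resolution D A E)"

text \<open>\<open>A\<^sup>\<alpha> = \<integral> l\<^sup>\<alpha> dE\<^sub>l\<close> and its domain, for \<open>A\<close> with strictly positive spectrum: the values of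
  \<open>l powr a\<close> at \<open>l \<le> 0\<close> are then irrelevant.\<close>

definition power_dom :: "'h::real_inner set \<Rightarrow> ('h \<Rightarrow> 'h) \<Rightarrow> real \<Rightarrow> 'h set" where
  "power_dom D A a = spectral_dom (spectral_resolution D A) (\<lambda>l. l powr a)"

definition power_op :: "'h::real_inner set \<Rightarrow> ('h \<Rightarrow> 'h) \<Rightarrow> real \<Rightarrow> 'h \<Rightarrow> 'h" where
  "power_op D A a = spectral_op (spectral_resolution D A) (\<lambda>l. l powr a)"


subsection \<open>Functions of class \<open>C\<^sup>k\<close> on the closed half-line\<close>

text \<open>The derivative is one-sided at \<open>0\<close>; values at negative arguments play no role.\<close>

definition hderiv :: "(real \<Rightarrow> 'h::real_normed_vector) \<Rightarrow> real \<Rightarrow> 'h" where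
  "hderiv f t = vector_derivative f (at t within {0..})"

definition C1_half :: "(real \<Rightarrow> 'h::real_normed_vector) \<Rightarrow> bool" where
  "C1_half f \<longleftrightarrow> f differentiable_on {0..} \<and> continuous_on {0..} (hderiv f)"

definition C2_half :: "(real \<Rightarrow> 'h::real_normed_vector) \<Rightarrow> bool" where
  "C2_half f \<longleftrightarrow> C1_half f \<and> C1_half (hderiv f)"

text \<open>Regularity with values in the domain \<open>D\<close> of \<open>B\<close> with the graph norm. The map
  \<open>x \<mapsto> (x, B x)\<close> is a linear isometry of this normed space into the product space, whose norm is
  \<open>sqrt (|x|\<^sup>2 + |y|\<^sup>2)\<close>.\<close>

definition C0_half_graph ::
  "'h::real_normed_vector set \<Rightarrow> ('h \<Rightarrow> 'h) \<Rightarrow> (real \<Rightarrow> 'h) \<Rightarrow> bool" where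
  "C0_half_graph D B u \<longleftrightarrow>
     (\<forall>t\<ge>0. u t \<in> D) \<and> continuous_on {0..} (\<lambda>t. (u t, B (u t)))"

definition C1_half_graph ::
  "'h::real_normed_vector set \<Rightarrow> ('h \<Rightarrow> 'h) \<Rightarrow> (real \<Rightarrow> 'h) \<Rightarrow> bool" where
  "C1_half_graph D B u \<longleftrightarrow> (\<forall>t\<ge>0. u t \<in> D) \<and>
     (\<exists>v. C0_half_graph D B v \<and>
        (\<forall>t\<ge>0. ((\<lambda>s. (u s, B (u s))) has_vector_derivative (v t, B (v t))) (at t within {0..})))"


subsection \<open>The Cauchy problem\<close>

definition is_solution ::
  "'h::real_inner set \<Rightarrow> ('h \<Rightarrow> 'h) \<Rightarrow> real \<Rightarrow> real \<Rightarrow> (real \<Rightarrow> real) \<Rightarrow> 'h \<Rightarrow> 'h \<Rightarrow> (real \<Rightarrow> 'h) \<Rightarrow> bool"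
where
  "is_solution D A p \<epsilon> c u0 u1 u \<longleftrightarrow>
     C2_half u \<and>
     C1_half_graph (power_dom D A (1/2)) (power_op D A (1/2)) u \<and>
     C0_half_graph D A u \<and>
     (\<forall>t\<ge>0. \<epsilon> *\<^sub>R hderiv (hderiv u) t + (1 / (1 + t) powr p) *\<^sub>R hderiv u t
             + c t *\<^sub>R A (u t) = 0) \<and>
     u 0 = u0 \<and> hderiv u 0 = u1"

definition Gamma_energy ::
  "'h::real_inner set \<Rightarrow> ('h \<Rightarrow> 'h) \<Rightarrow> real \<Rightarrow> (real \<Rightarrow> 'h) \<Rightarrow> real \<Rightarrow> real" where
  "Gamma_energy D A \<epsilon> u t =
     (norm (u t))\<^sup>2 + (norm (power_op D A (1/2) (u t)))\<^sup>2 + (norm (A (u t)))\<^sup>2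
     + (norm (hderiv u t))\<^sup>2 + \<epsilon> * (norm (power_op D A (1/2) (hderiv u t)))\<^sup>2"

end

theory Submission imports Defs "HOL-Probability.Distribution_Functions"
begin

text \<open>Spectral resolution. Let \<open>T\<close> be the bounded inverse of \<open>A\<close>. Since \<open>n \<mapsto> |T\<^sup>n x|\<close> is log-convex,
  the vectors with \<open>|T\<^sup>n x| = O(r\<^sup>n)\<close> satisfy \<open>|T\<^sup>n x| \<le> r\<^sup>n |x|\<close>; they form the spectral subspace of
  \<open>T\<close> for \<open>[0, r]\<close>, and their orthogonal complements give a resolution of the identity \<open>E\<close> for \<open>A\<close>.
  Riemann sums with respect to \<open>E\<close> define \<open>A\<close> and its square root.

  Existence. On the range of \<open>E n\<close> the equation is a linear ODE with bounded coefficients. The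
  energy \<open>\<epsilon> |A\<^sup>1\<^sup>/\<^sup>2 u'|\<^sup>2 + c |A u|\<^sup>2\<close> bounds differences of truncated solutions, which therefore
  converge locally uniformly; a solution is determined by its truncations.

  Decay. Let \<open>b = (1 + t)\<^sup>-\<^sup>p\<close>. The functional
  \<open>Z = \<epsilon> |A\<^sup>1\<^sup>/\<^sup>2 u'|\<^sup>2 / c + |A u|\<^sup>2 + k b (2 \<epsilon> \<langle>u', A u\<rangle> + b \<langle>A u, u\<rangle>)\<close> satisfies \<open>Z' \<le> - \<gamma> b Z\<close> once
  \<open>\<gamma> b\<^sup>2 < 2 \<mu> \<nu>\<close>, \<open>k\<close> is large and \<open>\<epsilon>\<close> is small. For \<open>p = 0\<close> this is the restriction on \<open>\<beta>\<close>; for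
  \<open>p > 0\<close> it holds for all large \<open>t\<close> because \<open>b\<close> tends to 0. The remaining term \<open>|u'|\<^sup>2\<close> obeys a
  scalar differential inequality with source \<open>|A u|\<^sup>2 / b\<^sup>2\<close>, so that \<open>b\<^sup>2 |u'|\<^sup>2\<close> decays at the same
  rate, and the factor \<open>b\<^sup>-\<^sup>2\<close> is absorbed by increasing \<open>\<gamma>\<close>.\<close>

section \<open>Orthogonal projections\<close>

text \<open>A solution has \<open>u'\<close> only in \<open>V\<close>, so the energy identity, which
  contains the product of \<open>A u\<close> and \<open>A u'\<close>, makes no sense for it. The
  projections \<open>E n\<close> commute with \<open>A\<close> and with the scalar coefficients; a
  projected solution solves the same equation in a space where \<open>A\<close> is bounded. All
  estimates are made there with constants independent of \<open>n\<close>, and then \<open>n\<close>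
  tends to infinity. Hence the spectral resolution precedes every energy estimate. The threshold for
  the rate comes from the terms of \<open>Z'\<close> proportional to \<open>k * Q\<close>: the cross
  term yields \<open>- 2 * \<mu>\<close>, and \<open>\<gamma>\<close> times the part of
  \<open>Z\<close> with \<open>A u \<bullet> u\<close> yields
  \<open>\<gamma> * b\<^sup>2 / \<nu>\<close>. Their sum is negative exactly when
  \<open>\<gamma> * b\<^sup>2 < 2 * \<mu> * \<nu>\<close>, and a large \<open>k\<close> lets it
  outweigh the term \<open>\<gamma> * Q\<close>, which carries no \<open>k\<close>. All remaining
  harmful terms carry a factor \<open>\<epsilon>\<close>, so \<open>\<epsilon>\<close> is made small
  after \<open>k\<close> is fixed.\<close>

lemma parallelogram_law:
  fixes x y :: "'a::real_inner"
  shows "(norm (x + y))\<^sup>2 + (norm (x - y))\<^sup>2 = 2 * (norm x)\<^sup>2 + 2 * (norm y)\<^sup>2"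
  by (simp add: power2_norm_eq_inner inner_simps inner_commute)

text \<open>This takes the place of weak compactness of balls. Points of almost minimal norm form a
  Cauchy sequence by the parallelogram law, because the distances of the sets from 0 increase to a
  finite limit.\<close>

lemma nested_closed_convex_Inter_nonempty:
  fixes C :: "nat \<Rightarrow> 'h::{real_inner,complete_space} set"
  assumes cl: "\<And>n. closed (C n)" and cv: "\<And>n. convex (C n)" and dec: "decseq C"
    and bd: "\<And>n. \<exists>x\<in>C n. norm x \<le> R"
  shows "\<exists>x. \<forall>n. x \<in> C n"
proof -
  define d where "d n = infdist 0 (C n)" for n
  have ne: "C n \<noteq> {}" for n using bd by blast
  have d_le: "d n \<le> norm x" if "x \<in> C n" for n x
    using infdist_le[OF that, of 0] by (simp add: d_def)
  have d0: "0 \<le> d n" for n by (simp add: d_def infdist_nonneg)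
  have sub: "C m \<subseteq> C n" if "n \<le> m" for m n using dec that by (simp add: decseq_def)
  have "incseq d"
    unfolding incseq_def d_def using infdist_mono[OF sub] ne by blast
  moreover have "d n \<le> R" for n using bd[of n] d_le by force
  ultimately obtain L where L: "d \<longlonglongrightarrow> L" by (metis incseq_convergent)
  have "\<exists>x\<in>C n. norm x < d n + 1 / Suc n" for n
    using infdist_notempty[OF ne[of n], of 0] cINF_less_iff[OF ne[of n] bdd_belowI2[where m=0], of "dist 0" "d n + 1 / Suc n"]
    by (simp add: d_def)
  then obtain x where xC: "x n \<in> C n" and xd: "norm (x n) < d n + 1 / Suc n" for n by metis
  \<comment> \<open>The sets decrease, so the midpoint of \<open>x n\<close> and \<open>x m\<close>
    stays in \<open>C n\<close> and has norm at least \<open>d n\<close>.\<close>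
  have key: "(norm (x n - x m))\<^sup>2 \<le> 2 * (d n + 1 / Suc n)\<^sup>2 + 2 * (d m + 1 / Suc m)\<^sup>2 - 4 * (d n)\<^sup>2"
    if "n \<le> m" for m n
  proof -
    have "(1/2) *\<^sub>R x n + (1/2) *\<^sub>R x m \<in> C n"
      by (rule convexD[OF cv]) (use xC sub[OF that] in auto)
    then have "d n \<le> norm ((1/2) *\<^sub>R (x n + x m))" using d_le by (simp add: scaleR_add_right)
    then have "2 * d n \<le> norm (x n + x m)" by simp
    then have "(2 * d n)\<^sup>2 \<le> (norm (x n + x m))\<^sup>2" using d0 by (intro power_mono) auto
    moreover have "(norm (x n))\<^sup>2 \<le> (d n + 1 / Suc n)\<^sup>2" "(norm (x m))\<^sup>2 \<le> (d m + 1 / Suc m)\<^sup>2"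
      using less_imp_le[OF xd] by (auto intro!: power_mono simp del: of_nat_Suc)
    ultimately show ?thesis using parallelogram_law[of "x n" "x m"] by (simp add: power_mult_distrib)
  qed
  have s: "(\<lambda>n. (d n + 1 / Suc n)\<^sup>2) \<longlonglongrightarrow> L\<^sup>2"
    using tendsto_power[OF tendsto_add[OF L LIMSEQ_inverse_real_of_nat], of 2] by (simp add: inverse_eq_divide)
  have s2: "(\<lambda>n. (d n)\<^sup>2) \<longlonglongrightarrow> L\<^sup>2" by (intro tendsto_intros L)
  have "Cauchy x"
  proof (rule metric_CauchyI)
    fix e :: real assume "e > 0"
    then have e8: "e\<^sup>2 / 8 > 0" by simp
    from s have "\<forall>\<^sub>F n in sequentially. (d n + 1 / Suc n)\<^sup>2 < L\<^sup>2 + e\<^sup>2/8"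
      using e8 by (intro order_tendstoD(2)) auto
    moreover from s2 have "\<forall>\<^sub>F n in sequentially. (d n)\<^sup>2 > L\<^sup>2 - e\<^sup>2/8"
      using e8 by (intro order_tendstoD(1)) auto
    ultimately have "\<forall>\<^sub>F n in sequentially. (d n + 1 / Suc n)\<^sup>2 < L\<^sup>2 + e\<^sup>2/8 \<and> (d n)\<^sup>2 > L\<^sup>2 - e\<^sup>2/8"
      by (rule eventually_conj)
    then obtain N where N: "\<And>n. n \<ge> N \<Longrightarrow> (d n + 1 / Suc n)\<^sup>2 < L\<^sup>2 + e\<^sup>2/8 \<and> (d n)\<^sup>2 > L\<^sup>2 - e\<^sup>2/8"
      by (auto simp: eventually_sequentially)
    have *: "norm (x n - x m) < e" if "N \<le> n" "n \<le> m" for m n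
    proof -
      have "(norm (x n - x m))\<^sup>2 < e\<^sup>2" using key[OF that(2)] N[of n] N[of m] that by linarith
      then show ?thesis using \<open>e > 0\<close> by (simp add: power2_less_imp_less)
    qed
    show "\<exists>M. \<forall>m\<ge>M. \<forall>n\<ge>M. dist (x m) (x n) < e"
      by (metis * dist_norm dist_commute nle_le)
  qed
  then obtain l where l: "x \<longlonglongrightarrow> l" using Cauchy_convergent_iff convergent_def by blast
  have "l \<in> C n" for n
  proof (rule closed_sequentially[OF cl])
    show "(\<lambda>k. x (k + n)) \<longlonglongrightarrow> l" using l by (rule LIMSEQ_ignore_initial_segment)
    show "x (k + n) \<in> C n" for k using xC[of "k+n"] sub[of n "k+n"] by auto
  qed
  then show ?thesis by blast
qed

text \<open>The optimal \<open>t\<close> lowers the squared norm by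
  \<open>(z \<bullet> y)\<^sup>2 / (y \<bullet> y)\<close>, so minimality forces this quantity to
  vanish.\<close>

lemma inner_eq_0_if_norm_minimal:
  fixes z y :: "'a::real_inner"
  assumes "\<And>t. norm z \<le> norm (z - t *\<^sub>R y)"
  shows "z \<bullet> y = 0"
proof (cases "y = 0")
  case False
  define t where "t = (z \<bullet> y) / (y \<bullet> y)"
  have yy: "y \<bullet> y > 0" using False by simp
  have "(norm z)\<^sup>2 \<le> (norm (z - t *\<^sub>R y))\<^sup>2" using assms[of t] by (intro power_mono) auto
  also have "\<dots> = (norm z)\<^sup>2 - 2 * t * (z \<bullet> y) + t\<^sup>2 * (y \<bullet> y)"
    unfolding power2_norm_eq_inner by (simp add: inner_simps inner_commute power2_eq_square algebra_simps)
  also have "\<dots> = (norm z)\<^sup>2 - (z \<bullet> y)\<^sup>2 / (y \<bullet> y)"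
    using yy by (simp add: t_def field_simps power2_eq_square)
  finally have "(z \<bullet> y)\<^sup>2 / (y \<bullet> y) \<le> 0" by simp
  then show ?thesis using yy by (simp add: divide_le_0_iff power2_less_eq_zero_iff)
qed simp

lemma projection_exists:
  fixes M :: "'h::{real_inner,complete_space} set"
  assumes "closed M" "subspace M"
  shows "\<exists>p\<in>M. \<forall>y\<in>M. (x - p) \<bullet> y = 0"
proof -
  define d where "d = infdist x M"
  \<comment> \<open>A common point of these sets is a difference \<open>x - p\<close> with
    \<open>p\<close> in \<open>M\<close> and norm at most \<open>d\<close>, so it realises the
    distance of \<open>x\<close> to \<open>M\<close>.\<close>
  define C where "C n = {z. x - z \<in> M \<and> norm z \<le> d + 1 / Suc n}" for n :: nat
  have ne: "M \<noteq> {}" using assms(2) subspace_0 by blast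
  have "\<exists>z. \<forall>n. z \<in> C n"
  proof (rule nested_closed_convex_Inter_nonempty)
    fix n
    have "C n = (\<lambda>z. x - z) -` M \<inter> cball 0 (d + 1 / Suc n)" by (auto simp: C_def)
    moreover have "closed ((\<lambda>z. x - z) -` M)"
      by (intro continuous_closed_vimage assms continuous_intros)
    ultimately show "closed (C n)" by auto
    show "convex (C n)"
    proof (rule convexI)
      fix a b and u v :: real
      assume ab: "a \<in> C n" "b \<in> C n" and uv: "0 \<le> u" "0 \<le> v" "u + v = 1"
      have "x - (u *\<^sub>R a + v *\<^sub>R b) = u *\<^sub>R (x - a) + v *\<^sub>R (x - b)"
        using uv by (simp add: algebra_simps flip: scaleR_add_left)
      moreover have "u *\<^sub>R (x - a) + v *\<^sub>R (x - b) \<in> M"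
        using ab assms(2) by (auto simp: C_def intro!: subspace_add subspace_scale)
      moreover have "norm (u *\<^sub>R a + v *\<^sub>R b) \<le> u * norm a + v * norm b"
        using uv by (metis norm_triangle_ineq norm_scaleR abs_of_nonneg)
      moreover have "u * norm a + v * norm b \<le> d + 1 / Suc n"
        using ab uv by (intro convex_bound_le) (auto simp: C_def)
      ultimately show "u *\<^sub>R a + v *\<^sub>R b \<in> C n" by (simp add: C_def)
    qed
    show "\<exists>z\<in>C n. norm z \<le> d + 1"
    proof -
      have "\<exists>y\<in>M. dist x y < d + 1 / Suc n"
        using infdist_notempty[OF ne, of x] cINF_less_iff[OF ne bdd_belowI2[where m=0], of "dist x" "d + 1 / Suc n"]
        by (simp add: d_def)
      then obtain y where y: "y \<in> M" "dist x y < d + 1 / Suc n" by blast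
      have "1 / real (Suc n) \<le> 1" by simp
      then have "norm (x - y) \<le> d + 1" using y(2) unfolding dist_norm by linarith
      then show ?thesis using y by (intro bexI[of _ "x - y"]) (auto simp: C_def dist_norm)
    qed
  next
    show "decseq C" unfolding decseq_def C_def
    proof safe
      fix m n :: nat and z
      assume "m \<le> n" "norm z \<le> d + 1 / real (Suc n)"
      moreover have "1 / real (Suc n) \<le> 1 / real (Suc m)" using \<open>m \<le> n\<close> by (simp add: frac_le)
      ultimately show "norm z \<le> d + 1 / real (Suc m)" by linarith
    qed
  qed
  then obtain z where z: "\<And>n. z \<in> C n" by blast
  have "norm z \<le> d"
  proof (rule LIMSEQ_le_const)
    show "(\<lambda>n. d + inverse (real (Suc n))) \<longlonglongrightarrow> d" by (rule LIMSEQ_inverse_real_of_nat_add)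
    show "\<exists>N. \<forall>n\<ge>N. norm z \<le> d + inverse (real (Suc n))" using z by (auto simp: C_def inverse_eq_divide)
  qed
  have xz: "x - z \<in> M" using z by (simp add: C_def)
  have "z \<bullet> y = 0" if y: "y \<in> M" for y
  proof (rule inner_eq_0_if_norm_minimal)
    fix t :: real
    have "x - z + t *\<^sub>R y \<in> M" using xz y assms(2) by (simp add: subspace_add subspace_scale)
    then have "d \<le> dist x (x - z + t *\<^sub>R y)" unfolding d_def by (rule infdist_le)
    then show "norm z \<le> norm (z - t *\<^sub>R y)" using \<open>norm z \<le> d\<close> by (simp add: dist_norm)
  qed
  then show ?thesis using xz by (intro bexI[of _ "x - z"]) auto
qed

definition proj :: "'h::real_inner set \<Rightarrow> 'h \<Rightarrow> 'h" where
  "proj M x = (SOME p. p \<in> M \<and> (\<forall>y\<in>M. (x - p) \<bullet> y = 0))"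

context
  fixes M :: "'h::{real_inner,complete_space} set"
  assumes cl: "closed M" and ss: "subspace M"
begin

lemma proj_in: "proj M x \<in> M"
  and proj_orth: "y \<in> M \<Longrightarrow> (x - proj M x) \<bullet> y = 0"
proof -
  have "\<exists>p. p \<in> M \<and> (\<forall>y\<in>M. (x - p) \<bullet> y = 0)" using projection_exists[OF cl ss] by blast
  from someI_ex[OF this] show "proj M x \<in> M" "y \<in> M \<Longrightarrow> (x - proj M x) \<bullet> y = 0"
    unfolding proj_def by auto
qed

lemma proj_unique:
  assumes "p \<in> M" "\<And>y. y \<in> M \<Longrightarrow> (x - p) \<bullet> y = 0"
  shows "proj M x = p"
proof -
  have d: "proj M x - p \<in> M" using assms(1) proj_in ss by (simp add: subspace_diff)
  have "(proj M x - p) \<bullet> (proj M x - p) = (x - p) \<bullet> (proj M x - p) - (x - proj M x) \<bullet> (proj M x - p)"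
    by (simp add: inner_simps)
  also have "\<dots> = 0" using assms(2)[OF d] proj_orth[OF d] by simp
  finally show ?thesis by simp
qed

lemma proj_id: "x \<in> M \<Longrightarrow> proj M x = x"
  by (rule proj_unique) auto

lemma proj_pythagoras: "(norm x)\<^sup>2 = (norm (proj M x))\<^sup>2 + (norm (x - proj M x))\<^sup>2"
proof -
  have "(x - proj M x) \<bullet> proj M x = 0" using proj_orth proj_in by blast
  then show ?thesis by (simp add: power2_norm_eq_inner inner_simps inner_commute)
qed

lemma proj_norm_le: "norm (proj M x) \<le> norm x"
proof -
  have "(norm (proj M x))\<^sup>2 \<le> (norm x)\<^sup>2" using proj_pythagoras[of x] by simp
  then show ?thesis by (rule power2_le_imp_le) simp
qed

lemma proj_sym: "proj M x \<bullet> y = x \<bullet> proj M y"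
  using proj_orth[OF proj_in[of y], of x] proj_orth[OF proj_in[of x], of y]
  by (simp add: inner_simps inner_commute)

lemma proj_bounded_linear: "bounded_linear (proj M)"
proof (rule bounded_linear_intro[where K=1])
  show "proj M (x + y) = proj M x + proj M y" for x y
  proof (rule proj_unique)
    fix z assume "z \<in> M"
    then show "(x + y - (proj M x + proj M y)) \<bullet> z = 0"
      using proj_orth[of z x] proj_orth[of z y] by (simp add: inner_simps)
  qed (use proj_in ss in \<open>simp add: subspace_add\<close>)
  show "proj M (r *\<^sub>R x) = r *\<^sub>R proj M x" for r x
  proof (rule proj_unique)
    fix z assume "z \<in> M"
    then show "(r *\<^sub>R x - r *\<^sub>R proj M x) \<bullet> z = 0"
      using proj_orth[of z x] by (simp add: inner_simps flip: scaleR_diff_right)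
  qed (use proj_in ss in \<open>simp add: subspace_scale\<close>)
  show "norm (proj M x) \<le> norm x * 1" for x using proj_norm_le by simp
qed

lemma proj_orthogonal_projection: "orthogonal_projection (proj M)"
  unfolding orthogonal_projection_def using proj_bounded_linear proj_sym proj_id proj_in by auto

end

lemma closed_image_bounded_below:
  fixes B :: "'h::{real_normed_vector,complete_space} \<Rightarrow> 'h"
  assumes "closed M" "subspace M" "bounded_linear B" "c > 0"
    and lb: "\<And>x. x \<in> M \<Longrightarrow> c * norm x \<le> norm (B x)"
  shows "closed (B ` M)"
proof -
  interpret B: bounded_linear B by fact
  have "z \<in> B ` M" if yB: "\<And>n. y n \<in> B ` M" and lim: "y \<longlonglongrightarrow> z" for y z
  proof -
    obtain x where x: "\<And>n. x n \<in> M" "\<And>n. y n = B (x n)" using yB unfolding image_iff by metis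
    have "Cauchy x"
    proof (rule metric_CauchyI)
      fix e :: real assume "e > 0"
      then obtain N where N: "\<And>m n. m \<ge> N \<Longrightarrow> n \<ge> N \<Longrightarrow> dist (y m) (y n) < c * e"
        using metric_CauchyD[OF LIMSEQ_imp_Cauchy[OF lim], of "c * e"] \<open>c > 0\<close> by auto
      have "dist (x m) (x n) < e" if "m \<ge> N" "n \<ge> N" for m n
      proof -
        have "c * norm (x m - x n) \<le> norm (B (x m - x n))" using x assms(2) by (intro lb) (simp add: subspace_diff)
        also have "\<dots> < c * e" using N[OF that] by (simp add: dist_norm x B.diff)
        finally show ?thesis using \<open>c > 0\<close> by (simp add: dist_norm)
      qed
      then show "\<exists>M. \<forall>m\<ge>M. \<forall>n\<ge>M. dist (x m) (x n) < e" by blast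
    qed
    then obtain l where l: "x \<longlonglongrightarrow> l" using Cauchy_convergent_iff convergent_def by blast
    then have "l \<in> M" using closed_sequentially[OF assms(1)] x by blast
    moreover have "y \<longlonglongrightarrow> B l" using B.tendsto[OF l] unfolding x(2)[symmetric] .
    then have "z = B l" using lim LIMSEQ_unique by blast
    ultimately show ?thesis by blast
  qed
  then show ?thesis unfolding closed_sequential_limits by blast
qed

text \<open>The lower bound makes the range closed. If \<open>w\<close> in \<open>M\<close> is
  orthogonal to the range, symmetry turns \<open>B w \<bullet> B w\<close> into
  \<open>w \<bullet> B (B w)\<close>, which is 0, so \<open>w = 0\<close>.\<close>

lemma symmetric_bounded_below_surj:
  fixes B :: "'h::{real_inner,complete_space} \<Rightarrow> 'h"
  assumes "closed M" "subspace M" "bounded_linear B" "c > 0"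
    and lb: "\<And>x. x \<in> M \<Longrightarrow> c * norm x \<le> norm (B x)"
    and inv: "\<And>x. x \<in> M \<Longrightarrow> B x \<in> M"
    and sym: "\<And>x y. x \<in> M \<Longrightarrow> y \<in> M \<Longrightarrow> B x \<bullet> y = x \<bullet> B y"
  shows "B ` M = M"
proof (intro equalityI subsetI)
  interpret B: bounded_linear B by fact
  fix y assume y: "y \<in> M"
  have cl: "closed (B ` M)" using assms by (intro closed_image_bounded_below) auto
  have ss: "subspace (B ` M)" using assms(2) by (rule linear_subspace_image[OF B.linear])
  define p where "p = proj (B ` M) y"
  have pB: "p \<in> B ` M" unfolding p_def by (rule proj_in[OF cl ss])
  then have "p \<in> M" using inv by auto
  then have q: "y - p \<in> M" using y assms(2) by (simp add: subspace_diff)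
  have "B (y - p) \<bullet> B (y - p) = (y - p) \<bullet> B (B (y - p))" using q inv sym by blast
  also have "\<dots> = 0" unfolding p_def using q inv by (intro proj_orth[OF cl ss]) (auto simp: p_def)
  finally have "y - p = 0" using lb[OF q] \<open>c > 0\<close>
    by (metis inner_eq_zero_iff mult_le_0_iff norm_eq_zero norm_le_zero_iff not_less)
  then show "y \<in> B ` M" using pB by simp
qed (use inv in auto)

section \<open>Spectral subspaces of a symmetric operator\<close>

context
  fixes a :: "nat \<Rightarrow> real"
  assumes nonneg: "\<And>n. 0 \<le> a n"
    and logconvex: "\<And>n. (a (Suc n))\<^sup>2 \<le> a n * a (Suc (Suc n))"
begin

lemma logconvex_increasing_step:
  assumes "a n \<le> a (Suc n)" shows "a (Suc n) \<le> a (Suc (Suc n))"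
proof (cases "a (Suc n) = 0")
  case False
  then have pos: "a (Suc n) > 0" using nonneg[of "Suc n"] by simp
  have "a (Suc n) * a (Suc n) \<le> a n * a (Suc (Suc n))" using logconvex[of n] by (simp add: power2_eq_square)
  also have "\<dots> \<le> a (Suc n) * a (Suc (Suc n))" using assms nonneg by (simp add: mult_right_mono)
  finally show ?thesis using pos by simp
qed (use nonneg in simp)

lemma logconvex_increasing_from:
  assumes "a n \<le> a (Suc n)" "n \<le> i" "i \<le> j" shows "a i \<le> a j"
proof -
  have st: "a k \<le> a (Suc k)" if "n \<le> k" for k
    using that by (induction rule: dec_induct) (use assms(1) logconvex_increasing_step in auto)
  show ?thesis using \<open>i \<le> j\<close>
  proof (induction rule: dec_induct)
    case (step k) then show ?case using st[of k] \<open>n \<le> i\<close> by simp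
  qed simp
qed

text \<open>A convex sequence is largest at an end. Zeros are allowed, so the proof looks at steps
  instead of logarithms: if no step before \<open>j\<close> goes up, \<open>a j \<le> a 0\<close>;
  otherwise the sequence is nondecreasing from that step to \<open>N\<close>.\<close>

lemma logconvex_le_endpoints:
  assumes "j \<le> N" "a 0 \<le> c" "a N \<le> c" shows "a j \<le> c"
proof (cases "\<exists>i<j. a i \<le> a (Suc i)")
  case True
  then obtain i where "i < j" "a i \<le> a (Suc i)" by blast
  then have "a j \<le> a N" using logconvex_increasing_from[of i j N] assms by simp
  then show ?thesis using assms by simp
next
  case False
  have "a k \<le> a 0" if "k \<le> j" for k using that
    by (induction k) (use False in \<open>fastforce simp: Suc_le_eq not_le\<close>)+
  then show ?thesis using assms by force
qed

text \<open>If every step from \<open>m\<close> to \<open>N\<close> went down, \<open>a N\<close>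
  would lie below \<open>a m\<close>; and one step that does not go down prevents all later ones
  from going down.\<close>

lemma logconvex_next_increasing:
  assumes "m < N" "a m \<le> a N" shows "a N \<le> a (Suc N)"
proof (cases "\<exists>i. m \<le> i \<and> i < N \<and> a i \<le> a (Suc i)")
  case True
  then obtain i where "i < N" "a i \<le> a (Suc i)" by blast
  then show ?thesis using logconvex_increasing_from[of i N "Suc N"] by simp
next
  case False
  have "a k < a m" if "Suc m \<le> k" "k \<le> N" for k using that
  proof (induction k rule: dec_induct)
    case base
    then have "m < N" by simp
    then show ?case using False by force
  next
    case (step k)
    then have "a (Suc k) < a k" using False by (metis Suc_leD Suc_le_lessD not_le)
    then show ?case using step by simp
  qed
  then show ?thesis using assms by (metis Suc_leI le_refl not_le)
qed

text \<open>The quotients of consecutive terms do not decrease, so one strict increase with quotient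
  \<open>q > 1\<close> would force growth at least like \<open>q ^ k\<close>.\<close>

lemma logconvex_bounded_decreasing:
  assumes bd: "\<And>n. a n \<le> C" shows "a (Suc n) \<le> a n"
proof (rule ccontr)
  assume "\<not> a (Suc n) \<le> a n"
  then have lt: "a n < a (Suc n)" by simp
  have "a n \<noteq> 0"
  proof
    assume "a n = 0"
    then have "(a (Suc n))\<^sup>2 \<le> 0" using logconvex[of n] by simp
    then show False using lt \<open>a n = 0\<close> by simp
  qed
  then have an: "a n > 0" using nonneg[of n] by simp
  define q where "q = a (Suc n) / a n"
  have q: "q > 1" using lt an by (simp add: q_def)
  have st: "a (n + k) > 0 \<and> q * a (n + k) \<le> a (Suc (n + k))" for k
  proof (induction k)
    case (Suc k)
    let ?m = "n + k"
    have p: "a ?m > 0" "q * a ?m \<le> a (Suc ?m)" using Suc by auto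
    then have p2: "a (Suc ?m) > 0" using q by (smt (verit) mult_pos_pos)
    have "q * a ?m * a (Suc ?m) \<le> a (Suc ?m) * a (Suc ?m)" using p p2 by (intro mult_right_mono) auto
    also have "\<dots> \<le> a ?m * a (Suc (Suc ?m))" using logconvex[of ?m] by (simp add: power2_eq_square)
    finally have "a ?m * (q * a (Suc ?m)) \<le> a ?m * a (Suc (Suc ?m))" by (simp add: mult_ac)
    then show ?case using p p2 by simp
  qed (use an q_def in auto)
  have gr: "q ^ k * a n \<le> a (n + k)" for k
  proof (induction k)
    case (Suc k)
    have "q ^ Suc k * a n = q * (q ^ k * a n)" by simp
    also have "\<dots> \<le> q * a (n + k)" using Suc q by (intro mult_left_mono) auto
    also have "\<dots> \<le> a (n + Suc k)" using st[of k] by simp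
    finally show ?case .
  qed simp
  obtain k where "C / a n < q ^ k" using real_arch_pow[OF q] by blast
  then have "C < q ^ k * a n" using an by (simp add: field_simps)
  then show False using gr[of k] bd[of "n + k"] by simp
qed

end

text \<open>Division by \<open>r ^ n\<close> keeps log-convexity, and a bounded log-convex sequence
  decreases; so an arbitrary constant \<open>C\<close> improves to \<open>a 0\<close>.\<close>

lemma logconvex_geometric_bound:
  fixes a :: "nat \<Rightarrow> real"
  assumes "\<And>n. 0 \<le> a n" "\<And>n. (a (Suc n))\<^sup>2 \<le> a n * a (Suc (Suc n))" "r > 0"
    and "\<And>n. a n \<le> C * r ^ n"
  shows "a n \<le> r ^ n * a 0"
proof -
  define b where "b n = a n / r ^ n" for n
  have dec: "b (Suc n) \<le> b n" for n
  proof (rule logconvex_bounded_decreasing[where C = C])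
    fix k show "0 \<le> b k" using assms by (simp add: b_def)
    show "b k \<le> C" using assms by (simp add: b_def field_simps)
    show "(b (Suc k))\<^sup>2 \<le> b k * b (Suc (Suc k))"
    proof -
      have "(b (Suc k))\<^sup>2 = (a (Suc k))\<^sup>2 / r ^ (2 * Suc k)"
        by (simp add: b_def power_divide power_mult[symmetric] mult.commute del: power_Suc mult_Suc_right mult_Suc)
      also have "\<dots> \<le> (a k * a (Suc (Suc k))) / r ^ (2 * Suc k)" using assms by (intro divide_right_mono) auto
      also have "\<dots> = b k * b (Suc (Suc k))"
        by (simp add: b_def power_add[symmetric] mult_2 del: power_Suc)
      finally show ?thesis .
    qed
  qed
  have "b n \<le> b 0" by (induction n) (use dec order_trans in blast)+
  then show ?thesis using assms by (simp add: b_def field_simps)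
qed

section \<open>Growth subspaces of a bounded symmetric operator\<close>

locale symmetric_operator =
  fixes T :: "'h::{real_inner,complete_space} \<Rightarrow> 'h"
  assumes bl: "bounded_linear T" and sym: "\<And>x y. T x \<bullet> y = x \<bullet> T y"
begin

lemma pow_bl: "bounded_linear (T ^^ n)"
  by (induction n) (auto simp: id_def o_def bounded_linear_ident intro: bounded_linear_compose[OF bl])

lemma pow_sym: "(T ^^ n) x \<bullet> y = x \<bullet> (T ^^ n) y"
  by (induction n arbitrary: x y) (simp_all add: sym funpow_swap1)

lemma pow_logconvex:
  "(norm ((T ^^ Suc n) x))\<^sup>2 \<le> norm ((T ^^ n) x) * norm ((T ^^ Suc (Suc n)) x)"
proof -
  have "(norm ((T ^^ Suc n) x))\<^sup>2 = (T ^^ n) x \<bullet> (T ^^ Suc (Suc n)) x"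
    by (simp add: power2_norm_eq_inner sym)
  also have "\<dots> \<le> norm ((T ^^ n) x) * norm ((T ^^ Suc (Suc n)) x)" by (rule norm_cauchy_schwarz)
  finally show ?thesis .
qed

lemmas pow_increasing = logconvex_next_increasing[where a = "\<lambda>n. norm ((T ^^ n) x)" for x,
    OF norm_ge_zero pow_logconvex]
lemmas pow_endpoints = logconvex_le_endpoints[where a = "\<lambda>n. norm ((T ^^ n) x)" for x,
    OF norm_ge_zero pow_logconvex]

text \<open>\<open>x\<close> plays the role of the projection of \<open>a\<close> to the spectral subspace \<open>|T| \<le> 1\<close>: it is a
  limit of convex combinations of the vectors \<open>(1 + T\<^bsup>2m\<^esup>)\<^sup>-\<^sup>1 a\<close>.\<close>

lemma contractive_vector_exists:
  assumes lt: "norm (T a) < norm a"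
  shows "\<exists>x. (\<forall>n. norm ((T ^^ n) x) \<le> norm a) \<and> x \<bullet> a > 0"
proof -
  obtain K where K: "K > 0" "\<And>x. norm (T x) \<le> norm x * K" using bounded_linear.pos_bounded[OF bl] by blast
  define \<eta> where "\<eta> = norm a - norm (T a)"
  have \<eta>: "\<eta> > 0" using lt by (simp add: \<eta>_def)
  have a0: "norm a > 0" using lt by (metis norm_ge_zero le_less_trans)
  \<comment> \<open>Both bounds serve the contradiction below. If \<open>b\<close> and
    \<open>(T ^^ m) b\<close> were shorter than \<open>\<tau>\<close>, the first bound would make
    \<open>(T ^^ (2 * m)) b\<close> at least as long as \<open>(T ^^ m) b\<close>, and the second
    makes \<open>(1 + K) * \<tau>\<close> smaller than the gap \<open>\<eta>\<close>.\<close>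
  define \<tau> where "\<tau> = min (norm a / 2) (\<eta> / (2 * (1 + K)))"
  have \<tau>: "\<tau> > 0" using a0 \<eta> K by (simp add: \<tau>_def)
  have \<tau>2: "(1 + K) * \<tau> \<le> \<eta> / 2"
  proof -
    have "(1 + K) * \<tau> \<le> (1 + K) * (\<eta> / (2 * (1 + K)))" using K by (intro mult_left_mono) (auto simp: \<tau>_def)
    also have "\<dots> = \<eta> / 2" using K by (simp add: field_simps)
    finally show ?thesis .
  qed
  have b: "\<exists>b. norm b \<le> norm a \<and> norm ((T ^^ (2 * m)) b) \<le> norm a \<and> \<tau>\<^sup>2 \<le> b \<bullet> a" if m: "m > 0" for m
  proof -
    let ?P = "T ^^ (2 * m)"
    have bp: "bounded_linear (\<lambda>x. x + ?P x)" by (intro bounded_linear_add bounded_linear_ident pow_bl)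
    \<comment> \<open>The cross term is a square because the power is even; hence
      \<open>x + ?P x\<close> is at least as long as \<open>x\<close>, and this operator is
      onto.\<close>
    have ip: "x \<bullet> ?P x = (norm ((T ^^ m) x))\<^sup>2" for x
      unfolding power2_norm_eq_inner pow_sym mult_2 funpow_add o_def ..
    have sq: "(norm (x + ?P x))\<^sup>2 = (norm x)\<^sup>2 + 2 * (norm ((T ^^ m) x))\<^sup>2 + (norm (?P x))\<^sup>2" for x
      using ip[of x] dot_norm[of x "?P x"] by simp
    have lb: "1 * norm x \<le> norm (x + ?P x)" for x
    proof -
      have "(norm x)\<^sup>2 \<le> (norm (x + ?P x))\<^sup>2" unfolding sq by simp
      then have "norm x \<le> norm (x + ?P x)" by (rule power2_le_imp_le) simp
      then show ?thesis by simp
    qed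
    have sm: "(x + ?P x) \<bullet> y = x \<bullet> (y + ?P y)" for x y
      by (simp only: inner_add_left inner_add_right pow_sym)
    have "(\<lambda>x. x + ?P x) ` UNIV = UNIV"
      using symmetric_bounded_below_surj[OF closed_UNIV subspace_UNIV bp zero_less_one lb _ sm] by simp
    then obtain b where ab: "a = b + ?P b" by (metis UNIV_I image_iff)
    have s: "(norm a)\<^sup>2 = (norm b)\<^sup>2 + 2 * (norm ((T ^^ m) b))\<^sup>2 + (norm (?P b))\<^sup>2" using sq[of b] unfolding ab[symmetric] .
    have n1: "norm b \<le> norm a" and n2: "norm (?P b) \<le> norm a"
      by (rule power2_le_imp_le; simp add: s)+
    have ba: "b \<bullet> a = (norm b)\<^sup>2 + (norm ((T ^^ m) b))\<^sup>2"
      unfolding ab inner_add_right ip by (simp add: power2_norm_eq_inner)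
    have "\<tau>\<^sup>2 \<le> b \<bullet> a"
    proof (rule ccontr)
      assume "\<not> \<tau>\<^sup>2 \<le> b \<bullet> a"
      then have "(norm b)\<^sup>2 < \<tau>\<^sup>2" "(norm ((T ^^ m) b))\<^sup>2 < \<tau>\<^sup>2" using ba
        by (smt (verit) zero_le_power2)+
      then have l: "norm b < \<tau>" "norm ((T ^^ m) b) < \<tau>" using \<tau> by (auto intro: power2_less_imp_less)
      have t: "norm a \<le> norm b + norm (?P b)" unfolding ab by (rule norm_triangle_ineq)
      moreover have "\<tau> \<le> norm a / 2" unfolding \<tau>_def by (rule min.cobounded1)
      ultimately have "norm ((T ^^ m) b) \<le> norm (?P b)" using l by linarith
      \<comment> \<open>Since the norms do not drop between the powers \<open>m\<close> and
        \<open>2 * m\<close>, they do not drop at the next one either; but the next power of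
        \<open>b\<close> equals \<open>T a - T b\<close>, which is too short.\<close>
      then have "norm (?P b) \<le> norm ((T ^^ Suc (2 * m)) b)" using m by (intro pow_increasing[of m]) auto
      also have "(T ^^ Suc (2 * m)) b = T a - T b"
        unfolding ab by (simp add: linear_add[OF bounded_linear.linear[OF bl]])
      also have "norm \<dots> \<le> norm (T a) + norm b * K"
        using norm_triangle_ineq4[of "T a" "T b"] K(2)[of b] by linarith
      also have "norm b * K \<le> \<tau> * K" using l K by (intro mult_right_mono) auto
      finally have "norm a - \<tau> \<le> norm (T a) + \<tau> * K" using t l by linarith
      then show False using \<tau>2 \<eta> unfolding \<eta>_def by (simp add: algebra_simps)
    qed
    then show ?thesis using n1 n2 by blast
  qed
  \<comment> \<open>Finitely many powers are constrained at a time; the vector \<open>b\<close> for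
    \<open>m = Suc k\<close> qualifies, since a log-convex sequence is bounded by its values at 0
    and \<open>2 * Suc k\<close>. The bound \<open>\<tau>\<^sup>2\<close> does not depend on
    \<open>k\<close> and keeps the common point from being orthogonal to \<open>a\<close>.\<close>
  define C where "C k = {x. (\<forall>j\<le>k. norm ((T ^^ j) x) \<le> norm a) \<and> \<tau>\<^sup>2 \<le> x \<bullet> a}" for k
  have "\<exists>x. \<forall>k. x \<in> C k"
  proof (rule nested_closed_convex_Inter_nonempty)
    fix k
    have C_eq: "C k = (\<Inter>j\<in>{..k}. (T ^^ j) -` cball 0 (norm a)) \<inter> {x. \<tau>\<^sup>2 \<le> a \<bullet> x}"
      by (auto simp: C_def inner_commute)
    have cont: "continuous_on UNIV (T ^^ j)" for j
      using pow_bl by (rule linear_continuous_on)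
    show "closed (C k)" unfolding C_eq
      by (intro closed_Int closed_INT ballI closed_vimage cont closed_cball closed_halfspace_ge)
    show "convex (C k)" unfolding C_eq
      by (intro convex_Int convex_INT convex_linear_vimage convex_cball convex_halfspace_ge
          bounded_linear.linear pow_bl)
    obtain b where bb: "norm b \<le> norm a" "norm ((T ^^ (2 * Suc k)) b) \<le> norm a" "\<tau>\<^sup>2 \<le> b \<bullet> a" using b[of "Suc k"] by blast
    have "norm ((T ^^ j) b) \<le> norm a" if "j \<le> k" for j
    proof (rule pow_endpoints)
      show "j \<le> 2 * Suc k" using that by simp
      show "norm ((T ^^ 0) b) \<le> norm a" using bb(1) by simp
    qed (rule bb(2))
    then have "b \<in> C k" unfolding C_def using bb by blast
    then show "\<exists>x\<in>C k. norm x \<le> norm a" using bb by blast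
  next
    show "decseq C" by (auto simp: decseq_def C_def)
  qed
  then obtain x where x: "\<And>k. x \<in> C k" by blast
  have "norm ((T ^^ n) x) \<le> norm a" for n using x[of n] unfolding C_def by blast
  moreover have "\<tau>\<^sup>2 \<le> x \<bullet> a" using x[of 0] unfolding C_def by blast
  then have "x \<bullet> a > 0" using zero_less_power[OF \<tau>, of 2] by linarith
  ultimately show ?thesis by blast
qed

text \<open>With the constant \<open>norm x\<close> instead of an unspecified one closedness is
  evident; \<open>lowI\<close> restores the freedom in the constant that sums require.\<close>

definition low :: "real \<Rightarrow> 'h set" where
  "low r = {x. \<forall>n. norm ((T ^^ n) x) \<le> r ^ n * norm x}"

lemma lowI:
  assumes "r > 0" "\<And>n. norm ((T ^^ n) x) \<le> C * r ^ n"
  shows "x \<in> low r"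
proof -
  have "norm ((T ^^ n) x) \<le> r ^ n * norm x" for n
    using logconvex_geometric_bound[where a = "\<lambda>n. norm ((T ^^ n) x)", OF norm_ge_zero pow_logconvex assms]
    by simp
  then show ?thesis by (simp add: low_def)
qed

lemma low_norm_le: "x \<in> low r \<Longrightarrow> norm (T x) \<le> r * norm x"
  unfolding low_def by (drule CollectD, drule spec[of _ 1]) simp

lemma low_closed: "closed (low r)"
proof -
  have "low r = (\<Inter>n. {x. norm ((T ^^ n) x) \<le> r ^ n * norm x})" by (auto simp: low_def)
  moreover have "closed {x. norm ((T ^^ n) x) \<le> r ^ n * norm x}" for n
    by (intro closed_Collect_le continuous_intros linear_continuous_on pow_bl)
  ultimately show ?thesis by auto
qed

lemma low_subspace: assumes "r > 0" shows "subspace (low r)"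
proof (rule subspaceI)
  show "0 \<in> low r" by (simp add: low_def bounded_linear.linear[OF pow_bl] linear_0)
  fix x y assume xy: "x \<in> low r" "y \<in> low r"
  show "x + y \<in> low r"
  proof (rule lowI[OF assms])
    fix n
    have "norm ((T ^^ n) (x + y)) \<le> norm ((T ^^ n) x) + norm ((T ^^ n) y)"
      by (simp add: linear_add[OF bounded_linear.linear[OF pow_bl]] norm_triangle_ineq)
    also have "\<dots> \<le> r ^ n * norm x + r ^ n * norm y" using xy by (auto simp: low_def intro: add_mono)
    finally show "norm ((T ^^ n) (x + y)) \<le> (norm x + norm y) * r ^ n" by (simp add: algebra_simps)
  qed
next
  fix c x assume x: "x \<in> low r"
  show "c *\<^sub>R x \<in> low r"
  proof (rule lowI[OF assms])
    fix n
    have "norm ((T ^^ n) (c *\<^sub>R x)) = \<bar>c\<bar> * norm ((T ^^ n) x)" by (simp add: linear_scale[OF bounded_linear.linear[OF pow_bl]])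
    also have "\<dots> \<le> \<bar>c\<bar> * (r ^ n * norm x)" using x by (auto simp: low_def intro: mult_left_mono)
    finally show "norm ((T ^^ n) (c *\<^sub>R x)) \<le> (\<bar>c\<bar> * norm x) * r ^ n" by (simp add: mult_ac)
  qed
qed

lemma low_invariant: assumes "r > 0" "x \<in> low r" shows "T x \<in> low r"
proof (rule lowI[OF assms(1)])
  fix n
  have "norm ((T ^^ Suc n) x) \<le> r ^ Suc n * norm x" using assms(2) unfolding low_def by blast
  then show "norm ((T ^^ n) (T x)) \<le> (r * norm x) * r ^ n" by (simp add: funpow_swap1 mult_ac)
qed

lemma low_mono: assumes "0 \<le> r" "r \<le> s" shows "low r \<subseteq> low s"
  unfolding low_def using assms
  by (auto intro: order_trans[OF _ mult_right_mono[OF power_mono]])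

text \<open>Otherwise \<open>T\<close> scaled by \<open>1 / r\<close> strictly shortens
  \<open>x\<close>, and the vector given by \<open>contractive_vector_exists\<close> lies in
  \<open>low r\<close> without being orthogonal to \<open>x\<close>.\<close>

lemma low_orth_bound:
  assumes "r > 0" "\<And>y. y \<in> low r \<Longrightarrow> x \<bullet> y = 0"
  shows "r * norm x \<le> norm (T x)"
proof (rule ccontr)
  assume *: "\<not> r * norm x \<le> norm (T x)"
  define Q where "Q y = (1 / r) *\<^sub>R T y" for y
  interpret Q: symmetric_operator Q
  proof (rule symmetric_operator.intro)
    show "bounded_linear Q" unfolding Q_def by (intro bounded_linear_compose[OF bounded_linear_scaleR_right bl])
  qed (simp add: Q_def sym)
  have Qn: "(Q ^^ n) y = (1 / r) ^ n *\<^sub>R (T ^^ n) y" for n y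
    by (induction n) (simp_all add: Q_def linear_scale[OF bounded_linear.linear[OF bl]] mult.commute)
  have "norm (Q x) < norm x" using * assms(1) by (simp add: Q_def field_simps)
  then obtain y where y: "\<And>n. norm ((Q ^^ n) y) \<le> norm x" "y \<bullet> x > 0"
    using Q.contractive_vector_exists by blast
  have "y \<in> low r"
  proof (rule lowI[OF assms(1)])
    show "norm ((T ^^ n) y) \<le> norm x * r ^ n" for n
      using y(1)[of n] assms(1) by (simp add: Qn power_divide field_simps)
  qed
  then show False using assms(2)[of y] y(2) by (simp add: inner_commute)
qed

end

text \<open>Meant for projections to nested subspaces, where the squared distance equals the
  difference of the squared norms \<open>s\<close>, a bounded monotone sequence.\<close>

lemma Cauchy_if_norm_diff_square_le:
  fixes v :: "nat \<Rightarrow> 'a::real_normed_vector" and s :: "nat \<Rightarrow> real"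
  assumes s: "convergent s" and le: "\<And>i j. (norm (v i - v j))\<^sup>2 \<le> \<bar>s i - s j\<bar>"
  shows "Cauchy v"
proof (rule metric_CauchyI)
  fix e :: real assume "e > 0"
  then obtain N where N: "\<And>m n. m \<ge> N \<Longrightarrow> n \<ge> N \<Longrightarrow> dist (s m) (s n) < e\<^sup>2"
    using metric_CauchyD[of s "e\<^sup>2"] s by (auto simp: Cauchy_convergent_iff)
  have "dist (v m) (v n) < e" if "m \<ge> N" "n \<ge> N" for m n
  proof -
    have "(norm (v m - v n))\<^sup>2 < e\<^sup>2" using N[OF that] le[of m n] by (simp add: dist_real_def)
    then show ?thesis using \<open>e > 0\<close> by (simp add: dist_norm power2_less_imp_less)
  qed
  then show "\<exists>M. \<forall>m\<ge>M. \<forall>n\<ge>M. dist (v m) (v n) < e" by blast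
qed

section \<open>Resolutions of the identity from nested subspaces\<close>

locale subspace_family =
  fixes M :: "real \<Rightarrow> 'h::{real_inner,complete_space} set"
  assumes cl: "\<And>l. closed (M l)" and ss: "\<And>l. subspace (M l)"
    and mono: "\<And>l m. l \<le> m \<Longrightarrow> M l \<subseteq> M m"
    and right_cont: "\<And>l x. (\<And>m. l < m \<Longrightarrow> x \<in> M m) \<Longrightarrow> x \<in> M l"
    and zero: "\<And>l. l \<le> 0 \<Longrightarrow> M l \<subseteq> {0}"
    and total: "\<And>x. (\<And>n y. y \<in> M (real n) \<Longrightarrow> x \<bullet> y = 0) \<Longrightarrow> x = 0"
begin

lemmas pr_in = proj_in[OF cl ss]
lemmas pr_orth = proj_orth[OF cl ss]
lemmas pr_unique = proj_unique[OF cl ss]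
lemmas pr_id = proj_id[OF cl ss]

lemma proj_comp_mono:
  assumes "l \<le> m"
  shows "proj (M l) (proj (M m) x) = proj (M l) x" "proj (M m) (proj (M l) x) = proj (M l) x"
proof -
  show "proj (M l) (proj (M m) x) = proj (M l) x"
  proof (rule pr_unique)
    fix y assume y: "y \<in> M l"
    then have "y \<in> M m" using mono[OF assms] by blast
    then show "(proj (M m) x - proj (M l) x) \<bullet> y = 0"
      using pr_orth[OF y, of x] pr_orth[of y m x] by (simp add: inner_diff_left)
  qed (rule pr_in)
  show "proj (M m) (proj (M l) x) = proj (M l) x"
    by (rule pr_id[OF subsetD[OF mono[OF assms] pr_in]])
qed

lemma norm_proj_diff:
  assumes "l \<le> m"
  shows "(norm (proj (M m) x - proj (M l) x))\<^sup>2 = (norm (proj (M m) x))\<^sup>2 - (norm (proj (M l) x))\<^sup>2"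
  using proj_pythagoras[OF cl[of l] ss[of l], of "proj (M m) x"] by (simp add: proj_comp_mono[OF assms])

lemma norm_proj_mono: "l \<le> m \<Longrightarrow> (norm (proj (M l) x))\<^sup>2 \<le> (norm (proj (M m) x))\<^sup>2"
  using norm_proj_diff[of l m x] zero_le_power2[of "norm (proj (M m) x - proj (M l) x)"] by linarith

lemma norm_proj_diff_abs:
  "(norm (proj (M m) x - proj (M l) x))\<^sup>2 = \<bar>(norm (proj (M m) x))\<^sup>2 - (norm (proj (M l) x))\<^sup>2\<bar>"
  using norm_proj_diff[of l m x] norm_proj_diff[of m l x] norm_proj_mono[of l m x] norm_proj_mono[of m l x]
  by (cases "l \<le> m") (auto simp: norm_minus_commute)

text \<open>Along a sequence decreasing to \<open>l\<close> the projections are Cauchy; their limit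
  lies in every \<open>M m'\<close> with \<open>m' > l\<close>, hence in \<open>M l\<close>.
  Monotonicity of the squared norms carries the convergence from the sequence to the filter.\<close>

lemma proj_tendsto_at_right: "((\<lambda>m. proj (M m) x) \<longlongrightarrow> proj (M l) x) (at_right l)"
proof -
  define m where "m i = l + inverse (real (Suc i))" for i
  have m: "l < m i" for i by (simp add: m_def)
  have ml: "m \<longlonglongrightarrow> l" unfolding m_def by (rule LIMSEQ_inverse_real_of_nat_add)
  have mdec: "m j \<le> m i" if "i \<le> j" for i j unfolding m_def using that by simp
  define v where "v i = proj (M (m i)) x" for i
  define s where "s i = (norm (v i))\<^sup>2" for i
  have dec: "decseq s" unfolding decseq_def s_def v_def by (intro allI impI norm_proj_mono mdec)
  obtain L where "s \<longlonglongrightarrow> L" using decseq_convergent[OF dec, of 0] by (auto simp: s_def)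
  then have "convergent s" by (rule convergentI)
  then have "Cauchy v"
    by (rule Cauchy_if_norm_diff_square_le) (simp add: v_def s_def norm_proj_diff_abs)
  then obtain p where p: "v \<longlonglongrightarrow> p" using Cauchy_convergent_iff convergent_def by blast
  have pl: "proj (M l) x = p"
  proof (rule pr_unique)
    show "p \<in> M l"
    proof (rule right_cont)
      fix m' assume "l < m'"
      then have "\<forall>\<^sub>F i in sequentially. m i < m'" using ml by (intro order_tendstoD(2))
      then have "\<forall>\<^sub>F i in sequentially. v i \<in> M m'"
        by eventually_elim (use subsetD[OF mono[OF less_imp_le] pr_in] in \<open>simp add: v_def\<close>)
      then show "p \<in> M m'" using p by (intro Lim_in_closed_set[OF cl]) auto
    qed
    fix y assume y: "y \<in> M l"
    have "(\<lambda>i. (x - v i) \<bullet> y) \<longlonglongrightarrow> (x - p) \<bullet> y" by (intro tendsto_intros p)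
    moreover have "(x - v i) \<bullet> y = 0" for i
      unfolding v_def by (intro pr_orth subsetD[OF mono[OF less_imp_le[OF m]] y])
    ultimately show "(x - p) \<bullet> y = 0" by (simp add: LIMSEQ_const_iff)
  qed
  show ?thesis
  proof (rule tendstoI)
    fix e :: real assume "e > 0"
    then obtain N where "dist (v N) p < e" using metric_LIMSEQ_D[OF p] by blast
    then have N: "norm (v N - p) < e" by (simp add: dist_norm)
    have "dist (proj (M k) x) (proj (M l) x) < e" if "l < k" "k < m N" for k
    proof -
      have "(norm (proj (M k) x - proj (M l) x))\<^sup>2 \<le> (norm (v N - proj (M l) x))\<^sup>2"
        unfolding v_def using that norm_proj_mono[of k "m N" x] by (simp add: norm_proj_diff)
      then have "norm (proj (M k) x - proj (M l) x) \<le> norm (v N - proj (M l) x)" by (rule power2_le_imp_le) simp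
      then show ?thesis using N pl by (simp add: dist_norm)
    qed
    then show "\<forall>\<^sub>F k in at_right l. dist (proj (M k) x) (proj (M l) x) < e"
      using m[of N] by (auto simp: eventually_at_right)
  qed
qed

text \<open>The same Cauchy argument gives a limit \<open>p\<close> along the integers;
  \<open>x - p\<close> is orthogonal to every \<open>M n\<close>, so \<open>total\<close> yields
  \<open>p = x\<close>.\<close>

lemma proj_tendsto_at_top: "((\<lambda>m. proj (M m) x) \<longlongrightarrow> x) at_top"
proof -
  define v where "v n = proj (M (real n)) x" for n
  define s where "s i = (norm (v i))\<^sup>2" for i
  have inc: "incseq s" unfolding incseq_def s_def v_def by (intro allI impI norm_proj_mono) simp
  have "s i \<le> (norm x)\<^sup>2" for i
    unfolding s_def v_def using proj_norm_le[OF cl ss] by (intro power_mono) auto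
  then obtain L where "s \<longlonglongrightarrow> L" using incseq_convergent[OF inc] by blast
  then have "convergent s" by (rule convergentI)
  then have "Cauchy v"
    by (rule Cauchy_if_norm_diff_square_le) (simp add: v_def s_def norm_proj_diff_abs)
  then obtain p where p: "v \<longlonglongrightarrow> p" using Cauchy_convergent_iff convergent_def by blast
  have "x - p = 0"
  proof (rule total)
    fix n y assume y: "y \<in> M (real n)"
    have "(\<lambda>i. (x - v i) \<bullet> y) \<longlonglongrightarrow> (x - p) \<bullet> y" by (intro tendsto_intros p)
    moreover have "\<forall>\<^sub>F i in sequentially. (x - v i) \<bullet> y = 0"
      unfolding v_def using eventually_ge_at_top[of n]
      by eventually_elim (rule pr_orth, rule subsetD[OF mono y], simp)
    then have "(\<lambda>i. (x - v i) \<bullet> y) \<longlonglongrightarrow> 0" by (rule tendsto_eventually)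
    ultimately show "(x - p) \<bullet> y = 0" using LIMSEQ_unique by blast
  qed
  then have px: "p = x" by simp
  show ?thesis
  proof (rule tendstoI)
    fix e :: real assume "e > 0"
    then obtain N where "dist (v N) p < e" using metric_LIMSEQ_D[OF p] by blast
    then have N: "norm (x - v N) < e" by (simp add: px dist_norm norm_minus_commute)
    have "dist (proj (M k) x) x < e" if "real N \<le> k" for k
    proof -
      have "(norm (x - proj (M k) x))\<^sup>2 \<le> (norm (x - v N))\<^sup>2"
        unfolding v_def using norm_proj_mono[OF that, of x] proj_pythagoras[OF cl[of k] ss[of k], of x]
          proj_pythagoras[OF cl[of "real N"] ss[of "real N"], of x] by linarith
      then have "norm (x - proj (M k) x) \<le> norm (x - v N)" by (rule power2_le_imp_le) simp
      then show ?thesis using N by (simp add: dist_norm norm_minus_commute)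
    qed
    then show "\<forall>\<^sub>F k in at_top. dist (proj (M k) x) x < e"
      by (auto simp: eventually_at_top_linorder)
  qed
qed

lemma proj_zero: "l \<le> 0 \<Longrightarrow> proj (M l) x = 0"
  using subsetD[OF zero pr_in] by simp

lemma proj_tendsto_at_bot: "((\<lambda>m. proj (M m) x) \<longlongrightarrow> 0) at_bot"
proof (rule tendsto_eventually)
  show "\<forall>\<^sub>F m in at_bot. proj (M m) x = 0"
    using eventually_le_at_bot[of 0] by eventually_elim (rule proj_zero)
qed

lemma resolution: "resolution_of_identity (\<lambda>l. proj (M l))"
  unfolding resolution_of_identity_def
  by (intro conjI allI impI proj_orthogonal_projection[OF cl ss] proj_comp_mono proj_tendsto_at_right
      proj_tendsto_at_top proj_tendsto_at_bot)

end

section \<open>Spectral resolution of a positive self-adjoint operator\<close>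

text \<open>A positive real lower bound stands here in place of the infimum, which is infinite on
  the zero space.\<close>

locale positive_self_adjoint =
  fixes D :: "'h::{real_inner,complete_space} set" and A :: "'h \<Rightarrow> 'h" and \<nu> :: real
  assumes sa: "self_adjoint_op D A" and \<nu>: "\<nu> > 0"
    and lower: "\<And>u. u \<in> D \<Longrightarrow> \<nu> * (norm u)\<^sup>2 \<le> A u \<bullet> u"
begin

lemma D_subspace: "subspace D"
  and A_add: "x \<in> D \<Longrightarrow> y \<in> D \<Longrightarrow> A (x + y) = A x + A y"
  and A_scale: "x \<in> D \<Longrightarrow> A (r *\<^sub>R x) = r *\<^sub>R A x"
  using sa by (auto simp: self_adjoint_op_def linear_op_def)

lemma A_diff: "x \<in> D \<Longrightarrow> y \<in> D \<Longrightarrow> A (x - y) = A x - A y"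
  using A_add[of x "- 1 *\<^sub>R y"] A_scale[of y "-1"] D_subspace by (simp add: subspace_neg)

lemma A_0: "A 0 = 0"
  using A_scale[of 0 0] D_subspace by (simp add: subspace_0)

lemma A_adjoint: "(\<And>x. x \<in> D \<Longrightarrow> A x \<bullet> y = x \<bullet> z) \<Longrightarrow> y \<in> D \<and> A y = z"
proof -
  assume "\<And>x. x \<in> D \<Longrightarrow> A x \<bullet> y = x \<bullet> z"
  then have "(y, z) \<in> adjoint_graph D A" by (simp add: adjoint_graph_def)
  then show ?thesis using sa by (auto simp: self_adjoint_op_def op_graph_def)
qed

lemma A_sym: assumes "x \<in> D" "y \<in> D" shows "A x \<bullet> y = x \<bullet> A y"
proof -
  have "(y, A y) \<in> adjoint_graph D A" using sa assms by (auto simp: self_adjoint_op_def op_graph_def)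
  then show ?thesis using assms by (simp add: adjoint_graph_def)
qed

lemma A_closed:
  assumes "\<And>i. x i \<in> D" "x \<longlonglongrightarrow> y" "(\<lambda>i. A (x i)) \<longlonglongrightarrow> z"
  shows "y \<in> D \<and> A y = z"
proof (rule A_adjoint)
  fix w assume w: "w \<in> D"
  have "(\<lambda>i. A w \<bullet> x i) \<longlonglongrightarrow> A w \<bullet> y" "(\<lambda>i. w \<bullet> A (x i)) \<longlonglongrightarrow> w \<bullet> z"
    by (intro tendsto_intros assms)+
  then show "A w \<bullet> y = w \<bullet> z" using A_sym[OF w] assms(1) LIMSEQ_unique by simp
qed

lemma A_bounded_below: assumes "x \<in> D" shows "\<nu> * norm x \<le> norm (A x)"
proof (cases "x = 0")
  case False
  have "\<nu> * norm x * norm x \<le> norm (A x) * norm x"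
    using lower[OF assms] norm_cauchy_schwarz[of "A x" x] by (simp add: power2_eq_square mult.assoc)
  then show ?thesis using False by simp
qed simp

text \<open>The lower bound makes the range closed. A vector \<open>w\<close> orthogonal to the
  range satisfies the adjoint relation with value 0, so self-adjointness gives \<open>w\<close> in
  \<open>D\<close> with \<open>A w = 0\<close>, and the lower bound gives
  \<open>w = 0\<close>.\<close>

lemma A_surj: "\<exists>x\<in>D. A x = y"
proof -
  have ss: "subspace (A ` D)"
  proof (rule subspaceI)
    show "0 \<in> A ` D" using A_0 D_subspace subspace_0 by (metis imageI)
    show "x + y \<in> A ` D" if "x \<in> A ` D" "y \<in> A ` D" for x y
      using that A_add D_subspace by (metis (no_types, lifting) image_iff subspace_add)
    show "c *\<^sub>R x \<in> A ` D" if "x \<in> A ` D" for c x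
      using that A_scale D_subspace by (metis (no_types, lifting) image_iff subspace_scale)
  qed
  have "z \<in> A ` D" if zA: "\<And>n. z' n \<in> A ` D" and lim: "z' \<longlonglongrightarrow> z" for z' z
  proof -
    obtain x where x: "\<And>n. x n \<in> D" "\<And>n. z' n = A (x n)" using zA unfolding image_iff by metis
    have "Cauchy x"
    proof (rule metric_CauchyI)
      fix e :: real assume "e > 0"
      then obtain N where N: "\<And>m n. m \<ge> N \<Longrightarrow> n \<ge> N \<Longrightarrow> dist (z' m) (z' n) < \<nu> * e"
        using metric_CauchyD[OF LIMSEQ_imp_Cauchy[OF lim], of "\<nu> * e"] \<nu> by auto
      have "dist (x m) (x n) < e" if "m \<ge> N" "n \<ge> N" for m n
      proof -
        have "\<nu> * norm (x m - x n) \<le> norm (A (x m - x n))"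
          using x D_subspace by (intro A_bounded_below) (simp add: subspace_diff)
        also have "\<dots> < \<nu> * e" using N[OF that] by (simp add: dist_norm x A_diff)
        finally show ?thesis using \<nu> by (simp add: dist_norm)
      qed
      then show "\<exists>M. \<forall>m\<ge>M. \<forall>n\<ge>M. dist (x m) (x n) < e" by blast
    qed
    then obtain l where l: "x \<longlonglongrightarrow> l" using Cauchy_convergent_iff convergent_def by blast
    have "l \<in> D \<and> A l = z" by (rule A_closed[OF x(1) l]) (use lim in \<open>simp add: x(2)[symmetric]\<close>)
    then show ?thesis by blast
  qed
  then have cl: "closed (A ` D)" unfolding closed_sequential_limits by blast
  define w where "w = y - proj (A ` D) y"
  have "w \<in> D \<and> A w = 0"
  proof (rule A_adjoint)
    fix x assume "x \<in> D"
    then have "w \<bullet> A x = 0" unfolding w_def by (intro proj_orth[OF cl ss]) blast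
    then show "A x \<bullet> w = x \<bullet> 0" by (simp add: inner_commute)
  qed
  then have "w = 0" using A_bounded_below[of w] \<nu> by (simp add: mult_le_0_iff)
  then show ?thesis using proj_in[OF cl ss, of y] by (auto simp: w_def)
qed

definition T :: "'h \<Rightarrow> 'h" where "T y = (SOME x. x \<in> D \<and> A x = y)"

lemma T_in: "T y \<in> D" and A_T: "A (T y) = y"
proof -
  have "\<exists>x. x \<in> D \<and> A x = y" using A_surj by blast
  from someI_ex[OF this] show "T y \<in> D" "A (T y) = y" by (auto simp: T_def)
qed

lemma A_inj: assumes "x \<in> D" "y \<in> D" "A x = A y" shows "x = y"
proof -
  have "x - y \<in> D" using assms D_subspace by (simp add: subspace_diff)
  from A_bounded_below[OF this] show ?thesis using assms A_diff \<nu> by (simp add: mult_le_0_iff)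
qed

lemma T_A: "x \<in> D \<Longrightarrow> T (A x) = x"
  by (rule A_inj) (auto simp: T_in A_T)

lemma T_norm: "norm (T x) \<le> norm x * (1 / \<nu>)"
  using A_bounded_below[OF T_in[of x]] \<nu> by (simp add: A_T field_simps)

lemma T_bl: "bounded_linear T"
proof (rule bounded_linear_intro[OF _ _ T_norm])
  show "T (x + y) = T x + T y" for x y
    by (rule A_inj) (auto simp: T_in A_T A_add intro: subspace_add[OF D_subspace])
  show "T (r *\<^sub>R x) = r *\<^sub>R T x" for r x
    by (rule A_inj) (auto simp: T_in A_T A_scale intro: subspace_scale[OF D_subspace])
qed

lemma T_sym: "T x \<bullet> y = x \<bullet> T y"
  using A_sym[OF T_in[of x] T_in[of y]] by (simp add: A_T)

lemma T_pos: "0 \<le> T x \<bullet> x"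
proof -
  have "0 \<le> \<nu> * (norm (T x))\<^sup>2" using \<nu> by simp
  also have "\<dots> \<le> A (T x) \<bullet> T x" using lower T_in by blast
  finally show ?thesis by (simp add: A_T inner_commute)
qed

sublocale inv: symmetric_operator T
  by (rule symmetric_operator.intro[OF T_bl T_sym])

text \<open>The range of the spectral projection of \<open>A\<close> for \<open>(-\<infinity>, l]\<close>: for \<open>r = 1 / s\<close> the subspace
  \<^term>\<open>inv.low r\<close> belongs to \<open>T \<le> r\<close>, that is, to \<open>A \<ge> s\<close>.\<close>

definition M :: "real \<Rightarrow> 'h set" where
  "M l = {x. \<forall>s>0. s > l \<longrightarrow> (\<forall>y\<in>inv.low (1 / s). x \<bullet> y = 0)}"

lemma M_closed: "closed (M l)"
proof -
  have "M l = (\<Inter>s\<in>{s. s > 0 \<and> s > l}. \<Inter>y\<in>inv.low (1 / s). {x. y \<bullet> x = 0})"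
    by (auto simp: M_def inner_commute)
  then show ?thesis by (auto intro!: closed_INT closed_hyperplane)
qed

lemma M_subspace: "subspace (M l)"
  by (rule subspaceI) (auto simp: M_def inner_simps)

lemma M_mono: "l \<le> m \<Longrightarrow> M l \<subseteq> M m"
  by (auto simp: M_def)

lemma M_right_cont: assumes "\<And>m. l < m \<Longrightarrow> x \<in> M m" shows "x \<in> M l"
  unfolding M_def
proof (intro CollectI allI impI ballI)
  fix s y assume s: "0 < s" "l < s" and y: "y \<in> inv.low (1 / s)"
  obtain m where "l < m" "m < s" using dense[OF s(2)] by blast
  then show "x \<bullet> y = 0" using assms[of m] s y by (auto simp: M_def)
qed

text \<open>For \<open>l \<le> 0\<close> the parameter \<open>s = \<nu>\<close> is admissible in
  \<open>M\<close>, and \<open>low (1 / \<nu>)\<close> is the whole space because \<open>T\<close>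
  has norm at most \<open>1 / \<nu>\<close>. So \<open>x\<close> is orthogonal to itself.\<close>

lemma M_zero: assumes "l \<le> 0" shows "M l \<subseteq> {0}"
proof
  fix x assume x: "x \<in> M l"
  have "x \<in> inv.low (1 / \<nu>)"
  proof (rule inv.lowI[where C = "norm x"])
    show "norm ((T ^^ n) x) \<le> norm x * (1 / \<nu>) ^ n" for n
    proof (induction n)
      case (Suc n)
      have "norm ((T ^^ Suc n) x) \<le> norm ((T ^^ n) x) * (1 / \<nu>)" using T_norm by simp
      also have "\<dots> \<le> norm x * (1 / \<nu>) ^ n * (1 / \<nu>)" using Suc \<nu> by (intro mult_right_mono) auto
      finally show ?case by simp
    qed simp
  qed (use \<nu> in simp)
  then have "x \<bullet> x = 0" using x \<nu> assms by (auto simp: M_def)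
  then show "x \<in> {0}" by simp
qed

lemma M_T: assumes "x \<in> M l" shows "T x \<in> M l"
  using assms inv.low_invariant by (auto simp: M_def T_sym)

text \<open>Every \<open>s > l\<close> gives the bound with factor \<open>s\<close> by
  \<open>low_orth_bound\<close>; then \<open>s\<close> decreases to \<open>l\<close>.\<close>

lemma M_norm_T: assumes "x \<in> M l" "l > 0" shows "norm x \<le> l * norm (T x)"
proof -
  have *: "norm x \<le> s * norm (T x)" if "l < s" for s
  proof -
    have "1 / s * norm x \<le> norm (T x)"
    proof (rule inv.low_orth_bound)
      fix y assume "y \<in> inv.low (1 / s)"
      then show "x \<bullet> y = 0" using assms that unfolding M_def by (auto dest: spec[of _ s])
    qed (use assms that in simp)
    then show ?thesis using that assms by (simp add: field_simps)
  qed
  have "((\<lambda>s. s * norm (T x)) \<longlongrightarrow> l * norm (T x)) (at_right l)" by (intro tendsto_intros)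
  moreover have "\<forall>\<^sub>F s in at_right l. norm x \<le> s * norm (T x)"
    using * by (auto simp: eventually_at_right_less intro: eventually_mono[OF eventually_at_right_less])
  ultimately show ?thesis by (rule tendsto_lowerbound) simp
qed

text \<open>On \<open>M l\<close> the operator \<open>T\<close> is symmetric and bounded below by
  \<open>1 / l\<close>, so it is invertible there; the inverse is \<open>A\<close>, which places
  \<open>M l\<close> inside \<open>D\<close>.\<close>

lemma T_image_M: assumes "l > 0" shows "T ` M l = M l"
proof (rule symmetric_bounded_below_surj[where c = "1 / l"])
  show "1 / l * norm x \<le> norm (T x)" if "x \<in> M l" for x
    using M_norm_T[OF that assms] assms by (simp add: field_simps)
qed (use assms in \<open>auto simp: M_closed M_subspace T_bl M_T T_sym\<close>)

lemma M_A:
  assumes "x \<in> M l" "l > 0" shows "x \<in> D" "A x \<in> M l" "norm (A x) \<le> l * norm x"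
proof -
  obtain y where y: "y \<in> M l" "x = T y" using assms T_image_M by blast
  show "x \<in> D" "A x \<in> M l" "norm (A x) \<le> l * norm x"
    using y T_in M_norm_T[OF y(1) assms(2)] by (auto simp: A_T)
qed

text \<open>Subtract from \<open>x\<close> its projection to \<open>low (1 / l)\<close>. The rest is
  orthogonal to all the smaller subspaces \<open>low (1 / s)\<close> with \<open>s > l\<close>, so
  it lies in \<open>M l\<close> and is orthogonal to \<open>x\<close>, hence to itself.\<close>

lemma M_orth_low:
  assumes "l > 0" and orth: "\<And>y. y \<in> M l \<Longrightarrow> x \<bullet> y = 0"
  shows "x \<in> inv.low (1 / l)"
proof -
  have ss: "subspace (inv.low (1 / l))" using assms by (intro inv.low_subspace) simp
  note cs = inv.low_closed ss
  define p where "p = proj (inv.low (1 / l)) x"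
  have p: "p \<in> inv.low (1 / l)" unfolding p_def by (rule proj_in[OF cs])
  have z: "(x - p) \<bullet> y = 0" if "y \<in> inv.low (1 / l)" for y
    unfolding p_def using that by (rule proj_orth[OF cs])
  have "x - p \<in> M l" unfolding M_def
  proof (intro CollectI allI impI ballI)
    fix s y assume s: "0 < s" "l < s" "y \<in> inv.low (1 / s)"
    have "inv.low (1 / s) \<subseteq> inv.low (1 / l)" using s assms(1) by (intro inv.low_mono) (auto simp: frac_le)
    then show "(x - p) \<bullet> y = 0" using z s by blast
  qed
  then have "x \<bullet> (x - p) = 0" by (rule orth)
  then have "(x - p) \<bullet> (x - p) = 0" using z[OF p] by (simp add: inner_simps inner_commute)
  then show ?thesis using p by simp
qed

text \<open>For \<open>l > 0\<close> one has \<open>l * norm (T x) \<le> norm x\<close>. Positivity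
  of \<open>T\<close> at \<open>A x - l *\<^sub>R x\<close> reads \<open>0 \<le> A x \<bullet> x - 2
  * l * (norm x)\<^sup>2 + l\<^sup>2 * (T x \<bullet> x)\<close>, whose last term is at most
  \<open>l * (norm x)\<^sup>2\<close>.\<close>

lemma M_orth_lower:
  assumes "x \<in> D" and orth: "\<And>y. y \<in> M l \<Longrightarrow> x \<bullet> y = 0"
  shows "l * (norm x)\<^sup>2 \<le> A x \<bullet> x"
proof (cases "l > 0")
  case True
  have "norm (T x) \<le> 1 / l * norm x"
    using M_orth_low[OF True orth] by (rule inv.low_norm_le)
  then have "l * norm (T x) \<le> norm x" using True by (simp add: field_simps)
  then have "l * (l * norm (T x) * norm x) \<le> l * (norm x * norm x)"
    using True by (intro mult_left_mono mult_right_mono) auto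
  moreover have "l\<^sup>2 * (T x \<bullet> x) \<le> l\<^sup>2 * (norm (T x) * norm x)"
    by (intro mult_left_mono norm_cauchy_schwarz) auto
  moreover have "0 \<le> T (A x - l *\<^sub>R x) \<bullet> (A x - l *\<^sub>R x)" by (rule T_pos)
  moreover have "T (A x - l *\<^sub>R x) = x - l *\<^sub>R T x"
    using T_A[OF assms(1)] by (simp add: linear_diff linear_scale bounded_linear.linear[OF T_bl])
  moreover have "T x \<bullet> A x = x \<bullet> x" using T_sym[of x "A x"] T_A[OF assms(1)] by simp
  ultimately show ?thesis
    by (simp add: inner_diff_left inner_diff_right inner_commute power2_eq_square algebra_simps
        flip: power2_norm_eq_inner)
next
  case False
  have "l * (norm x)\<^sup>2 \<le> 0" "0 \<le> \<nu> * (norm x)\<^sup>2" using False \<nu> by (auto simp: mult_le_0_iff)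
  then show ?thesis using lower[OF assms(1)] by linarith
qed

text \<open>Such an \<open>x\<close> lies in \<open>low (1 / real (Suc n))\<close> for every
  \<open>n\<close>, so \<open>T x = 0\<close>, and applying \<open>A\<close> gives
  \<open>x = 0\<close>.\<close>

lemma M_total: assumes "\<And>n y. y \<in> M (real n) \<Longrightarrow> x \<bullet> y = 0" shows "x = 0"
proof -
  have "norm (T x) \<le> inverse (real (Suc n)) * norm x" for n
  proof -
    have "x \<in> inv.low (1 / real (Suc n))" by (rule M_orth_low[OF _ assms]) simp
    then show ?thesis unfolding inverse_eq_divide by (rule inv.low_norm_le)
  qed
  moreover have "(\<lambda>n. inverse (real (Suc n)) * norm x) \<longlonglongrightarrow> 0 * norm x"
    by (intro tendsto_mult LIMSEQ_inverse_real_of_nat tendsto_const)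
  ultimately have "norm (T x) \<le> 0" using LIMSEQ_le_const[of _ 0 "norm (T x)"] by simp
  then have "A (T x) = 0" using A_0 by simp
  then show ?thesis by (simp add: A_T)
qed

sublocale spectral: subspace_family M
  by standard (use M_closed M_subspace M_mono M_right_cont M_zero M_total in blast)+

lemma proj_M_commute:
  assumes "x \<in> D" shows "proj (M l) x \<in> D" "A (proj (M l) x) = proj (M l) (A x)"
proof -
  show d: "proj (M l) x \<in> D"
  proof (cases "l > 0")
    case True then show ?thesis using M_A(1)[OF spectral.pr_in] by blast
  next
    case False then show ?thesis using spectral.proj_zero D_subspace subspace_0 by auto
  qed
  show "A (proj (M l) x) = proj (M l) (A x)"
  proof (cases "l > 0")
    case True
    show ?thesis
    proof (rule sym, rule spectral.pr_unique)
      show "A (proj (M l) x) \<in> M l" using M_A(2)[OF spectral.pr_in True] .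
      fix y assume y: "y \<in> M l"
      have "(A x - A (proj (M l) x)) \<bullet> y = (x - proj (M l) x) \<bullet> A y"
        using A_sym[OF assms] A_sym[OF d] M_A(1)[OF y True] by (simp add: inner_diff_left)
      also have "\<dots> = 0" using M_A(2)[OF y True] by (rule spectral.pr_orth)
      finally show "(A x - A (proj (M l) x)) \<bullet> y = 0" .
    qed
  next
    case False then show ?thesis using spectral.proj_zero A_0 by auto
  qed
qed

end

section \<open>Functional calculus for a resolution of the identity\<close>

locale resolution =
  fixes E :: "real \<Rightarrow> 'h::{real_inner,complete_space} \<Rightarrow> 'h"
  assumes res: "resolution_of_identity E"
begin

lemma E_bl: "bounded_linear (E l)" and E_idem: "E l (E l x) = E l x" and E_sym: "E l x \<bullet> y = x \<bullet> E l y"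
  using res by (auto simp: resolution_of_identity_def orthogonal_projection_def)

lemma E_min: "E l (E m x) = E (min l m) x"
  using res by (cases "l \<le> m") (auto simp: resolution_of_identity_def min_def)

lemma E_right: "((\<lambda>m. E m x) \<longlongrightarrow> E l x) (at_right l)"
  and E_bot: "((\<lambda>l. E l x) \<longlongrightarrow> 0) at_bot" and E_top: "((\<lambda>l. E l x) \<longlongrightarrow> x) at_top"
  using res by (auto simp: resolution_of_identity_def)

lemma E_seq: "(\<lambda>n. E (real n) x) \<longlonglongrightarrow> x"
  using filterlim_compose[where g = "\<lambda>l. E l x" and f = real, OF E_top filterlim_real_sequentially] .

lemmas E_linear = bounded_linear.linear[OF E_bl]
lemmas E_add = linear_add[OF E_linear] and E_diff = linear_diff[OF E_linear]
  and E_scale = linear_scale[OF E_linear] and E_sum = linear_sum[OF E_linear]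
  and E_zero = linear_0[OF E_linear]

lemma E_tendsto: "(X \<longlongrightarrow> x) F \<Longrightarrow> ((\<lambda>i. E l (X i)) \<longlongrightarrow> E l x) F"
  by (rule bounded_linear.tendsto[OF E_bl])

lemma E_inner: "E l x \<bullet> E m y = E (min l m) x \<bullet> y"
  using E_sym[of m "E l x" y] by (simp add: E_min min.commute)

lemma E_inner_self: "E l x \<bullet> x = (norm (E l x))\<^sup>2"
  using E_inner[of l x l x] by (simp add: power2_norm_eq_inner)

lemma E_norm_le: "norm (E l x) \<le> norm x"
proof (cases "E l x = 0")
  case False
  have "norm (E l x) * norm (E l x) \<le> norm (E l x) * norm x"
    using norm_cauchy_schwarz[of "E l x" x] by (simp add: E_inner_self power2_eq_square)
  then show ?thesis using False by simp
qed simp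

lemma E_increment: assumes "l \<le> m" shows "(norm (E m x - E l x))\<^sup>2 = E m x \<bullet> x - E l x \<bullet> x"
  using assms by (simp add: power2_norm_eq_inner inner_diff_left inner_diff_right E_inner min_def)

lemma E_form_mono: "l \<le> m \<Longrightarrow> E l x \<bullet> x \<le> E m x \<bullet> x"
  using E_increment[of l m x] zero_le_power2[of "norm (E m x - E l x)"] by linarith

abbreviation "\<mu> \<equiv> spectral_measure E"

lemma form_right: "continuous (at_right a) (\<lambda>l. E l x \<bullet> x)"
  unfolding continuous_within by (intro tendsto_intros E_right)

lemma space_\<mu>: "space (\<mu> x) = UNIV" and sets_\<mu>: "sets (\<mu> x) = sets borel"
  by (simp_all add: spectral_measure_def)

lemma measure_\<mu>_Ioc: "a \<le> b \<Longrightarrow> measure (\<mu> x) {a<..b} = E b x \<bullet> x - E a x \<bullet> x"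
  unfolding spectral_measure_def
  by (intro measure_interval_measure_Ioc E_form_mono form_right)

lemma emeasure_\<mu>_Ioc: "a \<le> b \<Longrightarrow> emeasure (\<mu> x) {a<..b} = E b x \<bullet> x - E a x \<bullet> x"
  unfolding spectral_measure_def
  by (intro emeasure_interval_measure_Ioc E_form_mono form_right)

lemma emeasure_\<mu>_UNIV: "emeasure (\<mu> x) UNIV = ennreal ((norm x)\<^sup>2)"
  unfolding spectral_measure_def
proof (rule interval_measure_UNIV)
  show "((\<lambda>l. E l x \<bullet> x) \<longlongrightarrow> 0) at_bot" using tendsto_inner[OF E_bot tendsto_const, of x x] by simp
  show "((\<lambda>l. E l x \<bullet> x) \<longlongrightarrow> (norm x)\<^sup>2) at_top"
    using tendsto_inner[OF E_top tendsto_const, of x x] by (simp add: power2_norm_eq_inner)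
qed (use E_form_mono form_right in auto)

lemma finite_\<mu>: "finite_measure (\<mu> x)"
  by (rule finite_measureI) (simp add: space_\<mu> emeasure_\<mu>_UNIV)

lemma measure_\<mu>_UNIV: "measure (\<mu> x) UNIV = (norm x)\<^sup>2"
  by (simp add: measure_def emeasure_\<mu>_UNIV)

lemma borel_measurable_\<mu> [simp]: "f \<in> borel_measurable (\<mu> x) \<longleftrightarrow> f \<in> borel_measurable borel"
  using measurable_cong_sets[OF sets_\<mu> refl] by blast

lemma AE_\<mu>_le: "AE l in \<mu> (E m x). l \<le> m"
proof -
  have "AE l in \<mu> (E m x). \<forall>n::nat. l \<notin> {m<..m + real n}"
  proof (subst AE_all_countable, rule allI, rule AE_not_in)
    fix n :: nat
    show "{m<..m + real n} \<in> null_sets (\<mu> (E m x))"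
      by (rule null_setsI) (simp_all add: emeasure_\<mu>_Ioc sets_\<mu> E_min)
  qed
  then show ?thesis
  proof eventually_elim
    case (elim l)
    obtain n :: nat where "l - m < real n" using reals_Archimedean2 by blast
    then show ?case using elim[rule_format, of n] by auto
  qed
qed

lemma AE_\<mu>_greater: assumes "E m x = 0" shows "AE l in \<mu> x. m < l"
proof -
  have "AE l in \<mu> x. \<forall>n::nat. l \<notin> {m - real n<..m}"
  proof (subst AE_all_countable, rule allI, rule AE_not_in)
    fix n :: nat
    have "E (m - real n) x = E (m - real n) (E m x)" by (simp add: E_min)
    also have "\<dots> = 0" by (simp add: assms E_zero)
    finally show "{m - real n<..m} \<in> null_sets (\<mu> x)"
      by (intro null_setsI) (simp_all add: emeasure_\<mu>_Ioc sets_\<mu> assms)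
  qed
  then show ?thesis
  proof eventually_elim
    case (elim l)
    obtain n :: nat where "m - l < real n" using reals_Archimedean2 by blast
    then show ?case using elim[rule_format, of n] by auto
  qed
qed

section \<open>Dyadic Riemann sums\<close>

definition cell :: "nat \<Rightarrow> nat \<Rightarrow> real set" where
  "cell k i = {real i / 2 ^ k<..real (Suc i) / 2 ^ k}"

definition incr :: "nat \<Rightarrow> nat \<Rightarrow> 'h \<Rightarrow> 'h" where
  "incr k i x = E (real (Suc i) / 2 ^ k) x - E (real i / 2 ^ k) x"

text \<open>The \<open>4 ^ k\<close> cells of length \<open>1 / 2 ^ k\<close> cover
  \<open>{0<..2 ^ k}\<close>, so refinement and exhaustion of the half line happen together. Taking
  values at left ends keeps \<open>step f k\<close> below an increasing \<open>f\<close>.\<close>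

definition \<Phi> :: "(real \<Rightarrow> real) \<Rightarrow> nat \<Rightarrow> 'h \<Rightarrow> 'h" where
  "\<Phi> f k x = (\<Sum>i<4 ^ k. f (real i / 2 ^ k) *\<^sub>R incr k i x)"

definition step :: "(real \<Rightarrow> real) \<Rightarrow> nat \<Rightarrow> real \<Rightarrow> real" where
  "step f k l = (\<Sum>i<4 ^ k. f (real i / 2 ^ k) * indicator (cell k i) l)"

text \<open>A product of two projections is the one with the smaller index, so both sides are
  increments of the distribution function. Two levels \<open>k\<close> and \<open>j\<close> are
  allowed so that distances between Riemann sums become integrals.\<close>

lemma incr_inner:
  "incr k i x \<bullet> incr j i' x = measure (\<mu> x) (cell k i \<inter> cell j i')"
proof -
  define a b c d where "a = real i / 2 ^ k" and "b = real (Suc i) / 2 ^ k"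
    and "c = real i' / 2 ^ j" and "d = real (Suc i') / 2 ^ j"
  have ab: "a \<le> b" "c \<le> d" by (auto simp: a_def b_def c_def d_def divide_right_mono)
  have int: "cell k i \<inter> cell j i' = {max a c<..min b d}"
    by (auto simp: cell_def a_def b_def c_def d_def)
  have lhs: "incr k i x \<bullet> incr j i' x
      = E (min b d) x \<bullet> x - E (min b c) x \<bullet> x - E (min a d) x \<bullet> x + E (min a c) x \<bullet> x"
    by (simp add: incr_def inner_diff_left inner_diff_right E_inner del: of_nat_Suc
        flip: a_def b_def c_def d_def)
  show ?thesis
  proof (cases "max a c \<le> min b d")
    case True
    then show ?thesis unfolding lhs int measure_\<mu>_Ioc[OF True] using ab by (auto simp: min_def max_def)
  next
    case False
    then have "{max a c<..min b d} = {}" by auto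
    then show ?thesis unfolding lhs int using False ab by (auto simp: min_def max_def split: if_splits)
  qed
qed

lemma incr_inner_self: "incr k i x \<bullet> x = measure (\<mu> x) (cell k i)"
  unfolding cell_def incr_def
  by (subst measure_\<mu>_Ioc) (auto simp: inner_diff_left divide_right_mono)

lemma incr_linear: "linear (incr k i)"
  unfolding incr_def by (intro linear_compose_sub E_linear)

lemma incr_sym: "incr k i x \<bullet> y = x \<bullet> incr k i y"
  by (simp add: incr_def inner_diff_left inner_diff_right E_sym)

lemma incr_E: "incr k i (E l x) = E l (incr k i x)"
  by (simp add: incr_def E_diff E_min min.commute)

lemma \<Phi>_linear: "linear (\<Phi> f k)"
  unfolding \<Phi>_def by (intro linear_compose_sum ballI linear_compose_scale_right incr_linear)

lemma \<Phi>_bl: "bounded_linear (\<Phi> f k)"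
  unfolding \<Phi>_def incr_def
  by (intro bounded_linear_sum bounded_linear_const_scaleR bounded_linear_sub E_bl)

lemma \<Phi>_sym: "\<Phi> f k x \<bullet> y = x \<bullet> \<Phi> f k y"
  by (simp add: \<Phi>_def inner_sum_left inner_sum_right incr_sym)

lemma \<Phi>_E: "\<Phi> f k (E l x) = E l (\<Phi> f k x)"
  by (simp add: \<Phi>_def E_sum E_scale incr_E)

lemma cell_measurable [measurable]: "cell k i \<in> sets borel"
  by (simp add: cell_def)

lemma step_measurable [measurable]: "step f k \<in> borel_measurable borel"
  unfolding step_def by measurable

lemma integrable_indicator_\<mu>: "B \<in> sets borel \<Longrightarrow> integrable (\<mu> x) (indicator B :: real \<Rightarrow> real)"
  using finite_measure.emeasure_finite[OF finite_\<mu>] by (simp add: sets_\<mu> less_top)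

lemma integral_step: "(LINT l|\<mu> x. step f k l) = \<Phi> f k x \<bullet> x"
  unfolding step_def
  by (subst Bochner_Integration.integral_sum)
    (simp_all add: integrable_indicator_\<mu> space_\<mu> \<Phi>_def inner_sum_left incr_inner_self)

lemma integral_step_mult:
  "(LINT l|\<mu> x. step f k l * step f j l) = \<Phi> f k x \<bullet> \<Phi> f j x"
proof -
  have *: "step f k l * step f j l = (\<Sum>i<4 ^ k. \<Sum>i'<4 ^ j.
      f (real i / 2 ^ k) * f (real i' / 2 ^ j) * indicator (cell k i \<inter> cell j i') l)" for l
    unfolding step_def sum_product by (intro sum.cong refl) (simp add: indicator_inter_arith mult_ac)
  have int: "integrable (\<mu> x) (\<lambda>l. c * indicator (cell k i \<inter> cell j i') l)" for c :: real and i i'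
    using integrable_indicator_\<mu>[of "cell k i \<inter> cell j i'" x] by simp
  have "(LINT l|\<mu> x. step f k l * step f j l) = (\<Sum>i<4 ^ k. (LINT l|\<mu> x. (\<Sum>i'<4 ^ j.
      f (real i / 2 ^ k) * f (real i' / 2 ^ j) * indicator (cell k i \<inter> cell j i') l)))"
    unfolding * by (rule Bochner_Integration.integral_sum) (intro Bochner_Integration.integrable_sum int)
  also have "\<dots> = (\<Sum>i<4 ^ k. \<Sum>i'<4 ^ j. (LINT l|\<mu> x.
      f (real i / 2 ^ k) * f (real i' / 2 ^ j) * indicator (cell k i \<inter> cell j i') l))"
    by (intro sum.cong refl Bochner_Integration.integral_sum int)
  also have "\<dots> = (\<Sum>i<4 ^ k. \<Sum>i'<4 ^ j.
      f (real i / 2 ^ k) * f (real i' / 2 ^ j) * measure (\<mu> x) (cell k i \<inter> cell j i'))"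
    by (intro sum.cong refl) (simp add: space_\<mu>)
  also have "\<dots> = \<Phi> f k x \<bullet> \<Phi> f j x"
    unfolding \<Phi>_def inner_sum_left by (simp add: inner_sum_right incr_inner mult_ac)
  finally show ?thesis .
qed

text \<open>The right side is the polarization of \<open>spectral_form\<close> with
  \<open>step f k\<close> in place of \<open>f\<close>; symmetry of \<open>\<Phi>\<close> merges the
  two mixed terms.\<close>

lemma \<Phi>_polar:
  "\<Phi> f k x \<bullet> y = ((LINT l|\<mu> (x + y). step f k l) - (LINT l|\<mu> (x - y). step f k l)) / 4"
proof -
  have "\<Phi> f k (x + y) \<bullet> (x + y) - \<Phi> f k (x - y) \<bullet> (x - y)
      = 2 * (\<Phi> f k x \<bullet> y) + 2 * (\<Phi> f k y \<bullet> x)"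
    unfolding linear_add[OF \<Phi>_linear] linear_diff[OF \<Phi>_linear] inner_add_left inner_add_right
      inner_diff_left inner_diff_right by simp
  moreover have "\<Phi> f k y \<bullet> x = \<Phi> f k x \<bullet> y" using \<Phi>_sym inner_commute by metis
  ultimately show ?thesis unfolding integral_step by simp
qed

lemma step_cell:
  assumes "l \<in> cell k i" "i < 4 ^ k" shows "step f k l = f (real i / 2 ^ k)"
proof -
  have "indicator (cell k j) l = (if j = i then 1 else 0 :: real)" for j
  proof -
    have "l \<in> cell k j \<longleftrightarrow> j = i"
    proof
      assume "l \<in> cell k j"
      then have "real j < real (Suc i)" "real i < real (Suc j)"
        using assms(1) unfolding cell_def by (auto simp: field_simps simp del: of_nat_Suc)
      then show "j = i" by linarith
    qed (use assms in simp)
    then show ?thesis using assms(1) by (auto split: split_indicator)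
  qed
  then show ?thesis unfolding step_def using assms(2) by (simp add: if_distrib[of "(*) _"] sum.delta' cong: if_cong)
qed

lemma cell_exists:
  assumes "0 < l" "l \<le> 2 ^ k" shows "\<exists>i<4 ^ k. l \<in> cell k i"
proof -
  \<comment> \<open>Cells are open on the left, so the index is the ceiling minus one: a dyadic
    \<open>l\<close> belongs to the cell that it closes.\<close>
  define z where "z = \<lceil>l * 2 ^ k\<rceil> - 1"
  have p: "l * 2 ^ k > 0" using assms by simp
  then have z0: "0 \<le> z" by (simp add: z_def)
  define i where "i = nat z"
  have ri: "real i = of_int z" using z0 by (simp add: i_def)
  have lo: "real i < l * 2 ^ k" and hi: "l * 2 ^ k \<le> real i + 1" unfolding ri z_def by linarith+
  have "l * 2 ^ k \<le> 2 ^ k * 2 ^ k" using assms by simp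
  also have "\<dots> = real (4 ^ k)" by (simp flip: power_mult_distrib)
  finally have "real i < real (4 ^ k)" using lo by linarith
  then have "i < 4 ^ k" using of_nat_less_iff by blast
  moreover have "l \<in> cell k i" using lo hi by (simp add: cell_def field_simps)
  ultimately show ?thesis by blast
qed

lemma step_outside: assumes "l \<le> 0 \<or> 2 ^ k < l" shows "step f k l = 0"
  unfolding step_def
proof (rule sum.neutral, rule ballI)
  fix i assume "i \<in> {..<4 ^ k :: nat}"
  then have i: "Suc i \<le> 4 ^ k" by simp
  have "real (Suc i) \<le> real (4 ^ k)" using i of_nat_le_iff by blast
  also have "\<dots> = 2 ^ k * 2 ^ k" by (simp flip: power_mult_distrib)
  finally have "real (Suc i) / 2 ^ k \<le> 2 ^ k" by (simp add: field_simps)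
  moreover have "0 \<le> real i / 2 ^ k" by simp
  ultimately have "l \<notin> cell k i" unfolding cell_def greaterThanAtMost_iff using assms by linarith
  then show "f (real i / 2 ^ k) * indicator (cell k i) l = 0" by simp
qed

end

section \<open>Functional calculus for increasing functions\<close>

locale positive_resolution = resolution +
  assumes E_0: "E 0 x = 0"
begin

lemma E_neg: assumes "l \<le> 0" shows "E l x = 0"
proof -
  have "(norm (E l x))\<^sup>2 \<le> (norm (E 0 x))\<^sup>2" using E_form_mono[OF assms] by (simp add: E_inner_self)
  then show ?thesis by (simp add: E_0)
qed

lemma AE_\<mu>_pos: "AE l in \<mu> x. 0 < l"
  by (rule AE_\<mu>_greater[OF E_0])

end

text \<open>Made for the identity and the square root. The spectral measures live on positive
  arguments, where continuity is asked; monotonicity makes \<open>step f k\<close> a minorant of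
  \<open>f\<close>, so limits of integrals follow by domination.\<close>

locale resolution_fun = positive_resolution +
  fixes f :: "real \<Rightarrow> real"
  assumes f_mono: "\<And>a b. 0 \<le> a \<Longrightarrow> a \<le> b \<Longrightarrow> f a \<le> f b" and f_0: "0 \<le> f 0"
    and f_cont: "\<And>l. 0 < l \<Longrightarrow> isCont f l" and f_meas [measurable]: "f \<in> borel_measurable borel"
begin

lemma f_nonneg: "0 \<le> l \<Longrightarrow> 0 \<le> f l"
  using f_mono[of 0 l] f_0 by simp

lemma step_bounds: assumes "0 < l" shows "0 \<le> step f k l" "step f k l \<le> f l"
proof -
  have "0 \<le> step f k l \<and> step f k l \<le> f l"
  proof (cases "l \<le> 2 ^ k")
    case True
    then obtain i where i: "i < 4 ^ k" "l \<in> cell k i" using cell_exists assms by blast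
    then have "real i / 2 ^ k \<le> l" by (simp add: cell_def)
    then show ?thesis using step_cell[OF i(2,1), of f] f_mono[of "real i / 2 ^ k" l] f_nonneg[of "real i / 2 ^ k"] by simp
  next
    case False
    then show ?thesis using step_outside[of l k f] f_nonneg assms by simp
  qed
  then show "0 \<le> step f k l" "step f k l \<le> f l" by auto
qed

lemma step_tendsto: assumes "0 < l" shows "(\<lambda>k. step f k l) \<longlonglongrightarrow> f l"
proof -
  obtain g where g: "\<And>k. l \<le> 2 ^ k \<Longrightarrow> step f k l = f (g k) \<and> l - 1 / 2 ^ k \<le> g k \<and> g k \<le> l"
  proof (rule that)
    fix k assume "l \<le> 2 ^ k"
    then obtain i where i: "i < 4 ^ k" "l \<in> cell k i" using cell_exists assms by blast
    let ?P = "\<lambda>r. step f k l = f r \<and> l - 1 / 2 ^ k \<le> r \<and> r \<le> l"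
    have "?P (real i / 2 ^ k)"
      using i(2) step_cell[OF i(2,1), of f] by (simp add: cell_def add_divide_distrib)
    then show "?P (SOME r. ?P r)" by (rule someI)
  qed
  have ev: "\<forall>\<^sub>F k in sequentially. l \<le> 2 ^ k"
  proof -
    obtain n where "l < 2 ^ n" using real_arch_pow[of 2 l] by auto
    moreover have "(2::real) ^ n \<le> 2 ^ k" if "n \<le> k" for k
      using that by (intro power_increasing) auto
    ultimately have "l \<le> 2 ^ k" if "n \<le> k" for k
      using that by (meson less_imp_le order_trans)
    then show ?thesis by (auto simp: eventually_sequentially)
  qed
  have "(\<lambda>k. (1 / 2) ^ k :: real) \<longlonglongrightarrow> 0" by (rule LIMSEQ_power_zero) simp
  from tendsto_diff[OF tendsto_const this] have "(\<lambda>k. l - 1 / 2 ^ k) \<longlonglongrightarrow> l" by (simp add: power_one_over)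
  then have "g \<longlonglongrightarrow> l"
  proof (rule tendsto_sandwich[rotated 2])
    show "\<forall>\<^sub>F k in sequentially. l - 1 / 2 ^ k \<le> g k" "\<forall>\<^sub>F k in sequentially. g k \<le> l"
      using ev g by (auto elim!: eventually_mono)
  qed simp
  then have "(\<lambda>k. f (g k)) \<longlonglongrightarrow> f l" by (rule isCont_tendsto_compose[OF f_cont[OF assms]])
  moreover have "\<forall>\<^sub>F k in sequentially. f (g k) = step f k l"
    using ev g by (auto elim!: eventually_mono)
  ultimately show ?thesis by (rule Lim_transform_eventually)
qed

lemma norm_\<Phi>: "(norm (\<Phi> f k x))\<^sup>2 = (LINT l|\<mu> x. (step f k l)\<^sup>2)"
proof -
  have "(norm (\<Phi> f k x))\<^sup>2 = (LINT l|\<mu> x. step f k l * step f k l)"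
    by (simp only: power2_norm_eq_inner integral_step_mult)
  then show ?thesis by (simp add: power2_eq_square)
qed

lemma step_abs_le: "\<bar>step f k l\<bar> \<le> f (2 ^ k)"
proof (cases "0 < l \<and> l \<le> 2 ^ k")
  case True
  then have "step f k l \<le> f l" "0 \<le> step f k l" using step_bounds by auto
  moreover have "f l \<le> f (2 ^ k)" using True by (intro f_mono) auto
  ultimately show ?thesis by simp
next
  case False
  then have "step f k l = 0" using step_outside[of l k f] by linarith
  then show ?thesis using f_nonneg[of "2 ^ k"] by simp
qed

lemma integrable_step_mult: "integrable (\<mu> x) (\<lambda>l. step f k l * step f j l)"
proof (rule finite_measure.integrable_const_bound[OF finite_\<mu>])
  show "AE l in \<mu> x. norm (step f k l * step f j l) \<le> f (2 ^ k) * f (2 ^ j)"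
    using step_abs_le by (auto simp: abs_mult intro!: AE_I2 mult_mono f_nonneg)
qed simp

lemma dom_integrable: "x \<in> spectral_dom E f \<longleftrightarrow> integrable (\<mu> x) (\<lambda>l. (f l)\<^sup>2)"
  by (simp add: spectral_dom_def)

text \<open>The norm of a Riemann sum is the L2 norm of \<open>step f k\<close>, which lies below
  \<open>f\<close>; conversely Fatou's lemma bounds the integral of \<open>f\<^sup>2\<close>. In
  this form the domain is easily seen to be a subspace and to contain limits of bounded
  sequences.\<close>

lemma dom_iff_bounded: "x \<in> spectral_dom E f \<longleftrightarrow> (\<exists>C. \<forall>k. norm (\<Phi> f k x) \<le> C)"
proof
  assume x: "x \<in> spectral_dom E f"
  have "norm (\<Phi> f k x) \<le> sqrt (LINT l|\<mu> x. (f l)\<^sup>2)" for k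
  proof (rule real_le_rsqrt)
    show "(norm (\<Phi> f k x))\<^sup>2 \<le> (LINT l|\<mu> x. (f l)\<^sup>2)" unfolding norm_\<Phi>
    proof (rule integral_mono_AE)
      show "integrable (\<mu> x) (\<lambda>l. (step f k l)\<^sup>2)" using integrable_step_mult[of x k k] by (simp add: power2_eq_square)
      show "integrable (\<mu> x) (\<lambda>l. (f l)\<^sup>2)" using x by (simp add: dom_integrable)
      show "AE l in \<mu> x. (step f k l)\<^sup>2 \<le> (f l)\<^sup>2"
        using AE_\<mu>_pos[of x] by eventually_elim (use step_bounds in \<open>auto intro: power_mono\<close>)
    qed
  qed
  then show "\<exists>C. \<forall>k. norm (\<Phi> f k x) \<le> C" by blast
next
  assume "\<exists>C. \<forall>k. norm (\<Phi> f k x) \<le> C"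
  then obtain C where C: "\<And>k. norm (\<Phi> f k x) \<le> C" by blast
  have b: "(\<integral>\<^sup>+l. ennreal ((step f k l)\<^sup>2) \<partial>\<mu> x) \<le> ennreal (C\<^sup>2)" for k
  proof -
    have "(\<integral>\<^sup>+l. ennreal ((step f k l)\<^sup>2) \<partial>\<mu> x) = ennreal (LINT l|\<mu> x. (step f k l)\<^sup>2)"
      using integrable_step_mult[of x k k] by (intro nn_integral_eq_integral) (auto simp: power2_eq_square)
    also have "\<dots> \<le> ennreal (C\<^sup>2)" unfolding norm_\<Phi>[symmetric] using C by (intro ennreal_leI power_mono) auto
    finally show ?thesis .
  qed
  have "(\<integral>\<^sup>+l. ennreal ((f l)\<^sup>2) \<partial>\<mu> x) = (\<integral>\<^sup>+l. liminf (\<lambda>k. ennreal ((step f k l)\<^sup>2)) \<partial>\<mu> x)"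
  proof (rule nn_integral_cong_AE)
    show "AE l in \<mu> x. ennreal ((f l)\<^sup>2) = liminf (\<lambda>k. ennreal ((step f k l)\<^sup>2))"
      using AE_\<mu>_pos[of x]
    proof eventually_elim
      case (elim l)
      have "(\<lambda>k. ennreal ((step f k l)\<^sup>2)) \<longlonglongrightarrow> ennreal ((f l)\<^sup>2)"
        using step_tendsto[OF elim] by (intro tendsto_intros)
      then show ?case by (rule lim_imp_Liminf[OF sequentially_bot, symmetric])
    qed
  qed
  also have "\<dots> \<le> liminf (\<lambda>k. \<integral>\<^sup>+l. ennreal ((step f k l)\<^sup>2) \<partial>\<mu> x)"
    by (rule nn_integral_liminf) simp
  also have "\<dots> \<le> ennreal (C\<^sup>2)"
    using b by (intro Liminf_le) (auto intro: always_eventually)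
  also have "\<dots> < \<infinity>" by simp
  finally have "integrable (\<mu> x) (\<lambda>l. (f l)\<^sup>2)"
    by (intro integrableI_bounded) auto
  then show "x \<in> spectral_dom E f" by (simp add: dom_integrable)
qed

lemma dom_subspace: "subspace (spectral_dom E f)"
proof (rule subspaceI)
  show "0 \<in> spectral_dom E f" by (auto simp: dom_iff_bounded linear_0[OF \<Phi>_linear] intro: exI[of _ 0])
  show "x + y \<in> spectral_dom E f" if xy: "x \<in> spectral_dom E f" "y \<in> spectral_dom E f" for x y
  proof -
    obtain C C' where "\<And>k. norm (\<Phi> f k x) \<le> C" "\<And>k. norm (\<Phi> f k y) \<le> C'"
      using xy unfolding dom_iff_bounded by blast
    then have "norm (\<Phi> f k (x + y)) \<le> C + C'" for k
      unfolding linear_add[OF \<Phi>_linear] by (rule norm_triangle_mono)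
    then show ?thesis unfolding dom_iff_bounded by blast
  qed
  show "c *\<^sub>R x \<in> spectral_dom E f" if xd: "x \<in> spectral_dom E f" for c x
  proof -
    obtain C where "\<And>k. norm (\<Phi> f k x) \<le> C" using xd unfolding dom_iff_bounded by blast
    then have "norm (\<Phi> f k (c *\<^sub>R x)) \<le> \<bar>c\<bar> * C" for k
      unfolding linear_scale[OF \<Phi>_linear] by (simp add: mult_left_mono)
    then show ?thesis unfolding dom_iff_bounded by blast
  qed
qed

lemma \<Phi>_truncated: assumes "0 \<le> m" shows "norm (\<Phi> f k (E m x)) \<le> f m * norm x"
proof -
  have "(norm (\<Phi> f k (E m x)))\<^sup>2 \<le> (LINT l|\<mu> (E m x). (f m)\<^sup>2)" unfolding norm_\<Phi>
  proof (rule integral_mono_AE)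
    show "integrable (\<mu> (E m x)) (\<lambda>l. (step f k l)\<^sup>2)"
      using integrable_step_mult[of _ k k] by (simp add: power2_eq_square)
    show "integrable (\<mu> (E m x)) (\<lambda>l. (f m)\<^sup>2)" by (rule finite_measure.integrable_const[OF finite_\<mu>])
    show "AE l in \<mu> (E m x). (step f k l)\<^sup>2 \<le> (f m)\<^sup>2"
      using AE_\<mu>_pos[of "E m x"] AE_\<mu>_le[of m x]
    proof eventually_elim
      case (elim l)
      then have "step f k l \<le> f m" using step_bounds(2)[of l k] f_mono[of l m] by simp
      then show ?case using step_bounds(1)[of l k] elim by (intro power_mono) auto
    qed
  qed
  also have "\<dots> = (f m * norm (E m x))\<^sup>2"
    by (simp add: space_\<mu> measure_\<mu>_UNIV power_mult_distrib mult.commute)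
  finally have "norm (\<Phi> f k (E m x)) \<le> f m * norm (E m x)"
    by (rule power2_le_imp_le) (simp add: f_nonneg assms)
  also have "\<dots> \<le> f m * norm x" using E_norm_le f_nonneg assms by (intro mult_left_mono) auto
  finally show ?thesis .
qed

lemma E_in_dom: "E m x \<in> spectral_dom E f"
proof (cases "0 \<le> m")
  case True then show ?thesis unfolding dom_iff_bounded using \<Phi>_truncated by blast
next
  case False then show ?thesis using E_neg[of m x] subspace_0[OF dom_subspace] by simp
qed

lemma eq_if_inner_dom_eq:
  assumes "\<And>y. y \<in> spectral_dom E f \<Longrightarrow> z \<bullet> y = z' \<bullet> y" shows "z = z'"
proof -
  have "(z - z') \<bullet> E m (z - z') = 0" for m using assms[OF E_in_dom] by (simp add: inner_diff_left)
  moreover have "((\<lambda>m. (z - z') \<bullet> E m (z - z')) \<longlongrightarrow> (z - z') \<bullet> (z - z')) at_top"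
    by (intro tendsto_intros E_top)
  ultimately have "(z - z') \<bullet> (z - z') = 0" by (simp add: tendsto_const_iff)
  then show ?thesis by simp
qed

text \<open>The squared distance of two Riemann sums is the integral of
  \<open>(step f k - step f j)\<^sup>2\<close>, at most twice the sum of the squared L2 distances to
  \<open>f\<close>, and these tend to 0 by dominated convergence.\<close>

lemma \<Phi>_convergent: assumes x: "x \<in> spectral_dom E f" shows "convergent (\<lambda>k. \<Phi> f k x)"
proof -
  define d where "d k = (LINT l|\<mu> x. (step f k l - f l)\<^sup>2)" for k
  have f2: "integrable (\<mu> x) (\<lambda>l. (f l)\<^sup>2)" using x by (simp add: dom_integrable)
  have dom: "AE l in \<mu> x. norm ((step f k l - f l)\<^sup>2) \<le> (f l)\<^sup>2" for k
    using AE_\<mu>_pos[of x]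
  proof eventually_elim
    case (elim l)
    have "\<bar>step f k l - f l\<bar> \<le> f l" using step_bounds[OF elim, of k] by simp
    then have "\<bar>step f k l - f l\<bar>\<^sup>2 \<le> (f l)\<^sup>2" by (intro power_mono) auto
    then show ?case by simp
  qed
  have int: "integrable (\<mu> x) (\<lambda>l. (step f k l - f l)\<^sup>2)" for k
    by (rule Bochner_Integration.integrable_bound[OF f2]) (use dom in \<open>auto elim: eventually_mono\<close>)
  have "d \<longlonglongrightarrow> (LINT l|\<mu> x. 0)"
    unfolding d_def
  proof (rule integral_dominated_convergence[OF _ _ f2 _ dom])
    show "AE l in \<mu> x. (\<lambda>k. (step f k l - f l)\<^sup>2) \<longlonglongrightarrow> 0" using AE_\<mu>_pos[of x]
    proof eventually_elim
      case (elim l)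
      have "(\<lambda>k. (step f k l - f l)\<^sup>2) \<longlonglongrightarrow> (f l - f l)\<^sup>2" by (intro tendsto_intros step_tendsto elim)
      then show ?case by simp
    qed
  qed auto
  then have d0: "d \<longlonglongrightarrow> 0" by simp
  have le: "(norm (\<Phi> f k x - \<Phi> f j x))\<^sup>2 \<le> 2 * d k + 2 * d j" for k j
  proof -
    note i = integrable_step_mult
    have "(norm (\<Phi> f k x - \<Phi> f j x))\<^sup>2
        = (LINT l|\<mu> x. step f k l * step f k l) - 2 * (LINT l|\<mu> x. step f k l * step f j l)
          + (LINT l|\<mu> x. step f j l * step f j l)"
      unfolding integral_step_mult
      by (simp add: power2_norm_eq_inner inner_diff_left inner_diff_right inner_commute)
    also have "\<dots> = (LINT l|\<mu> x. step f k l * step f k l - 2 * (step f k l * step f j l) + step f j l * step f j l)"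
      using i by simp
    also have "\<dots> \<le> (LINT l|\<mu> x. 2 * (step f k l - f l)\<^sup>2 + 2 * (step f j l - f l)\<^sup>2)"
    proof (rule integral_mono)
      fix l
      have "0 \<le> (step f k l - f l + (step f j l - f l))\<^sup>2" by simp
      then show "step f k l * step f k l - 2 * (step f k l * step f j l) + step f j l * step f j l
          \<le> 2 * (step f k l - f l)\<^sup>2 + 2 * (step f j l - f l)\<^sup>2"
        by (simp add: power2_eq_square algebra_simps)
    qed (use i int in simp_all)
    also have "\<dots> = 2 * d k + 2 * d j" using int by (simp add: d_def)
    finally show ?thesis .
  qed
  have "Cauchy (\<lambda>k. \<Phi> f k x)"
  proof (rule metric_CauchyI)
    fix e :: real assume "e > 0"
    then obtain N where N: "\<And>k. k \<ge> N \<Longrightarrow> d k < e\<^sup>2 / 4"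
      using order_tendstoD(2)[OF d0, of "e\<^sup>2 / 4"] by (auto simp: eventually_sequentially)
    have "dist (\<Phi> f m x) (\<Phi> f n x) < e" if "m \<ge> N" "n \<ge> N" for m n
    proof -
      have "(norm (\<Phi> f m x - \<Phi> f n x))\<^sup>2 < e\<^sup>2" using le[of m n] N[OF that(1)] N[OF that(2)] by linarith
      then show ?thesis using \<open>e > 0\<close> by (simp add: dist_norm power2_less_imp_less)
    qed
    then show "\<exists>M. \<forall>m\<ge>M. \<forall>n\<ge>M. dist (\<Phi> f m x) (\<Phi> f n x) < e" by blast
  qed
  then show ?thesis by (simp add: Cauchy_convergent_iff)
qed

lemma integral_step_tendsto:
  assumes x: "x \<in> spectral_dom E f" shows "(\<lambda>k. LINT l|\<mu> x. step f k l) \<longlonglongrightarrow> (LINT l|\<mu> x. f l)"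
\<comment> \<open>The measure is finite, so \<open>1 + f\<^sup>2\<close> is integrable, and it
  dominates \<open>f\<close>.\<close>
proof (rule integral_dominated_convergence[where w = "\<lambda>l. 1 + (f l)\<^sup>2"])
  show "integrable (\<mu> x) (\<lambda>l. 1 + (f l)\<^sup>2)"
    using x unfolding dom_integrable
    by (intro Bochner_Integration.integrable_add finite_measure.integrable_const[OF finite_\<mu>])
  show "AE l in \<mu> x. (\<lambda>k. step f k l) \<longlonglongrightarrow> f l"
    using AE_\<mu>_pos[of x] by eventually_elim (rule step_tendsto)
  show "AE l in \<mu> x. norm (step f k l) \<le> 1 + (f l)\<^sup>2" for k
    using AE_\<mu>_pos[of x]
  proof eventually_elim
    case (elim l)
    have "0 \<le> (f l - 1)\<^sup>2 + f l" using f_nonneg[of l] elim by simp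
    then have "f l \<le> 1 + (f l)\<^sup>2" by (simp add: power2_eq_square algebra_simps)
    then show ?case using step_bounds[OF elim, of k] by simp
  qed
qed auto

lemma \<Phi>_form_tendsto:
  assumes "x \<in> spectral_dom E f" "y \<in> spectral_dom E f"
  shows "(\<lambda>k. \<Phi> f k x \<bullet> y) \<longlonglongrightarrow> spectral_form E f x y"
  unfolding spectral_form_def \<Phi>_polar using assms dom_subspace
  by (intro tendsto_intros integral_step_tendsto) (auto simp: subspace_add subspace_diff)

lemma spectral_op_unique:
  assumes "\<And>y. y \<in> spectral_dom E f \<Longrightarrow> z \<bullet> y = spectral_form E f x y"
  shows "spectral_op E f x = z"
  unfolding spectral_op_def
proof (rule the_equality)
  show "\<forall>y\<in>spectral_dom E f. z \<bullet> y = spectral_form E f x y" by (intro ballI assms)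
  fix z' assume z': "\<forall>y\<in>spectral_dom E f. z' \<bullet> y = spectral_form E f x y"
  show "z' = z"
  proof (rule eq_if_inner_dom_eq)
    show "z' \<bullet> y = z \<bullet> y" if "y \<in> spectral_dom E f" for y
      using bspec[OF z' that] assms[OF that] by (rule trans[OF _ sym])
  qed
qed

text \<open>The limit satisfies the condition that defines \<open>spectral_op\<close>, and this
  condition has one solution because the ranges of the \<open>E m\<close> make the domain
  dense.\<close>

lemma \<Phi>_tendsto:
  assumes x: "x \<in> spectral_dom E f" shows "(\<lambda>k. \<Phi> f k x) \<longlonglongrightarrow> spectral_op E f x"
proof -
  obtain z where z: "(\<lambda>k. \<Phi> f k x) \<longlonglongrightarrow> z" using \<Phi>_convergent[OF x] unfolding convergent_def by blast
  have "spectral_op E f x = z"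
  proof (rule spectral_op_unique)
    fix y assume y: "y \<in> spectral_dom E f"
    have "(\<lambda>k. \<Phi> f k x \<bullet> y) \<longlonglongrightarrow> z \<bullet> y" by (intro tendsto_intros z)
    then show "z \<bullet> y = spectral_form E f x y" using \<Phi>_form_tendsto[OF x y] by (rule LIMSEQ_unique)
  qed
  then show ?thesis using z by simp
qed

lemma spectral_op_form:
  assumes "x \<in> spectral_dom E f" "y \<in> spectral_dom E f"
  shows "spectral_op E f x \<bullet> y = spectral_form E f x y"
proof -
  have "(\<lambda>k. \<Phi> f k x \<bullet> y) \<longlonglongrightarrow> spectral_op E f x \<bullet> y"
    by (rule tendsto_inner[OF \<Phi>_tendsto[OF assms(1)] tendsto_const])
  then show ?thesis using \<Phi>_form_tendsto[OF assms] by (rule LIMSEQ_unique)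
qed

end

context resolution_fun begin

abbreviation "opf \<equiv> spectral_op E f"
abbreviation "domf \<equiv> spectral_dom E f"

lemma op_add: assumes "x \<in> domf" "y \<in> domf" shows "opf (x + y) = opf x + opf y"
proof -
  have "(\<lambda>k. \<Phi> f k (x + y)) \<longlonglongrightarrow> opf x + opf y"
    unfolding linear_add[OF \<Phi>_linear] by (rule tendsto_add[OF \<Phi>_tendsto[OF assms(1)] \<Phi>_tendsto[OF assms(2)]])
  from LIMSEQ_unique[OF \<Phi>_tendsto[OF subspace_add[OF dom_subspace assms]] this] show ?thesis .
qed

lemma op_scale: assumes "x \<in> domf" shows "opf (c *\<^sub>R x) = c *\<^sub>R opf x"
proof -
  have "(\<lambda>k. \<Phi> f k (c *\<^sub>R x)) \<longlonglongrightarrow> c *\<^sub>R opf x"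
    unfolding linear_scale[OF \<Phi>_linear] by (rule tendsto_scaleR[OF tendsto_const \<Phi>_tendsto[OF assms]])
  from LIMSEQ_unique[OF \<Phi>_tendsto[OF subspace_scale[OF dom_subspace assms]] this] show ?thesis .
qed

lemma op_diff: assumes "x \<in> domf" "y \<in> domf" shows "opf (x - y) = opf x - opf y"
  using op_add[OF assms(1) subspace_scale[OF dom_subspace assms(2), of "-1"]] op_scale[OF assms(2), of "-1"] by simp

lemma op_E: assumes "x \<in> domf" shows "opf (E l x) = E l (opf x)"
proof -
  have "(\<lambda>k. \<Phi> f k (E l x)) \<longlonglongrightarrow> E l (opf x)"
    unfolding \<Phi>_E by (rule E_tendsto[OF \<Phi>_tendsto[OF assms]])
  from LIMSEQ_unique[OF \<Phi>_tendsto[OF E_in_dom] this] show ?thesis .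
qed

lemma op_sym: assumes "x \<in> domf" "y \<in> domf" shows "opf x \<bullet> y = x \<bullet> opf y"
proof -
  have "(\<lambda>k. \<Phi> f k x \<bullet> y) \<longlonglongrightarrow> opf x \<bullet> y" "(\<lambda>k. x \<bullet> \<Phi> f k y) \<longlonglongrightarrow> x \<bullet> opf y"
    by (rule tendsto_inner[OF \<Phi>_tendsto[OF assms(1)] tendsto_const]
        tendsto_inner[OF tendsto_const \<Phi>_tendsto[OF assms(2)]])+
  from LIMSEQ_unique[OF this(1)[unfolded \<Phi>_sym] this(2)] show ?thesis .
qed

lemma op_truncated: assumes "0 \<le> m" shows "norm (opf (E m x)) \<le> f m * norm x"
proof (rule LIMSEQ_le_const2)
  show "(\<lambda>k. norm (\<Phi> f k (E m x))) \<longlonglongrightarrow> norm (opf (E m x))"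
    by (intro tendsto_norm \<Phi>_tendsto E_in_dom)
qed (use \<Phi>_truncated[OF assms] in blast)

lemma op_E_tendsto: assumes "x \<in> domf" shows "(\<lambda>n. opf (E (real n) x)) \<longlonglongrightarrow> opf x"
  unfolding op_E[OF assms] by (rule E_seq)

lemma norm_op: assumes x: "x \<in> domf" shows "(norm (opf x))\<^sup>2 = (LINT l|\<mu> x. (f l)\<^sup>2)"
proof -
  have "(\<lambda>k. LINT l|\<mu> x. (step f k l)\<^sup>2) \<longlonglongrightarrow> (LINT l|\<mu> x. (f l)\<^sup>2)"
  proof (rule integral_dominated_convergence[where w = "\<lambda>l. (f l)\<^sup>2"])
    show "integrable (\<mu> x) (\<lambda>l. (f l)\<^sup>2)" using x by (simp add: dom_integrable)
    show "AE l in \<mu> x. (\<lambda>k. (step f k l)\<^sup>2) \<longlonglongrightarrow> (f l)\<^sup>2"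
      using AE_\<mu>_pos[of x] by eventually_elim (intro tendsto_intros step_tendsto)
    show "AE l in \<mu> x. norm ((step f k l)\<^sup>2) \<le> (f l)\<^sup>2" for k
      using AE_\<mu>_pos[of x] by eventually_elim (use step_bounds in \<open>auto intro: power_mono\<close>)
  qed auto
  moreover have "(\<lambda>k. (norm (\<Phi> f k x))\<^sup>2) \<longlonglongrightarrow> (norm (opf x))\<^sup>2"
    by (rule tendsto_power[OF tendsto_norm[OF \<Phi>_tendsto[OF x]]])
  ultimately show ?thesis unfolding norm_\<Phi> by (rule LIMSEQ_unique[symmetric])
qed

lemma norm_\<Phi>_le: assumes x: "x \<in> domf" shows "norm (\<Phi> f k x) \<le> norm (opf x)"
proof (rule power2_le_imp_le)
  show "(norm (\<Phi> f k x))\<^sup>2 \<le> (norm (opf x))\<^sup>2" unfolding norm_\<Phi> norm_op[OF x]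
  proof (rule integral_mono_AE)
    show "integrable (\<mu> x) (\<lambda>l. (step f k l)\<^sup>2)" using integrable_step_mult[of x k k] by (simp add: power2_eq_square)
    show "integrable (\<mu> x) (\<lambda>l. (f l)\<^sup>2)" using x by (simp add: dom_integrable)
    show "AE l in \<mu> x. (step f k l)\<^sup>2 \<le> (f l)\<^sup>2"
      using AE_\<mu>_pos[of x] by eventually_elim (use step_bounds in \<open>auto intro: power_mono\<close>)
  qed
qed simp

text \<open>Each \<open>\<Phi> f k\<close> is bounded on the whole space, so the common bound of the
  \<open>\<Phi> f k (X i)\<close> passes to \<open>x\<close>.\<close>

lemma op_bounded_limit:
  assumes x: "\<And>i. X i \<in> domf" and lim: "X \<longlonglongrightarrow> x" and bd: "\<And>i. norm (opf (X i)) \<le> C"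
  shows "x \<in> domf"
proof -
  have "norm (\<Phi> f k x) \<le> C" for k
  proof (rule LIMSEQ_le_const2)
    show "(\<lambda>i. norm (\<Phi> f k (X i))) \<longlonglongrightarrow> norm (\<Phi> f k x)"
      by (intro tendsto_norm bounded_linear.tendsto[OF \<Phi>_bl] lim)
    show "\<exists>N. \<forall>i\<ge>N. norm (\<Phi> f k (X i)) \<le> C" using norm_\<Phi>_le[OF x] bd order_trans by blast
  qed
  then show ?thesis unfolding dom_iff_bounded by blast
qed

lemma op_closed:
  assumes x: "\<And>i. X i \<in> domf" and lim: "X \<longlonglongrightarrow> x" and opl: "(\<lambda>i. opf (X i)) \<longlonglongrightarrow> z"
  shows "x \<in> domf \<and> opf x = z"
proof
  obtain C where "\<And>i. norm (opf (X i)) \<le> C"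
    using convergent_imp_Bseq[OF convergentI[OF opl]] by (auto simp: Bseq_def)
  then show xd: "x \<in> domf" using op_bounded_limit[OF x lim] by blast
  show "opf x = z"
  proof (rule eq_if_inner_dom_eq)
    fix y assume y: "y \<in> domf"
    have "(\<lambda>i. opf (X i) \<bullet> y) \<longlonglongrightarrow> z \<bullet> y" "(\<lambda>i. X i \<bullet> opf y) \<longlonglongrightarrow> x \<bullet> opf y"
      by (intro tendsto_intros opl lim)+
    then show "opf x \<bullet> y = z \<bullet> y" unfolding op_sym[OF x y] op_sym[OF xd y] by (rule LIMSEQ_unique[symmetric])
  qed
qed

end

text \<open>The resolution behind \<open>power_op\<close> is a choice known only through
  \<open>is_spectral_resolution\<close>, so its support must be derived from that. A nonzero vector
  in the range of \<open>E 0 - E (- n)\<close> would lie in \<open>D\<close> with a nonpositive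
  form, against the lower bound.\<close>

lemma (in resolution) E_0_if_positive:
  assumes sr: "is_spectral_resolution D A E" and \<nu>: "\<nu> > 0"
    and lower: "\<And>u. u \<in> D \<Longrightarrow> \<nu> * (norm u)\<^sup>2 \<le> A u \<bullet> u"
  shows "E 0 x = 0"
proof -
  define w where "w n y = E 0 y - E (- real n) y" for n y
  have supp: "AE l in \<mu> (w n y). - real n < l \<and> l \<le> 0" for n y
  proof -
    have "E (- real n) (w n y) = 0" by (simp add: w_def E_diff E_min)
    from AE_\<mu>_greater[OF this] have "AE l in \<mu> (w n y). - real n < l" .
    moreover have "E 0 (w n y) = w n y" by (simp add: w_def E_diff E_min)
    then have "AE l in \<mu> (w n y). l \<le> 0" using AE_\<mu>_le[of 0 "w n y"] by metis
    ultimately show ?thesis by eventually_elim simp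
  qed
  have int: "(LINT l|\<mu> (w n y). l) \<le> 0" for n y
  proof -
    have "0 \<le> (LINT l|\<mu> (w n y). - l)"
      by (rule integral_nonneg_AE) (use supp[of n y] in \<open>auto elim: eventually_mono\<close>)
    then show ?thesis by simp
  qed
  have int0: "(LINT l|\<mu> 0. l) = 0"
  proof -
    have w0: "w 0 0 = 0" by (simp add: w_def E_zero)
    from supp[of 0 0] have "AE l in \<mu> (w 0 0). l = 0" by eventually_elim simp
    then have "AE l in \<mu> 0. l = 0" unfolding w0 .
    then show ?thesis by (intro integral_eq_zero_AE)
  qed
  have "w n x = 0" for n
  proof -
    have "integrable (\<mu> (w n x)) (\<lambda>l. l\<^sup>2)"
    proof (rule finite_measure.integrable_const_bound[OF finite_\<mu>])
      show "AE l in \<mu> (w n x). norm (l\<^sup>2) \<le> (real n)\<^sup>2" using supp[of n x]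
      proof eventually_elim
        case (elim l)
        then have "\<bar>l\<bar> \<le> real n" by linarith
        then have "\<bar>l\<bar>\<^sup>2 \<le> (real n)\<^sup>2" by (intro power_mono) auto
        then show ?case by simp
      qed
    qed simp
    then have wD: "w n x \<in> D" using sr by (simp add: is_spectral_resolution_def spectral_dom_def)
    have "A (w n x) \<bullet> w n x = spectral_form E (\<lambda>l. l) (w n x) (w n x)"
      using sr wD by (simp add: is_spectral_resolution_def)
    \<comment> \<open>On the diagonal the polarization has the arguments \<open>x + x\<close> and 0;
      the zero vector contributes nothing by \<open>int0\<close>.\<close>
    also have "\<dots> = (LINT l|\<mu> (w n (x + x)). l) / 4"
      by (simp add: spectral_form_def int0 w_def E_add algebra_simps)
    also have "\<dots> \<le> 0" using int by simp
    finally have "\<nu> * (norm (w n x))\<^sup>2 \<le> 0" using lower[OF wD] by linarith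
    then show ?thesis using \<nu> by (simp add: mult_le_0_iff power2_eq_iff_nonneg)
  qed
  then have "E 0 x = E (- real n) x" for n by (simp add: w_def)
  moreover have "(\<lambda>n. E (- real n) x) \<longlonglongrightarrow> 0"
    using filterlim_compose[where g = "\<lambda>l. E l x" and f = "\<lambda>n. - real n",
        OF E_bot filterlim_compose[OF filterlim_uminus_at_bot_at_top filterlim_real_sequentially]] .
  ultimately have "(\<lambda>n::nat. E 0 x) \<longlonglongrightarrow> 0" by simp
  then show ?thesis by (simp add: LIMSEQ_const_iff)
qed

section \<open>Identification of A with its spectral integral\<close>

context positive_self_adjoint begin

text \<open>On the complement of \<open>M l\<close> in \<open>M m\<close> the form of
  \<open>B = A - l\<close> lies between 0 and \<open>m - l\<close>. A form bound becomes a norm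
  bound by testing positivity of \<open>B\<close> at \<open>y - s *\<^sub>R B y\<close> with
  \<open>s = 1 / (m - l)\<close>.\<close>

lemma block_bound:
  assumes lm: "0 \<le> l" "l < m" and y: "y \<in> M m" "\<And>z. z \<in> M l \<Longrightarrow> y \<bullet> z = 0"
  shows "A y - l *\<^sub>R y \<in> M m" "z \<in> M l \<Longrightarrow> (A y - l *\<^sub>R y) \<bullet> z = 0"
    "norm (A y - l *\<^sub>R y) \<le> (m - l) * norm y"
proof -
  have m: "m > 0" using lm by simp
  define B where "B w = A w - l *\<^sub>R w" for w
  define X where "X = {w. w \<in> M m \<and> (\<forall>z\<in>M l. w \<bullet> z = 0)}"
  have XD: "w \<in> D" if "w \<in> X" for w using that M_A(1)[OF _ m] by (simp add: X_def)
  have BX: "B w \<in> X" if w: "w \<in> X" for w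
  proof -
    have "B w \<in> M m" unfolding B_def using w M_A(2)[OF _ m] M_subspace
      by (auto simp: X_def intro!: subspace_diff subspace_scale)
    moreover have "B w \<bullet> z = 0" if z: "z \<in> M l" for z
    proof (cases "l > 0")
      case True
      then have "z \<in> D" "A z \<in> M l" using M_A z by auto
      then have "A w \<bullet> z = 0" using A_sym[OF XD[OF w]] w by (simp add: X_def)
      then show ?thesis using w z by (simp add: B_def X_def inner_diff_left)
    next
      case False
      then have "z = 0" using M_zero[of l] z by auto
      then show ?thesis by simp
    qed
    ultimately show ?thesis by (simp add: X_def)
  qed
  have Xd: "v - c *\<^sub>R w \<in> X" if "v \<in> X" "w \<in> X" for v w c
    using that M_subspace by (auto simp: X_def inner_diff_left intro!: subspace_diff subspace_scale)
  have low: "0 \<le> B w \<bullet> w" if "w \<in> X" for w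
    using M_orth_lower[OF XD[OF that], of l] that
    by (simp add: B_def X_def inner_diff_left power2_norm_eq_inner)
  have up: "B w \<bullet> w \<le> (m - l) * (w \<bullet> w)" if "w \<in> X" for w
  proof -
    have "A w \<bullet> w \<le> norm (A w) * norm w" by (rule norm_cauchy_schwarz)
    also have "\<dots> \<le> m * norm w * norm w"
      using M_A(3)[OF _ m, of w] that by (intro mult_right_mono) (auto simp: X_def)
    also have "\<dots> = m * (w \<bullet> w)" by (simp add: dot_square_norm power2_eq_square)
    finally show ?thesis by (simp add: B_def inner_diff_left algebra_simps)
  qed
  have yX: "y \<in> X" using y by (simp add: X_def)
  then show "A y - l *\<^sub>R y \<in> M m" "z \<in> M l \<Longrightarrow> (A y - l *\<^sub>R y) \<bullet> z = 0"
    using BX[OF yX] by (auto simp: X_def B_def)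
  define s where "s = 1 / (m - l)"
  have s: "s > 0" "s * (m - l) = 1" using lm by (auto simp: s_def)
  define b where "b = B y"
  have bX: "b \<in> X" unfolding b_def by (rule BX[OF yX])
  have Bsym: "B b \<bullet> y = b \<bullet> b"
    using A_sym[OF XD[OF bX] XD[OF yX]] by (simp add: b_def B_def inner_diff_left inner_diff_right)
  have "B (v - c *\<^sub>R w) = B v - c *\<^sub>R B w" if "v \<in> D" "w \<in> D" for v w c
    using that A_diff[OF that(1) subspace_scale[OF D_subspace that(2), of c]]
    by (simp add: B_def A_scale algebra_simps)
  then have Bdiff: "B (y - s *\<^sub>R b) = b - s *\<^sub>R B b"
    using XD[OF bX] XD[OF yX] by (simp add: b_def)
  have "0 \<le> B (y - s *\<^sub>R b) \<bullet> (y - s *\<^sub>R b)" by (rule low[OF Xd[OF yX bX]])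
  also have "\<dots> = b \<bullet> y - 2 * s * (b \<bullet> b) + s\<^sup>2 * (B b \<bullet> b)"
    unfolding Bdiff using Bsym by (simp add: inner_diff_left inner_diff_right power2_eq_square algebra_simps)
  also have "\<dots> \<le> (m - l) * (y \<bullet> y) - 2 * s * (b \<bullet> b) + s\<^sup>2 * ((m - l) * (b \<bullet> b))"
    using up[OF bX] up[OF yX] s(1) by (intro add_mono diff_mono mult_left_mono) (auto simp: b_def)
  also have "s\<^sup>2 * ((m - l) * (b \<bullet> b)) = (s * (m - l)) * s * (b \<bullet> b)" by (simp add: power2_eq_square)
  also have "\<dots> = s * (b \<bullet> b)" by (simp add: s)
  finally have "s * (b \<bullet> b) \<le> (m - l) * (y \<bullet> y)" by simp
  then have "(m - l) * (s * (b \<bullet> b)) \<le> (m - l) * ((m - l) * (y \<bullet> y))" using lm by (intro mult_left_mono) auto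
  moreover have "(m - l) * (s * (b \<bullet> b)) = b \<bullet> b" using s by (simp add: mult.assoc[symmetric] mult.commute)
  ultimately have "(norm b)\<^sup>2 \<le> ((m - l) * norm y)\<^sup>2"
    unfolding power_mult_distrib power2_norm_eq_inner by (simp add: power2_eq_square mult.assoc)
  then show "norm (A y - l *\<^sub>R y) \<le> (m - l) * norm y"
    unfolding b_def B_def by (rule power2_le_imp_le) (use lm in simp)
qed

sublocale res: resolution_fun "\<lambda>l. proj (M l)" "\<lambda>l. l"
  by unfold_locales (auto simp: spectral.resolution spectral.proj_zero)

text \<open>The blocks are invariant under \<open>A\<close>, so their errors \<open>v i\<close> are
  mutually orthogonal. By Pythagoras the squares add up, and the total error is at most the mesh
  times \<open>norm x\<close>, however many blocks there are.\<close>

lemma \<Phi>_approx: "norm (res.\<Phi> (\<lambda>l. l) k x - A (proj (M (2 ^ k)) x)) \<le> 1 / 2 ^ k * norm x"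
proof -
  define y where "y i = res.incr k i x" for i
  define v where "v i = A (y i) - (real i / 2 ^ k) *\<^sub>R y i" for i
  have lt: "real i / 2 ^ k < real (Suc i) / 2 ^ k" for i by (simp add: divide_strict_right_mono)
  have yM: "y i \<in> M (real (Suc i) / 2 ^ k)" for i
    unfolding y_def res.incr_def
    by (intro subspace_diff M_subspace spectral.pr_in subsetD[OF M_mono[OF less_imp_le[OF lt]]])
  have yo: "y i \<bullet> z = 0" if "z \<in> M (real i / 2 ^ k)" for i z
  proof -
    have "z \<in> M (real (Suc i) / 2 ^ k)" using subsetD[OF M_mono[OF less_imp_le[OF lt]] that] .
    then show ?thesis using that
      by (simp add: y_def res.incr_def inner_diff_left res.E_sym spectral.pr_id)
  qed
  have yD: "y i \<in> D" for i using M_A(1)[OF yM] by simp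
  note bb = block_bound[OF _ lt yM yo]
  have ortho: "orthogonal (v i) (v j) \<and> orthogonal (y i) (y j)" if "i < j" for i j
  proof -
    have le: "real (Suc i) / 2 ^ k \<le> real j / 2 ^ k" using that by (intro divide_right_mono) auto
    have "v i \<in> M (real j / 2 ^ k)" unfolding v_def using subsetD[OF M_mono[OF le] bb(1)] by simp
    then have "v j \<bullet> v i = 0" unfolding v_def[of j] using bb(2) by simp
    moreover have "y j \<bullet> y i = 0" using yo subsetD[OF M_mono[OF le] yM] by blast
    ultimately show ?thesis by (simp add: orthogonal_def inner_commute)
  qed
  have ov: "pairwise (\<lambda>i j. orthogonal (v i) (v j)) {..<4 ^ k}"
    and oy: "pairwise (\<lambda>i j. orthogonal (y i) (y j)) {..<4 ^ k}"
    unfolding pairwise_def using ortho by (metis linorder_neqE_nat orthogonal_commute)+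
  have "(2::real) ^ k * 2 ^ k = 4 ^ k" by (simp flip: power_mult_distrib)
  then have e2: "real (4 ^ k) / 2 ^ k = 2 ^ k" by (simp add: field_simps)
  have sy: "(\<Sum>i<4 ^ k. y i) = proj (M (2 ^ k)) x"
  proof -
    have "(\<Sum>i<4 ^ k. y i) = proj (M (real (4 ^ k) / 2 ^ k)) x - proj (M (real 0 / 2 ^ k)) x"
      unfolding y_def res.incr_def by (rule sum_lessThan_telescope)
    then show ?thesis using e2 by (simp add: spectral.proj_zero)
  qed
  have AS: "A (\<Sum>i\<in>I. y i) = (\<Sum>i\<in>I. A (y i)) \<and> (\<Sum>i\<in>I. y i) \<in> D" if "finite I" for I
    using that by induction (auto simp: A_0 A_add yD D_subspace subspace_0 subspace_add)
  have eq: "A (proj (M (2 ^ k)) x) - res.\<Phi> (\<lambda>l. l) k x = (\<Sum>i<4 ^ k. v i)"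
    unfolding sy[symmetric] res.\<Phi>_def v_def sum_subtractf using AS[of "{..<4 ^ k}"] by (simp add: y_def)
  have "(norm (\<Sum>i<4 ^ k. v i))\<^sup>2 = (\<Sum>i<4 ^ k. (norm (v i))\<^sup>2)"
    by (rule norm_sum_Pythagorean[OF _ ov]) simp
  also have "\<dots> \<le> (\<Sum>i<4 ^ k. (1 / 2 ^ k)\<^sup>2 * (norm (y i))\<^sup>2)"
  proof (rule sum_mono)
    fix i
    have "norm (v i) \<le> (real (Suc i) / 2 ^ k - real i / 2 ^ k) * norm (y i)" unfolding v_def using bb(3) by simp
    also have "real (Suc i) / 2 ^ k - real i / 2 ^ k = 1 / 2 ^ k" by (simp add: field_simps)
    finally have "(norm (v i))\<^sup>2 \<le> (1 / 2 ^ k * norm (y i))\<^sup>2" by (rule power_mono) simp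
    then show "(norm (v i))\<^sup>2 \<le> (1 / 2 ^ k)\<^sup>2 * (norm (y i))\<^sup>2" unfolding power_mult_distrib .
  qed
  also have "\<dots> = (1 / 2 ^ k)\<^sup>2 * (norm (\<Sum>i<4 ^ k. y i))\<^sup>2"
    unfolding sum_distrib_left[symmetric] by (subst norm_sum_Pythagorean[OF _ oy]) simp_all
  also have "\<dots> \<le> (1 / 2 ^ k)\<^sup>2 * (norm x)\<^sup>2"
    unfolding sy by (intro mult_left_mono power_mono res.E_norm_le) auto
  also have "\<dots> = (1 / 2 ^ k * norm x)\<^sup>2" by (rule power_mult_distrib[symmetric])
  finally have "norm (\<Sum>i<4 ^ k. v i) \<le> 1 / 2 ^ k * norm x" by (rule power2_le_imp_le) simp
  then show ?thesis unfolding eq[symmetric] by (simp add: norm_minus_commute)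
qed

lemma \<Phi>_A_tendsto: "(\<lambda>k. res.\<Phi> (\<lambda>l. l) k x - A (proj (M (2 ^ k)) x)) \<longlonglongrightarrow> 0"
proof (rule tendsto_norm_zero_cancel, rule tendsto_sandwich)
  show "\<forall>\<^sub>F k in sequentially. 0 \<le> norm (res.\<Phi> (\<lambda>l. l) k x - A (proj (M (2 ^ k)) x))" by simp
  show "\<forall>\<^sub>F k in sequentially. norm (res.\<Phi> (\<lambda>l. l) k x - A (proj (M (2 ^ k)) x)) \<le> (1 / 2) ^ k * norm x"
    using \<Phi>_approx[of _ x] by (simp add: power_one_over)
  have "(\<lambda>k. (1 / 2 :: real) ^ k) \<longlonglongrightarrow> 0" by (rule LIMSEQ_power_zero) simp
  then show "(\<lambda>k. (1 / 2) ^ k * norm x) \<longlonglongrightarrow> 0" using tendsto_mult_left_zero by blast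
qed simp

lemma proj_2_power_tendsto: "(\<lambda>k. proj (M (2 ^ k)) x) \<longlonglongrightarrow> x"
proof -
  have "filterlim (\<lambda>k. 2 ^ k :: real) at_top sequentially"
    by (rule filterlim_at_top_mono[OF filterlim_real_sequentially])
      (intro always_eventually allI less_imp_le of_nat_less_two_power)
  from filterlim_compose[where g = "\<lambda>l. proj (M l) x", OF spectral.proj_tendsto_at_top this]
  show ?thesis .
qed

text \<open>By \<open>\<Phi>_A_tendsto\<close> the Riemann sums and \<open>A\<close> of the
  projected vector differ by a null sequence for every \<open>x\<close>. For \<open>x\<close> in
  \<open>D\<close> the latter is the projection of \<open>A x\<close>, hence bounded; for
  \<open>x\<close> in the spectral domain it converges, and \<open>A\<close> is closed.\<close>

lemma D_eq_dom: "D = spectral_dom (\<lambda>l. proj (M l)) (\<lambda>l. l)"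
proof (intro equalityI subsetI)
  fix x assume x: "x \<in> D"
  have "norm (res.\<Phi> (\<lambda>l. l) k x) \<le> norm x + norm (A x)" for k
  proof -
    have "norm (A (proj (M (2 ^ k)) x)) \<le> norm (A x)"
      unfolding proj_M_commute(2)[OF x] by (rule res.E_norm_le)
    moreover have "(1 / 2 ^ k) * norm x \<le> 1 * norm x" by (intro mult_right_mono) auto
    ultimately show ?thesis
      using \<Phi>_approx[of k x] norm_triangle_sub[of "res.\<Phi> (\<lambda>l. l) k x" "A (proj (M (2 ^ k)) x)"] by linarith
  qed
  then show "x \<in> spectral_dom (\<lambda>l. proj (M l)) (\<lambda>l. l)" unfolding res.dom_iff_bounded by blast
next
  fix x assume x: "x \<in> spectral_dom (\<lambda>l. proj (M l)) (\<lambda>l. l)"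
  have "(\<lambda>k. res.\<Phi> (\<lambda>l. l) k x - (res.\<Phi> (\<lambda>l. l) k x - A (proj (M (2 ^ k)) x)))
      \<longlonglongrightarrow> spectral_op (\<lambda>l. proj (M l)) (\<lambda>l. l) x - 0"
    by (rule tendsto_diff[OF res.\<Phi>_tendsto[OF x] \<Phi>_A_tendsto])
  then have lim: "(\<lambda>k. A (proj (M (2 ^ k)) x)) \<longlonglongrightarrow> spectral_op (\<lambda>l. proj (M l)) (\<lambda>l. l) x" by simp
  have "proj (M (2 ^ k)) x \<in> D" for k by (rule M_A(1)[OF spectral.pr_in]) simp
  from A_closed[OF this proj_2_power_tendsto lim] show "x \<in> D" ..
qed

lemma A_eq_op: assumes x: "x \<in> D" shows "A x = spectral_op (\<lambda>l. proj (M l)) (\<lambda>l. l) x"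
proof -
  have "(\<lambda>k. (res.\<Phi> (\<lambda>l. l) k x - A (proj (M (2 ^ k)) x)) + proj (M (2 ^ k)) (A x)) \<longlonglongrightarrow> 0 + A x"
    by (rule tendsto_add[OF \<Phi>_A_tendsto proj_2_power_tendsto])
  then have "(\<lambda>k. res.\<Phi> (\<lambda>l. l) k x) \<longlonglongrightarrow> A x" by (simp add: proj_M_commute(2)[OF x])
  from LIMSEQ_unique[OF this res.\<Phi>_tendsto] show ?thesis using x D_eq_dom by blast
qed

lemma spectral_resolution_exists: "is_spectral_resolution D A (\<lambda>l. proj (M l))"
  unfolding is_spectral_resolution_def
  using spectral.resolution D_eq_dom A_eq_op res.spectral_op_form by auto

section \<open>The chosen resolution and the square root of A\<close>

abbreviation "E \<equiv> spectral_resolution D A"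

lemma is_resolution: "is_spectral_resolution D A E"
  unfolding spectral_resolution_def by (rule someI[of _ "\<lambda>l. proj (M l)"]) (rule spectral_resolution_exists)

sublocale E: resolution_fun E "\<lambda>l. l"
proof -
  interpret R: resolution E
    by unfold_locales (use is_resolution in \<open>simp add: is_spectral_resolution_def\<close>)
  show "resolution_fun E (\<lambda>l. l)"
    by unfold_locales (auto simp: R.E_0_if_positive[OF is_resolution \<nu> lower])
qed

sublocale S: resolution_fun E "\<lambda>l. l powr (1 / 2)"
  by unfold_locales (auto intro: powr_mono2 continuous_intros)

lemma D_dom: "D = spectral_dom E (\<lambda>l. l)"
  using is_resolution by (simp add: is_spectral_resolution_def)

lemma A_op: assumes "x \<in> D" shows "spectral_op E (\<lambda>l. l) x = A x"
  by (rule E.spectral_op_unique) (use assms is_resolution in \<open>auto simp: is_spectral_resolution_def\<close>)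

abbreviation "V \<equiv> power_dom D A (1 / 2)"
abbreviation "S \<equiv> power_op D A (1 / 2)"

lemma V_dom: "V = spectral_dom E (\<lambda>l. l powr (1 / 2))" and S_op: "S = spectral_op E (\<lambda>l. l powr (1 / 2))"
  by (simp_all add: power_dom_def power_op_def fun_eq_iff)

lemmas S_add = S.op_add[folded V_dom S_op] and S_scale = S.op_scale[folded V_dom S_op]
  and S_diff = S.op_diff[folded V_dom S_op]
  and S_E_tendsto = S.op_E_tendsto[folded V_dom S_op]
  and S_closed = S.op_closed[folded V_dom S_op]
  and E_V = S.E_in_dom[folded V_dom] and E_D = E.E_in_dom[folded D_dom]

text \<open>Both step functions use the same left ends, so the square of one is exactly the other
  already at level \<open>k\<close>. The limit gives \<open>norm_S\<close>, and Cauchy-Schwarz gives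
  \<open>D_subset_V\<close>.\<close>

lemma norm_\<Phi>_sqrt: "(norm (E.\<Phi> (\<lambda>l. l powr (1 / 2)) k x))\<^sup>2 = E.\<Phi> (\<lambda>l. l) k x \<bullet> x"
proof -
  have "(E.step (\<lambda>l. l powr (1 / 2)) k l)\<^sup>2 = E.step (\<lambda>l. l) k l" for l
  proof (cases "0 < l \<and> l \<le> 2 ^ k")
    case True
    then obtain i where i: "i < 4 ^ k" "l \<in> E.cell k i" using E.cell_exists by blast
    have "((real i / 2 ^ k) powr (1 / 2))\<^sup>2 = real i / 2 ^ k" by (simp add: powr_half_sqrt)
    then show ?thesis using i by (simp add: E.step_cell)
  next
    case False
    then have "l \<le> 0 \<or> 2 ^ k < l" by linarith
    then show ?thesis by (simp add: E.step_outside)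
  qed
  then show ?thesis unfolding S.norm_\<Phi> E.integral_step[symmetric] by simp
qed

lemma D_subset_V: "x \<in> D \<Longrightarrow> x \<in> V"
  and norm_S: "x \<in> D \<Longrightarrow> (norm (S x))\<^sup>2 = A x \<bullet> x"
proof -
  assume x: "x \<in> D"
  have xd: "x \<in> spectral_dom E (\<lambda>l. l)" using x D_dom by blast
  have "norm (E.\<Phi> (\<lambda>l. l powr (1 / 2)) k x) \<le> sqrt (norm (A x) * norm x)" for k
  proof (rule real_le_rsqrt)
    have "E.\<Phi> (\<lambda>l. l) k x \<bullet> x \<le> norm (E.\<Phi> (\<lambda>l. l) k x) * norm x" by (rule norm_cauchy_schwarz)
    also have "\<dots> \<le> norm (A x) * norm x"
      using E.norm_\<Phi>_le[OF xd, of k] A_op[OF x] by (intro mult_right_mono) auto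
    finally show "(norm (E.\<Phi> (\<lambda>l. l powr (1 / 2)) k x))\<^sup>2 \<le> norm (A x) * norm x"
      unfolding norm_\<Phi>_sqrt .
  qed
  then have xs: "x \<in> spectral_dom E (\<lambda>l. l powr (1 / 2))" unfolding S.dom_iff_bounded by blast
  then show "x \<in> V" by (simp add: V_dom)
  have "(\<lambda>k. (norm (E.\<Phi> (\<lambda>l. l powr (1 / 2)) k x))\<^sup>2) \<longlonglongrightarrow> (norm (S x))\<^sup>2"
    unfolding S_op by (rule tendsto_power[OF tendsto_norm[OF S.\<Phi>_tendsto[OF xs]]])
  moreover have "(\<lambda>k. E.\<Phi> (\<lambda>l. l) k x \<bullet> x) \<longlonglongrightarrow> A x \<bullet> x"
    unfolding A_op[OF x, symmetric] by (rule tendsto_inner[OF E.\<Phi>_tendsto[OF xd] tendsto_const])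
  ultimately show "(norm (S x))\<^sup>2 = A x \<bullet> x" unfolding norm_\<Phi>_sqrt by (rule LIMSEQ_unique)
qed

lemma A_E: assumes "x \<in> D" shows "A (E l x) = E l (A x)"
  using E.op_E[of x l] assms A_op D_dom E_D by auto

lemma A_E_tendsto: assumes "x \<in> D" shows "(\<lambda>n. A (E (real n) x)) \<longlonglongrightarrow> A x"
  unfolding A_E[OF assms] by (rule E.E_seq)

lemma A_E_bounded_linear: assumes "0 \<le> m" shows "bounded_linear (\<lambda>x. A (E m x))"
proof (rule bounded_linear_intro[where K = m])
  show "A (E m (x + y)) = A (E m x) + A (E m y)" for x y by (simp add: E.E_add A_add E_D)
  show "A (E m (r *\<^sub>R x)) = r *\<^sub>R A (E m x)" for r x by (simp add: E.E_scale A_scale E_D)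
  show "norm (A (E m x)) \<le> norm x * m" for x
    using E.op_truncated[OF assms, of x] by (simp add: A_op E_D mult.commute)
qed

end

section \<open>Ordinary differential equations on the half line\<close>

text \<open>A nonzero functional is represented by a scaled normal to its kernel. This brings
  integrals taken in the dual back to the space.\<close>

lemma Riesz_representation:
  fixes \<phi> :: "'h::{real_inner,complete_space} \<Rightarrow>\<^sub>L real"
  shows "\<exists>z. \<phi> = blinfun_inner_right z"
proof (cases "\<exists>e. blinfun_apply \<phi> e \<noteq> 0")
  case True
  then obtain e where e: "blinfun_apply \<phi> e \<noteq> 0" by blast
  define K where "K = {x. blinfun_apply \<phi> x = 0}"
  have ss: "subspace K" by (auto simp: K_def subspace_def blinfun.add_right blinfun.scaleR_right)
  have cl: "closed K" unfolding K_def
    by (intro closed_Collect_eq continuous_intros)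
  define w where "w = e - proj K e"
  have \<phi>w: "blinfun_apply \<phi> w \<noteq> 0"
    using proj_in[OF cl ss, of e] e by (simp add: w_def K_def blinfun.diff_right)
  then have ww: "w \<bullet> w \<noteq> 0" by (auto simp: blinfun.zero_right)
  define z where "z = (blinfun_apply \<phi> w / (w \<bullet> w)) *\<^sub>R w"
  have "blinfun_apply \<phi> x = z \<bullet> x" for x
  proof -
    have "x - (blinfun_apply \<phi> x / blinfun_apply \<phi> w) *\<^sub>R w \<in> K"
      using \<phi>w by (simp add: K_def blinfun.diff_right blinfun.scaleR_right)
    then have "w \<bullet> (x - (blinfun_apply \<phi> x / blinfun_apply \<phi> w) *\<^sub>R w) = 0"
      unfolding w_def by (rule proj_orth[OF cl ss])
    then have "w \<bullet> x = (blinfun_apply \<phi> x / blinfun_apply \<phi> w) * (w \<bullet> w)" by (simp add: inner_diff_right)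
    then show ?thesis using \<phi>w ww by (simp add: z_def)
  qed
  then have "\<phi> = blinfun_inner_right z"
    by (intro blinfun_eqI) (simp add: blinfun_inner_right.rep_eq)
  then show ?thesis by (rule exI)
next
  case False
  then have "blinfun_apply \<phi> x = blinfun_apply 0 x" for x by simp
  then have "\<phi> = 0" by (rule blinfun_eqI)
  also have "\<dots> = blinfun_inner_right 0"
    by (rule bounded_linear.linear[OF bounded_linear_blinfun_inner_right, THEN linear_0, symmetric])
  finally show ?thesis by (rule exI)
qed

lemma norm_blinfun_inner_right: "norm (blinfun_inner_right x) = norm (x :: 'a::real_inner)"
proof (rule antisym)
  show "norm (blinfun_inner_right x) \<le> norm x"
    by (rule norm_blinfun_bound) (auto simp: blinfun_inner_right.rep_eq Cauchy_Schwarz_ineq2)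
  have "norm (blinfun_apply (blinfun_inner_right x) x) \<le> norm (blinfun_inner_right x) * norm x"
    by (rule norm_blinfun)
  then have "norm x * norm x \<le> norm (blinfun_inner_right x) * norm x"
    by (simp add: blinfun_inner_right.rep_eq dot_square_norm power2_eq_square)
  then show "norm x \<le> norm (blinfun_inner_right x)" by (cases "x = 0") auto
qed

lemma at_within_Icc_eq_half_line:
  fixes t T :: real
  assumes "t \<in> {0..<T}" shows "at t within {0..T} = at t within {0..}"
proof (rule at_within_nhd)
  show "t \<in> {..<T}" using assms by simp
  show "{0..T} \<inter> {..<T} - {t} = {0..} \<inter> {..<T} - {t}" by auto
qed simp

text \<open>A Hilbert space need not be of class \<^class>\<open>banach\<close>, which the Henstock-Kurzweil integral
  requires, but its dual is; so the integration is done there.\<close>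

lemma antiderivative_exists:
  fixes f :: "real \<Rightarrow> 'h::{real_inner,complete_space}"
  assumes f: "continuous_on {0..} f"
  shows "\<exists>F. F 0 = 0 \<and> (\<forall>t\<ge>0. (F has_vector_derivative f t) (at t within {0..}))"
proof -
  let ?\<iota> = "blinfun_inner_right :: 'h \<Rightarrow> _"
  interpret \<iota>: bounded_linear ?\<iota> by (rule bounded_linear_blinfun_inner_right)
  define G where "G t = integral {0..t} (\<lambda>s. ?\<iota> (f s))" for t
  define F where "F t = (SOME z. G t = ?\<iota> z)" for t
  have GF: "G t = ?\<iota> (F t)" for t
    unfolding F_def using someI_ex[OF Riesz_representation] .
  have "G 0 = 0" by (simp add: G_def)
  then have "norm (?\<iota> (F 0)) = 0" by (simp add: GF)
  then have "F 0 = 0" by (simp add: norm_blinfun_inner_right)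
  moreover have "(F has_vector_derivative f t) (at t within {0..})" if t: "t \<ge> 0" for t
  proof -
    have "continuous_on {0..t + 1} (\<lambda>s. ?\<iota> (f s))"
      by (intro \<iota>.continuous_on continuous_on_subset[OF f]) auto
    then have "(G has_vector_derivative ?\<iota> (f t)) (at t within {0..t + 1})"
      unfolding G_def using t by (intro integral_has_vector_derivative) auto
    then have "(G has_vector_derivative ?\<iota> (f t)) (at t within {0..})"
      using t at_within_Icc_eq_half_line[of t "t + 1"] by simp
    then have "((\<lambda>s. norm (G s - G t - (s - t) *\<^sub>R ?\<iota> (f t)) / norm (s - t)) \<longlongrightarrow> 0) (at t within {0..})"
      unfolding has_vector_derivative_def has_derivative_iff_norm by blast
    \<comment> \<open>The embedding is a linear isometry, so the difference quotients have the same
      norm on both sides.\<close>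
    moreover have "norm (G s - G t - (s - t) *\<^sub>R ?\<iota> (f t)) = norm (F s - F t - (s - t) *\<^sub>R f t)" for s
      unfolding GF by (simp flip: norm_blinfun_inner_right[of "F s - F t - (s - t) *\<^sub>R f t"] add: \<iota>.diff \<iota>.scaleR)
    ultimately show ?thesis
      unfolding has_vector_derivative_def has_derivative_iff_norm
      by (simp add: bounded_linear_scaleR_left)
  qed
  ultimately show ?thesis by blast
qed

lemma norm_increment_le:
  fixes F :: "real \<Rightarrow> 'a::real_normed_vector" and \<phi> \<phi>' :: "real \<Rightarrow> real"
  assumes "0 \<le> t"
    and F: "\<And>s. 0 \<le> s \<Longrightarrow> (F has_vector_derivative F' s) (at s within {0..})"
    and \<phi>: "\<And>s. (\<phi> has_real_derivative \<phi>' s) (at s)"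
    and le: "\<And>s. 0 \<le> s \<Longrightarrow> s \<le> t \<Longrightarrow> norm (F' s) \<le> \<phi>' s"
  shows "norm (F t - F 0) \<le> \<phi> t - \<phi> 0"
proof (cases "t = 0")
  case False
  show ?thesis
  proof (rule differentiable_bound_general)
    show "continuous_on {0..t} F"
      by (rule continuous_on_subset[of "{0..}"])
        (use F in \<open>auto intro: continuous_on_vector_derivative\<close>)
    show "continuous_on {0..t} \<phi>" using \<phi> by (intro DERIV_continuous_on) (auto intro: DERIV_subset)
    show "(F has_vector_derivative F' s) (at s)" if "0 < s" "s < t" for s
      using F[of s] that at_within_interior[of s "{0..}"] by (simp add: interior_Ici)
    show "(\<phi> has_vector_derivative \<phi>' s) (at s)" for s
      using \<phi> by (simp flip: has_real_derivative_iff_has_vector_derivative)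
  qed (use assms(1) False le in simp_all)
qed simp

text \<open>The mean value inequality gives \<open>w m - w N\<close> a small Lipschitz constant near
  \<open>t\<close>; letting \<open>m\<close> grow transfers it to \<open>W - w N\<close>, so
  \<open>W\<close> inherits the derivative of \<open>w N\<close> up to a small error.\<close>

lemma has_vector_derivative_limit:
  fixes w :: "nat \<Rightarrow> real \<Rightarrow> 'a::real_normed_vector"
  assumes w: "\<And>n t. 0 \<le> t \<Longrightarrow> (w n has_vector_derivative g n t) (at t within {0..})"
    and lim: "\<And>t. 0 \<le> t \<Longrightarrow> (\<lambda>n. w n t) \<longlonglongrightarrow> W t"
    and unif: "\<And>T e. 0 < e \<Longrightarrow> \<exists>N. \<forall>n\<ge>N. \<forall>t\<in>{0..T}. norm (g n t - G t) \<le> e"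
    and t: "0 \<le> t"
  shows "(W has_vector_derivative G t) (at t within {0..})"
  unfolding has_vector_derivative_def has_derivative_within_alt
proof (intro conjI allI impI)
  show "bounded_linear (\<lambda>h. h *\<^sub>R G t)" by (rule bounded_linear_scaleR_left)
  fix e :: real assume "0 < e"
  \<comment> \<open>Uniformity is only local; this interval contains all points of the half line at
    distance less than 1 from \<open>t\<close>, hence the later \<open>min d 1\<close>.\<close>
  define S where "S = {0..t + 1}"
  have tS: "t \<in> S" using t by (simp add: S_def)
  obtain N where N: "\<And>n s. N \<le> n \<Longrightarrow> s \<in> S \<Longrightarrow> norm (g n s - G s) \<le> e / 4"
  proof -
    have "0 < e / 4" using \<open>0 < e\<close> by simp
    from unif[OF this, of "t + 1"] show ?thesis using that unfolding S_def by blast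
  qed
  have "\<forall>m\<ge>N. \<forall>n\<ge>N. \<forall>x\<in>S. \<forall>y\<in>S. norm ((w m x - w n x) - (w m y - w n y)) \<le> 2 * (e / 4) * norm (x - y)"
  proof (rule has_derivative_sequence_lipschitz_lemma)
    show "(w n has_derivative (\<lambda>h. h *\<^sub>R g n x)) (at x within S)" if "x \<in> S" for n x
      using w[of x n] that unfolding has_vector_derivative_def S_def
      by (auto intro: has_derivative_subset)
    show "norm (h *\<^sub>R g n x - h *\<^sub>R G x) \<le> e / 4 * norm h" if "N \<le> n" "x \<in> S" for n x h
    proof -
      have "norm (h *\<^sub>R g n x - h *\<^sub>R G x) = \<bar>h\<bar> * norm (g n x - G x)" by (simp flip: scaleR_diff_right)
      also have "\<dots> \<le> \<bar>h\<bar> * (e / 4)" using N[OF that] by (intro mult_left_mono) auto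
      finally show ?thesis by (simp add: mult.commute)
    qed
  qed (use \<open>0 < e\<close> in \<open>auto simp: S_def\<close>)
  then have lip: "norm ((w m x - w N x) - (w m t - w N t)) \<le> e / 2 * norm (x - t)" if "N \<le> m" "x \<in> S" for m x
    using that tS by force
  have lip': "norm ((W x - w N x) - (W t - w N t)) \<le> e / 2 * norm (x - t)" if x: "x \<in> S" for x
  proof (rule LIMSEQ_le_const2)
    have "0 \<le> x" using x by (simp add: S_def)
    then show "(\<lambda>m. norm ((w m x - w N x) - (w m t - w N t))) \<longlonglongrightarrow> norm ((W x - w N x) - (W t - w N t))"
      by (intro tendsto_norm tendsto_diff lim t tendsto_const)
  qed (intro exI[of _ N] allI impI lip x)
  obtain d where d: "d > 0" "\<And>y. y \<in> {0..} \<Longrightarrow> norm (y - t) < d \<Longrightarrow>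
      norm (w N y - w N t - (y - t) *\<^sub>R g N t) \<le> e / 4 * norm (y - t)"
    using w[OF t, of N] \<open>0 < e\<close> unfolding has_vector_derivative_def has_derivative_within_alt
    by (metis divide_pos_pos zero_less_numeral)
  show "\<exists>d>0. \<forall>y\<in>{0..}. norm (y - t) < d \<longrightarrow> norm (W y - W t - (y - t) *\<^sub>R G t) \<le> e * norm (y - t)"
  proof (intro exI[of _ "min d 1"] conjI ballI impI)
    fix y :: real assume y: "y \<in> {0..}" "norm (y - t) < min d 1"
    have yS: "y \<in> S" using y by (auto simp: S_def)
    have "W y - W t - (y - t) *\<^sub>R G t = ((W y - w N y) - (W t - w N t))
        + (w N y - w N t - (y - t) *\<^sub>R g N t) + (y - t) *\<^sub>R (g N t - G t)"
      by (simp add: scaleR_diff_right)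
    also have "norm \<dots> \<le> e / 2 * norm (y - t) + e / 4 * norm (y - t) + norm (y - t) * (e / 4)"
    proof (intro norm_triangle_mono lip' yS)
      show "norm (w N y - w N t - (y - t) *\<^sub>R g N t) \<le> e / 4 * norm (y - t)" using y d by auto
      show "norm ((y - t) *\<^sub>R (g N t - G t)) \<le> norm (y - t) * (e / 4)"
        unfolding norm_scaleR real_norm_def using N[OF le_refl tS] by (intro mult_left_mono) auto
    qed
    also have "\<dots> = e * norm (y - t)" by (simp add: algebra_simps)
    finally show "norm (W y - W t - (y - t) *\<^sub>R G t) \<le> e * norm (y - t)" .
  qed (use d(1) in simp)
qed

lemma ode_solution_exists:
  fixes f :: "real \<Rightarrow> 'h::{real_inner,complete_space} \<Rightarrow> 'h"
  assumes lip: "\<And>t x y. 0 \<le> t \<Longrightarrow> norm (f t x - f t y) \<le> K * norm (x - y)"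
    and cont: "\<And>x. continuous_on {0..} x \<Longrightarrow> continuous_on {0..} (\<lambda>t. f t (x t))"
    and K: "0 < K"
  shows "\<exists>x. x 0 = x0 \<and> (\<forall>t\<ge>0. (x has_vector_derivative f t (x t)) (at t within {0..}))"
proof -
  define I where "I g = (SOME F. F 0 = 0 \<and> (\<forall>t\<ge>0. (F has_vector_derivative g t) (at t within {0..})))"
    for g :: "real \<Rightarrow> 'h"
  have I: "I g 0 = 0 \<and> (\<forall>t\<ge>0. (I g has_vector_derivative g t) (at t within {0..}))"
    if "continuous_on {0..} g" for g
    unfolding I_def using someI_ex[OF antiderivative_exists[OF that]] .
  define w where "w = rec_nat (\<lambda>t. x0) (\<lambda>_ v t. x0 + I (\<lambda>s. f s (v s)) t)"
  have w_Suc: "w (Suc k) = (\<lambda>t. x0 + I (\<lambda>s. f s (w k s)) t)" for k by (simp add: w_def)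
  have w_0: "w 0 = (\<lambda>t. x0)" by (simp add: w_def)
  have wc: "continuous_on {0..} (w k)" for k
  proof (induction k)
    case (Suc k)
    have "continuous_on {0..} (I (\<lambda>s. f s (w k s)))"
      using I[OF cont[OF Suc]] by (intro continuous_on_vector_derivative) auto
    then show ?case unfolding w_Suc by (intro continuous_intros)
  qed (simp add: w_0)
  have wd: "(w (Suc k) has_vector_derivative f t (w k t)) (at t within {0..})" if "0 \<le> t" for k t
    unfolding w_Suc using I[OF cont[OF wc]] that by (auto intro!: derivative_eq_intros)
  have w_init: "w k 0 = x0" for k
    using I[OF cont[OF wc]] by (cases k) (auto simp: w_0 w_Suc)
  have step: "\<exists>C\<ge>0. \<forall>k. \<forall>t\<in>{0..T}. norm (w (Suc k) t - w k t) \<le> C / 2 ^ k" for T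
  proof -
    have "compact ((\<lambda>t. norm (w 1 t - w 0 t)) ` {0..T})"
      by (intro compact_continuous_image compact_Icc continuous_intros continuous_on_subset[OF wc]) auto
    then have "bounded ((\<lambda>t. norm (w 1 t - w 0 t)) ` {0..T})" by (rule compact_imp_bounded)
    then obtain C where bC: "\<And>y. y \<in> (\<lambda>t. norm (w 1 t - w 0 t)) ` {0..T} \<Longrightarrow> norm y \<le> C"
      unfolding bounded_iff by blast
    have C: "norm (w 1 t - w 0 t) \<le> C" if "t \<in> {0..T}" for t using bC[OF imageI[OF that]] by simp
    define C' where "C' = \<bar>C\<bar>"
    \<comment> \<open>Picard iteration against the weight \<open>exp (2 * K * t)\<close>:
      integrating \<open>K\<close> times the previous difference gains the factor 1/2, so the
      iterates converge on every interval, however long.\<close>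
    have ind: "norm (w (Suc k) t - w k t) \<le> C' / 2 ^ k * exp (2 * K * t)" if "t \<in> {0..T}" for k t
      using that
    proof (induction k arbitrary: t)
      case 0
      have "norm (w 1 t - w 0 t) \<le> C' * 1" using C[OF 0] by (simp add: C'_def)
      also have "\<dots> \<le> C' * exp (2 * K * t)" using 0 K by (intro mult_left_mono) (auto simp: C'_def)
      finally show ?case by simp
    next
      case (Suc k)
      define \<phi> where "\<phi> s = C' / 2 ^ Suc k * exp (2 * K * s)" for s
      have "norm ((w (Suc (Suc k)) t - w (Suc k) t) - (w (Suc (Suc k)) 0 - w (Suc k) 0)) \<le> \<phi> t - \<phi> 0"
      proof (rule norm_increment_le)
        show "((\<lambda>s. w (Suc (Suc k)) s - w (Suc k) s) has_vector_derivative
            f s (w (Suc k) s) - f s (w k s)) (at s within {0..})" if "0 \<le> s" for s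
          by (intro has_vector_derivative_diff wd that)
        show "(\<phi> has_real_derivative C' / 2 ^ k * K * exp (2 * K * s)) (at s)" for s
          unfolding \<phi>_def by (auto intro!: derivative_eq_intros)
        show "norm (f s (w (Suc k) s) - f s (w k s)) \<le> C' / 2 ^ k * K * exp (2 * K * s)"
          if "0 \<le> s" "s \<le> t" for s
        proof -
          have "norm (f s (w (Suc k) s) - f s (w k s)) \<le> K * norm (w (Suc k) s - w k s)" using that by (intro lip)
          also have "\<dots> \<le> K * (C' / 2 ^ k * exp (2 * K * s))"
            using Suc.IH[of s] Suc.prems that K by (intro mult_left_mono) auto
          finally show ?thesis by (simp add: mult_ac)
        qed
      qed (use Suc.prems in simp)
      moreover have "0 \<le> \<phi> 0" by (simp add: \<phi>_def C'_def)
      ultimately show ?case by (simp add: w_init \<phi>_def)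
    qed
    have "norm (w (Suc k) t - w k t) \<le> C' * exp (2 * K * T) / 2 ^ k" if "t \<in> {0..T}" for k t
    proof -
      have "norm (w (Suc k) t - w k t) \<le> C' / 2 ^ k * exp (2 * K * t)" by (rule ind[OF that])
      also have "\<dots> \<le> C' / 2 ^ k * exp (2 * K * T)" using that K by (intro mult_left_mono) (auto simp: C'_def)
      finally show ?thesis by simp
    qed
    then show ?thesis by (intro exI[of _ "C' * exp (2 * K * T)"]) (auto simp: C'_def)
  qed
  have geo: "\<exists>C\<ge>0. \<forall>m n. \<forall>t\<in>{0..T}. m \<le> n \<longrightarrow> norm (w n t - w m t) \<le> C / 2 ^ m" for T
  proof -
    obtain C where C: "C \<ge> 0" "\<And>k t. t \<in> {0..T} \<Longrightarrow> norm (w (Suc k) t - w k t) \<le> C / 2 ^ k" using step by blast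
    have tele: "norm (w n t - w m t) \<le> 2 * C / 2 ^ m - 2 * C / 2 ^ n" if t: "t \<in> {0..T}" and "m \<le> n" for m n t
      using \<open>m \<le> n\<close>
    proof (induction rule: dec_induct)
      case (step n)
      have "norm (w (Suc n) t - w m t) \<le> norm (w (Suc n) t - w n t) + norm (w n t - w m t)"
        using norm_triangle_ineq[of "w (Suc n) t - w n t" "w n t - w m t"] by simp
      also have "\<dots> \<le> C / 2 ^ n + (2 * C / 2 ^ m - 2 * C / 2 ^ n)" using C(2)[OF t, of n] step by simp
      also have "\<dots> = 2 * C / 2 ^ m - 2 * C / 2 ^ Suc n" by (simp add: field_simps)
      finally show ?case .
    qed simp
    have "norm (w n t - w m t) \<le> 2 * C / 2 ^ m" if "t \<in> {0..T}" "m \<le> n" for m n t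
    proof -
      have "0 \<le> 2 * C / 2 ^ n" using C(1) by simp
      then show ?thesis using tele[OF that] by linarith
    qed
    then show ?thesis using C(1) by (intro exI[of _ "2 * C"]) auto
  qed
  have pow0: "(\<lambda>n. C / 2 ^ n :: real) \<longlonglongrightarrow> 0" for C
  proof -
    have "(\<lambda>n. C * (1 / 2) ^ n :: real) \<longlonglongrightarrow> C * 0" by (rule tendsto_mult[OF tendsto_const LIMSEQ_power_zero]) simp
    then show ?thesis by (simp add: power_one_over)
  qed
  have conv: "convergent (\<lambda>n. w n t)" if t: "0 \<le> t" for t
  proof -
    obtain C where "\<forall>m n. \<forall>s\<in>{0..t}. m \<le> n \<longrightarrow> norm (w n s - w m s) \<le> C / 2 ^ m"
      using geo[of t] by blast
    then have C: "norm (w n t - w m t) \<le> C / 2 ^ m" if "m \<le> n" for m n using t that by simp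
    have "Cauchy (\<lambda>n. w n t)"
    proof (rule CauchyI')
      fix e :: real assume "0 < e"
      then have "\<forall>\<^sub>F n in sequentially. C / 2 ^ n < e" using pow0[of C] by (intro order_tendstoD(2))
      then obtain N where N: "\<And>n. n \<ge> N \<Longrightarrow> C / 2 ^ n < e" by (auto simp: eventually_sequentially)
      show "\<exists>M. \<forall>m\<ge>M. \<forall>n>m. dist (w m t) (w n t) < e"
      proof (intro exI[of _ N] allI impI)
        fix m n :: nat assume "N \<le> m" "m < n"
        then have "norm (w n t - w m t) \<le> C / 2 ^ m" using C by simp
        also have "\<dots> < e" using N \<open>N \<le> m\<close> .
        finally show "dist (w m t) (w n t) < e" by (simp add: dist_norm norm_minus_commute)
      qed
    qed
    then show ?thesis by (simp add: Cauchy_convergent_iff)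
  qed
  define W where "W t = lim (\<lambda>n. w n t)" for t
  have W: "(\<lambda>n. w n t) \<longlonglongrightarrow> W t" if "0 \<le> t" for t
    using conv[OF that] unfolding W_def convergent_LIMSEQ_iff .
  have "(W has_vector_derivative f t (W t)) (at t within {0..})" if "0 \<le> t" for t
  proof (rule has_vector_derivative_limit[where w = "\<lambda>n. w (Suc n)" and g = "\<lambda>n t. f t (w n t)"])
    show "(\<lambda>n. w (Suc n) t) \<longlonglongrightarrow> W t" if "0 \<le> t" for t using W[OF that] by (rule LIMSEQ_Suc)
    fix T e :: real assume "0 < e"
    obtain C where C: "C \<ge> 0" "\<And>m n t. t \<in> {0..T} \<Longrightarrow> m \<le> n \<Longrightarrow> norm (w n t - w m t) \<le> C / 2 ^ m"
      using geo by blast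
    have lim: "norm (W t - w m t) \<le> C / 2 ^ m" if t: "t \<in> {0..T}" for t m
    proof (rule LIMSEQ_le_const2)
      show "(\<lambda>n. norm (w n t - w m t)) \<longlonglongrightarrow> norm (W t - w m t)"
        using t by (intro tendsto_norm tendsto_diff W tendsto_const) auto
    qed (intro exI[of _ m] allI impI C(2)[OF t])
    have "\<forall>\<^sub>F n in sequentially. K * C / 2 ^ n < e" using pow0[of "K * C"] \<open>0 < e\<close> by (intro order_tendstoD(2))
    then obtain N where N: "\<And>n. n \<ge> N \<Longrightarrow> K * C / 2 ^ n < e" by (auto simp: eventually_sequentially)
    have "norm (f t (w n t) - f t (W t)) \<le> e" if "n \<ge> N" "t \<in> {0..T}" for n t
    proof -
      have "norm (f t (w n t) - f t (W t)) \<le> K * norm (w n t - W t)" using that by (intro lip) auto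
      also have "\<dots> \<le> K * (C / 2 ^ n)" using lim[OF that(2), of n] K
        by (intro mult_left_mono) (auto simp: norm_minus_commute)
      also have "\<dots> \<le> e" using N[OF that(1)] by simp
      finally show ?thesis .
    qed
    then show "\<exists>N. \<forall>n\<ge>N. \<forall>t\<in>{0..T}. norm (f t (w n t) - f t (W t)) \<le> e" by blast
  qed (rule wd, assumption, rule that)
  moreover have "W 0 = x0" using W[of 0] by (simp add: w_init LIMSEQ_const_iff)
  ultimately show ?thesis by (intro exI[of _ W]) simp
qed

lemma half_line_nonincreasing:
  fixes g :: "real \<Rightarrow> real"
  assumes g: "\<And>t. a \<le> t \<Longrightarrow> (g has_real_derivative g' t) (at t within {0..})"
    and le: "\<And>t. a \<le> t \<Longrightarrow> g' t \<le> 0" and "0 \<le> a" "a \<le> t"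
  shows "g t \<le> g a"
proof (cases "a = t")
  case False
  then have "a < t" using assms by simp
  moreover have "(g has_derivative (*) (g' x)) (at x within {a..t})" if "a \<le> x" "x \<le> t" for x
    using g[OF that(1), unfolded has_field_derivative_def]
    by (rule has_derivative_subset) (use \<open>0 \<le> a\<close> in auto)
  ultimately obtain x where "x \<in> {a<..<t}" "g t - g a = g' x * (t - a)"
    using mvt_simple[of a t g "\<lambda>x. (*) (g' x)"] by blast
  moreover have "g' x * (t - a) \<le> 0" using le[of x] \<open>x \<in> _\<close> by (intro mult_nonpos_nonneg) auto
  ultimately show ?thesis by simp
qed simp

section \<open>Energy estimates\<close>

text \<open>The letters are the energies at one time, and the left side is
  \<open>Z' + g * b * Z\<close>. Dissipation comes from \<open>- 2 * b * P / c\<close> and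
  \<open>- 2 * k * b * c * Q\<close>; all other terms are dropped by sign or bounded by multiples of
  \<open>b * P / c\<close> and \<open>b * Q\<close>, and \<open>hp\<close> and \<open>hq\<close>
  make the two total coefficients nonpositive.\<close>

lemma energy_derivative_bound:
  fixes \<epsilon> b b' c c' k g \<mu> M3 M4 \<nu> P Q W X Y :: real
  assumes pos: "0 < \<epsilon>" "0 < b" "b \<le> 1" "0 < \<mu>" "0 < \<nu>" "0 \<le> k" "0 \<le> g"
    and c: "\<mu> \<le> c" "c \<le> M3" "\<bar>c'\<bar> \<le> M4 * b" and b': "- b\<^sup>2 \<le> b'" "b' \<le> 0"
    and nn: "0 \<le> P" "0 \<le> Q" "0 \<le> W" "0 \<le> Y"
    and coer: "\<nu> * W \<le> P" "\<nu> * Y \<le> Q" and X: "2 * \<bar>X\<bar> \<le> W + Q"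
    and hp: "\<epsilon> * (M4 / \<mu> + k * M3 / \<nu> + 2 * k * M3 + g + g * k * M3 / \<nu>) \<le> 2"
    and hq: "- 2 * k * \<mu> + k * \<epsilon> + g + g * k * \<epsilon> + g * k * b\<^sup>2 / \<nu> \<le> 0"
  shows "- 2 * b * P / c - \<epsilon> * P * c' / c\<^sup>2 + k * b' * (2 * \<epsilon> * X + b * Y)
      + k * b * (2 * \<epsilon> * P - 2 * c * Q + b' * Y)
      + g * b * (\<epsilon> * P / c + Q + k * b * (2 * \<epsilon> * X + b * Y)) \<le> 0"
proof -
  define p where "p = P / c"
  have c0: "0 < c" "0 < M3" using c pos by linarith+
  have p0: "0 \<le> p" using nn c0 by (simp add: p_def)
  have P: "P = c * p" using c0 by (simp add: p_def)
  have PM: "P \<le> M3 * p" unfolding P using c p0 by (intro mult_right_mono) auto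
  have WM: "W \<le> M3 / \<nu> * p" using coer(1) PM pos by (simp add: field_simps)
  have YQ: "Y \<le> Q / \<nu>" using coer(2) pos by (simp add: field_simps)
  have b2: "b\<^sup>2 \<le> b" using pos by (simp add: power2_eq_square mult_left_le)
  have X2: "2 * X \<le> W + Q" "- (2 * X) \<le> W + Q" using X by linarith+
  have WQ: "0 \<le> W + Q" using nn by simp
  have t1: "- 2 * b * P / c = - 2 * b * p" by (simp add: p_def)
  have t2: "- (\<epsilon> * P * c' / c\<^sup>2) \<le> \<epsilon> * p * b * (M4 / \<mu>)"
  proof -
    have "- c' / c \<le> M4 * b / c" using c c0 by (intro divide_right_mono) auto
    also have "\<dots> \<le> M4 * b / \<mu>" using c pos by (intro divide_left_mono) (auto intro: order_trans[OF abs_ge_zero])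
    finally have "\<epsilon> * p * (- c' / c) \<le> \<epsilon> * p * (M4 * b / \<mu>)" using pos p0 by (intro mult_left_mono) auto
    then show ?thesis using c0 by (simp add: p_def power2_eq_square mult_ac)
  qed
  \<comment> \<open>From \<open>- b' \<le> b\<^sup>2 \<le> b\<close> this term obtains the factor
    \<open>b\<close> that the dissipation has.\<close>
  have t3: "k * b' * (2 * \<epsilon> * X) \<le> k * \<epsilon> * b * (W + Q)"
  proof -
    have "b' * (2 * X) = (- b') * (- (2 * X))" by simp
    also have "\<dots> \<le> (- b') * (W + Q)" using X2 b' by (intro mult_left_mono) auto
    also have "\<dots> \<le> b * (W + Q)" using b' b2 WQ by (intro mult_right_mono) auto
    finally have "(k * \<epsilon>) * (b' * (2 * X)) \<le> (k * \<epsilon>) * (b * (W + Q))" using pos by (intro mult_left_mono) auto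
    then show ?thesis by (simp add: mult_ac)
  qed
  have t4: "k * b' * (b * Y) \<le> 0" "k * b * (b' * Y) \<le> 0"
    using pos b' nn by (simp_all add: mult_nonneg_nonpos mult_nonpos_nonneg mult_le_0_iff zero_le_mult_iff)
  have t5: "k * b * (2 * \<epsilon> * P) \<le> k * b * (2 * \<epsilon> * (M3 * p))"
    using PM pos by (intro mult_left_mono) auto
  have t6: "k * b * (2 * \<mu> * Q) \<le> k * b * (2 * c * Q)"
    using c pos nn by (intro mult_left_mono mult_right_mono) auto
  have t7: "k * b * (2 * \<epsilon> * X) \<le> k * \<epsilon> * (W + Q)"
  proof -
    have "b * (2 * X) \<le> b * (W + Q)" using X2 pos by (intro mult_left_mono) auto
    also have "\<dots> \<le> 1 * (W + Q)" using WQ pos by (intro mult_right_mono) auto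
    finally have "(k * \<epsilon>) * (b * (2 * X)) \<le> (k * \<epsilon>) * (1 * (W + Q))" using pos by (intro mult_left_mono) auto
    then show ?thesis by (simp add: mult_ac)
  qed
  have t8: "k * b * (b * Y) \<le> k * b\<^sup>2 / \<nu> * Q"
  proof -
    have "(k * b\<^sup>2) * Y \<le> (k * b\<^sup>2) * (Q / \<nu>)" using YQ pos by (intro mult_left_mono) auto
    then show ?thesis by (simp add: power2_eq_square mult_ac)
  qed
  have Z: "\<epsilon> * P / c + Q + k * b * (2 * \<epsilon> * X + b * Y)
      \<le> \<epsilon> * p + Q + k * \<epsilon> * (M3 / \<nu> * p + Q) + k * b\<^sup>2 / \<nu> * Q"
  proof -
    have "k * \<epsilon> * (W + Q) \<le> k * \<epsilon> * (M3 / \<nu> * p + Q)" using WM pos by (intro mult_left_mono) auto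
    then show ?thesis using t7 t8 by (simp add: p_def distrib_left)
  qed
  have gZ: "g * b * (\<epsilon> * P / c + Q + k * b * (2 * \<epsilon> * X + b * Y))
      \<le> g * b * (\<epsilon> * p + Q + k * \<epsilon> * (M3 / \<nu> * p + Q) + k * b\<^sup>2 / \<nu> * Q)"
    using Z pos by (intro mult_left_mono) auto
  have t3': "k * \<epsilon> * b * (W + Q) \<le> k * \<epsilon> * b * (M3 / \<nu> * p + Q)" using WM pos by (intro mult_left_mono) auto
  have fp: "(b * p) * (\<epsilon> * (M4 / \<mu> + k * M3 / \<nu> + 2 * k * M3 + g + g * k * M3 / \<nu>) - 2) \<le> 0"
    using hp pos p0 by (intro mult_nonneg_nonpos) auto
  have fq: "(b * Q) * (- 2 * k * \<mu> + k * \<epsilon> + g + g * k * \<epsilon> + g * k * b\<^sup>2 / \<nu>) \<le> 0"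
    using hq pos nn by (intro mult_nonneg_nonpos) auto
  have "- 2 * b * P / c - \<epsilon> * P * c' / c\<^sup>2 + k * b' * (2 * \<epsilon> * X + b * Y)
      + k * b * (2 * \<epsilon> * P - 2 * c * Q + b' * Y)
      + g * b * (\<epsilon> * P / c + Q + k * b * (2 * \<epsilon> * X + b * Y))
    \<le> - 2 * b * p + \<epsilon> * p * b * (M4 / \<mu>) + k * \<epsilon> * b * (M3 / \<nu> * p + Q)
      + (k * b * (2 * \<epsilon> * (M3 * p)) - k * b * (2 * \<mu> * Q))
      + g * b * (\<epsilon> * p + Q + k * \<epsilon> * (M3 / \<nu> * p + Q) + k * b\<^sup>2 / \<nu> * Q)"
  proof -
    have "k * b' * (2 * \<epsilon> * X + b * Y) = k * b' * (2 * \<epsilon> * X) + k * b' * (b * Y)" by (rule distrib_left)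
    moreover have "k * b * (2 * \<epsilon> * P - 2 * c * Q + b' * Y)
        = k * b * (2 * \<epsilon> * P) - k * b * (2 * c * Q) + k * b * (b' * Y)"
      by (simp only: distrib_left right_diff_distrib)
    ultimately show ?thesis using t1 t2 t3 t3' t4 t5 t6 gZ by linarith
  qed
  also have "\<dots> = (b * p) * (\<epsilon> * (M4 / \<mu> + k * M3 / \<nu> + 2 * k * M3 + g + g * k * M3 / \<nu>) - 2)
      + (b * Q) * (- 2 * k * \<mu> + k * \<epsilon> + g + g * k * \<epsilon> + g * k * b\<^sup>2 / \<nu>)"
    by (simp add: algebra_simps)
  finally show ?thesis using fp fq by linarith
qed

text \<open>\<open>B\<close> is the clock in which decay is measured. The bound
  \<open>- b\<^sup>2 \<le> b'\<close> is where \<open>p \<le> 1\<close> enters: for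
  \<open>b = (1 + t) powr (- p)\<close> it says
  \<open>p * (1 + t) powr (- p - 1) \<le> (1 + t) powr (- 2 * p)\<close>.\<close>

locale damping =
  fixes \<epsilon> \<mu> M3 M4 :: real and b b' B c c' :: "real \<Rightarrow> real"
  assumes \<epsilon>: "0 < \<epsilon>" and \<mu>: "0 < \<mu>"
    and b: "\<And>t. 0 \<le> t \<Longrightarrow> 0 < b t" "\<And>t. 0 \<le> t \<Longrightarrow> b t \<le> 1" "b 0 = 1"
    and b': "\<And>t. 0 \<le> t \<Longrightarrow> (b has_real_derivative b' t) (at t within {0..})"
      "\<And>t. 0 \<le> t \<Longrightarrow> - (b t)\<^sup>2 \<le> b' t" "\<And>t. 0 \<le> t \<Longrightarrow> b' t \<le> 0"
    and B: "B 0 = 0" "\<And>t. 0 \<le> t \<Longrightarrow> (B has_real_derivative b t) (at t within {0..})"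
    and c: "\<And>t. 0 \<le> t \<Longrightarrow> \<mu> \<le> c t" "\<And>t. 0 \<le> t \<Longrightarrow> c t \<le> M3"
    and c': "\<And>t. 0 \<le> t \<Longrightarrow> (c has_real_derivative c' t) (at t within {0..})"
      "\<And>t. 0 \<le> t \<Longrightarrow> \<bar>c' t\<bar> \<le> M4 * b t"

text \<open>For a solution \<open>u\<close>, writing \<open>S\<close> for the square root of \<open>A\<close>:
  \<open>P = |S u'|\<^sup>2\<close>, \<open>Q = |A u|\<^sup>2\<close>, \<open>X = \<langle>u', A u\<rangle>\<close>, \<open>Y = |S u|\<^sup>2\<close>, \<open>W = |u'|\<^sup>2\<close> and \<open>R = \<langle>A u, A u'\<rangle>\<close>.
  The derivatives of \<open>\<epsilon> P / c\<close> and \<open>Q\<close> add up to a quantity free of \<open>R\<close>.\<close>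

locale damped_energy = damping +
  fixes \<nu> :: real and P Q X Y W R :: "real \<Rightarrow> real"
  assumes \<nu>: "0 < \<nu>"
    and P': "\<And>t. 0 \<le> t \<Longrightarrow> (P has_real_derivative - (2 / \<epsilon>) * (b t * P t + c t * R t)) (at t within {0..})"
    and Q': "\<And>t. 0 \<le> t \<Longrightarrow> (Q has_real_derivative 2 * R t) (at t within {0..})"
    and X': "\<And>t. 0 \<le> t \<Longrightarrow> (X has_real_derivative P t - (1 / \<epsilon>) * (b t * X t + c t * Q t)) (at t within {0..})"
    and Y': "\<And>t. 0 \<le> t \<Longrightarrow> (Y has_real_derivative 2 * X t) (at t within {0..})"
    and W': "\<And>t. 0 \<le> t \<Longrightarrow> (W has_real_derivative - (2 / \<epsilon>) * (b t * W t + c t * X t)) (at t within {0..})"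
    and Q: "\<And>t. 0 \<le> t \<Longrightarrow> 0 \<le> Q t" and Y: "\<And>t. 0 \<le> t \<Longrightarrow> 0 \<le> Y t" and W: "\<And>t. 0 \<le> t \<Longrightarrow> 0 \<le> W t"
    and WP: "\<And>t. 0 \<le> t \<Longrightarrow> \<nu> * W t \<le> P t" and YQ: "\<And>t. 0 \<le> t \<Longrightarrow> \<nu> * Y t \<le> Q t"
    and XWQ: "\<And>t. 0 \<le> t \<Longrightarrow> (X t)\<^sup>2 \<le> W t * Q t"
begin

lemma P: "0 \<le> t \<Longrightarrow> 0 \<le> P t"
  using WP[of t] W[of t] \<nu> by (meson mult_nonneg_nonneg less_imp_le order_trans)

lemma X_le: assumes "0 \<le> t" "0 \<le> s" "0 \<le> r" "s * r = 1" shows "2 * \<bar>X t\<bar> \<le> s * W t + r * Q t"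
proof -
  have "(2 * \<bar>X t\<bar>)\<^sup>2 \<le> 4 * (s * W t) * (r * Q t)"
    using XWQ[OF assms(1)] assms(4) by (simp add: power_mult_distrib mult_ac) (metis mult.assoc mult.commute mult.right_neutral)
  also have "\<dots> \<le> (s * W t + r * Q t)\<^sup>2"
    using zero_le_power2[of "s * W t - r * Q t"] by (simp add: power2_eq_square algebra_simps)
  finally show ?thesis using W[OF assms(1)] Q[OF assms(1)] assms
    by (intro power2_le_imp_le[of "2 * \<bar>X t\<bar>"]) auto
qed

text \<open>In the derivative of \<open>\<epsilon> * P + c * Q\<close> the terms with
  \<open>R\<close> cancel and leave \<open>- 2 * b * P + c' * Q\<close>, where
  \<open>c' * Q \<le> M4 / \<mu> * (c * Q)\<close>. This crude bound serves existence and
  uniqueness.\<close>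

lemma growth:
  assumes t: "0 \<le> t"
  shows "\<epsilon> * P t + c t * Q t \<le> exp (M4 / \<mu> * t) * (\<epsilon> * P 0 + c 0 * Q 0)"
proof -
  define G where "G t = (\<epsilon> * P t + c t * Q t) * exp (- (M4 / \<mu>) * t)" for t
  define G' where "G' t = (- 2 * b t * P t + c' t * Q t - M4 / \<mu> * (\<epsilon> * P t + c t * Q t)) * exp (- (M4 / \<mu>) * t)" for t
  have "G t \<le> G 0"
  proof (rule half_line_nonincreasing[where g = G and g' = G'])
    fix s :: real assume s: "0 \<le> s"
    show "(G has_real_derivative G' s) (at s within {0..})" unfolding G_def G'_def
      using \<epsilon> \<mu> by (auto intro!: derivative_eq_intros P'[OF s] Q'[OF s] c'(1)[OF s] simp: field_simps)
    have M4: "0 \<le> M4" using c'(2)[of 0] b(3) by simp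
    have "c' s * Q s \<le> M4 * Q s"
    proof (rule mult_right_mono[OF _ Q[OF s]])
      have "M4 * b s \<le> M4 * 1" using b(2)[OF s] M4 by (intro mult_left_mono) auto
      then show "c' s \<le> M4" using c'(2)[OF s] by linarith
    qed
    also have "M4 * Q s = M4 / \<mu> * (\<mu> * Q s)" using \<mu> by simp
    also have "\<dots> \<le> M4 / \<mu> * (c s * Q s)" using c(1)[OF s] Q[OF s] M4 \<mu> by (intro mult_left_mono mult_right_mono) auto
    finally have "c' s * Q s \<le> M4 / \<mu> * (c s * Q s)" .
    moreover have "0 \<le> b s * P s" "0 \<le> M4 / \<mu> * (\<epsilon> * P s)" using b(1)[OF s] P[OF s] M4 \<mu> \<epsilon> by auto
    ultimately have "- 2 * b s * P s + c' s * Q s - M4 / \<mu> * (\<epsilon> * P s + c s * Q s) \<le> 0"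
      by (simp add: distrib_left)
    then show "G' s \<le> 0" unfolding G'_def by (simp add: mult_le_0_iff)
  qed (use t in auto)
  then show ?thesis by (simp add: G_def exp_minus field_simps)
qed

text \<open>The bracket has derivative \<open>2 * \<epsilon> * P - 2 * c * Q + b' * Y\<close>: the
  friction part \<open>- 2 * b * X\<close> of \<open>2 * \<epsilon> * X'\<close> cancels against
  \<open>b * Y'\<close>. It supplies the dissipation of \<open>Q\<close> that the first two terms
  lack.\<close>

definition Z :: "real \<Rightarrow> real \<Rightarrow> real" where
  "Z k t = \<epsilon> * P t / c t + Q t + k * b t * (2 * \<epsilon> * X t + b t * Y t)"

definition Z' :: "real \<Rightarrow> real \<Rightarrow> real" where
  "Z' k t = - 2 * b t * P t / c t - \<epsilon> * P t * c' t / (c t)\<^sup>2 + k * b' t * (2 * \<epsilon> * X t + b t * Y t)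
      + k * b t * (2 * \<epsilon> * P t - 2 * c t * Q t + b' t * Y t)"

lemma Z_derivative: assumes t: "0 \<le> t" shows "(Z k has_real_derivative Z' k t) (at t within {0..})"
proof -
  have c0: "c t \<noteq> 0" using c(1)[OF t] \<mu> by simp
  have "((\<lambda>t. \<epsilon> * P t / c t + Q t + k * b t * (2 * \<epsilon> * X t + b t * Y t)) has_real_derivative
     ((\<epsilon> * (- (2 / \<epsilon>) * (b t * P t + c t * R t)) * c t - \<epsilon> * P t * c' t) / (c t * c t) + 2 * R t
      + (k * b' t * (2 * \<epsilon> * X t + b t * Y t) + k * b t * (2 * \<epsilon> * (P t - (1 / \<epsilon>) * (b t * X t + c t * Q t))
        + (b' t * Y t + b t * (2 * X t)))))) (at t within {0..})"
    by (rule derivative_eq_intros P'[OF t] Q'[OF t] X'[OF t] Y'[OF t] b'(1)[OF t] c'(1)[OF t] refl c0)+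
      (simp add: algebra_simps)
  moreover have "(\<epsilon> * (- (2 / \<epsilon>) * (b t * P t + c t * R t)) * c t - \<epsilon> * P t * c' t) / (c t * c t) + 2 * R t
      + (k * b' t * (2 * \<epsilon> * X t + b t * Y t) + k * b t * (2 * \<epsilon> * (P t - (1 / \<epsilon>) * (b t * X t + c t * Q t))
        + (b' t * Y t + b t * (2 * X t)))) = Z' k t"
  proof -
    have "(\<epsilon> * (- (2 / \<epsilon>) * (b t * P t + c t * R t)) * c t - \<epsilon> * P t * c' t) / (c t * c t) + 2 * R t
        = - 2 * b t * P t / c t - \<epsilon> * P t * c' t / (c t)\<^sup>2"
      using c0 \<epsilon> by (simp add: field_simps power2_eq_square)
    moreover have "2 * \<epsilon> * (P t - (1 / \<epsilon>) * (b t * X t + c t * Q t)) + (b' t * Y t + b t * (2 * X t))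
        = 2 * \<epsilon> * P t - 2 * c t * Q t + b' t * Y t"
      using \<epsilon> by (simp add: field_simps)
    ultimately show ?thesis unfolding Z'_def by simp
  qed
  ultimately show ?thesis unfolding Z_def[abs_def] by simp
qed

lemma Z_bound:
  assumes t: "0 \<le> t" and kg: "0 \<le> k" "0 \<le> g"
    and hp: "\<epsilon> * (M4 / \<mu> + k * M3 / \<nu> + 2 * k * M3 + g + g * k * M3 / \<nu>) \<le> 2"
    and hq: "- 2 * k * \<mu> + k * \<epsilon> + g + g * k * \<epsilon> + g * k * (b t)\<^sup>2 / \<nu> \<le> 0"
  shows "Z' k t + g * b t * Z k t \<le> 0"
  unfolding Z_def Z'_def
proof (rule energy_derivative_bound[OF \<epsilon> b(1,2)[OF t] \<mu> \<nu> kg c[OF t] c'(2)[OF t] b'(2,3)[OF t]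
      P[OF t] Q[OF t] W[OF t] Y[OF t] WP[OF t] YQ[OF t] _ hp hq])
  show "2 * \<bar>X t\<bar> \<le> W t + Q t" using X_le[OF t, of 1 1] by simp
qed

lemma Z_decay:
  assumes kg: "0 \<le> k" "0 \<le> g" and s: "0 \<le> s" "s \<le> t"
    and hp: "\<epsilon> * (M4 / \<mu> + k * M3 / \<nu> + 2 * k * M3 + g + g * k * M3 / \<nu>) \<le> 2"
    and hq: "\<And>t. s \<le> t \<Longrightarrow> - 2 * k * \<mu> + k * \<epsilon> + g + g * k * \<epsilon> + g * k * (b t)\<^sup>2 / \<nu> \<le> 0"
  shows "Z k t * exp (g * B t) \<le> Z k s * exp (g * B s)"
proof (rule half_line_nonincreasing[where g = "\<lambda>t. Z k t * exp (g * B t)" and g' = "\<lambda>t. (Z' k t + g * b t * Z k t) * exp (g * B t)"])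
  fix r assume r: "s \<le> r"
  then have r0: "0 \<le> r" using s by simp
  show "((\<lambda>t. Z k t * exp (g * B t)) has_real_derivative (Z' k r + g * b r * Z k r) * exp (g * B r)) (at r within {0..})"
    by (rule derivative_eq_intros Z_derivative[OF r0] B(2)[OF r0] refl)+ (simp add: algebra_simps)
  show "(Z' k r + g * b r * Z k r) * exp (g * B r) \<le> 0"
    using Z_bound[OF r0 kg hp hq[OF r]] by (simp add: mult_le_0_iff)
qed (use s in auto)

lemma Z_lower:
  assumes t: "0 \<le> t" and k: "0 < k" and h: "4 * k\<^sup>2 * M3 * \<epsilon> \<le> \<nu>"
  shows "\<epsilon> * P t / M3 + Q t \<le> 2 * Z k t"
proof -
  have M3: "0 < M3" using c[OF t] \<mu> by simp
  \<comment> \<open>With these weights the \<open>W\<close> part of the cross term is at most half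
    of \<open>\<epsilon> * P t / M3\<close> by \<open>WP\<close>, and the \<open>Q\<close> part at
    most \<open>Q t / 2\<close> by \<open>h\<close>.\<close>
  define s where "s = \<nu> / (2 * k * M3)"
  define r where "r = 2 * k * M3 / \<nu>"
  have sr: "0 < s" "0 < r" "s * r = 1" using k M3 \<nu> by (auto simp: s_def r_def)
  have PM: "P t / M3 \<le> P t / c t"
    using c[OF t] P[OF t] \<mu> by (intro divide_left_mono) auto
  have "2 * \<bar>X t\<bar> \<le> s * W t + r * Q t" using X_le[OF t, of s r] sr by simp
  then have "(k * \<epsilon>) * (2 * \<bar>X t\<bar>) \<le> (k * \<epsilon>) * (s * W t + r * Q t)" using k \<epsilon> by (intro mult_left_mono) auto
  moreover have "(k * \<epsilon>) * (s * W t) \<le> \<epsilon> * (P t / M3) / 2"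
  proof -
    have "(k * \<epsilon>) * (s * W t) = \<epsilon> / (2 * M3) * (\<nu> * W t)" using k M3 by (simp add: s_def)
    also have "\<dots> \<le> \<epsilon> / (2 * M3) * P t" using WP[OF t] \<epsilon> M3 by (intro mult_left_mono) auto
    finally show ?thesis by simp
  qed
  moreover have "(k * \<epsilon>) * (r * Q t) \<le> Q t / 2"
  proof -
    have "(k * \<epsilon>) * (r * Q t) = (4 * k\<^sup>2 * M3 * \<epsilon>) * (Q t / (2 * \<nu>))" by (simp add: r_def power2_eq_square)
    also have "\<dots> \<le> \<nu> * (Q t / (2 * \<nu>))" using h Q[OF t] \<nu> by (intro mult_right_mono) auto
    finally show ?thesis using \<nu> by simp
  qed
  ultimately have 1: "(k * \<epsilon>) * (2 * \<bar>X t\<bar>) \<le> \<epsilon> * (P t / M3) / 2 + Q t / 2" by (simp add: distrib_left)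
  have "b t * \<bar>X t\<bar> \<le> 1 * \<bar>X t\<bar>" using b(2)[OF t] by (intro mult_right_mono) auto
  then have "(2 * k * \<epsilon>) * (b t * \<bar>X t\<bar>) \<le> (2 * k * \<epsilon>) * \<bar>X t\<bar>" using k \<epsilon> by (intro mult_left_mono) auto
  moreover have "\<bar>k * b t * (2 * \<epsilon> * X t)\<bar> = (2 * k * \<epsilon>) * (b t * \<bar>X t\<bar>)"
    using k \<epsilon> b(1)[OF t] by (simp add: abs_mult)
  ultimately have "- (k * b t * (2 * \<epsilon> * X t)) \<le> (k * \<epsilon>) * (2 * \<bar>X t\<bar>)" by linarith
  from order_trans[OF this 1]
  have "- (k * b t * (2 * \<epsilon> * X t)) \<le> \<epsilon> * (P t / M3) / 2 + Q t / 2" .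
  moreover have "0 \<le> k * b t * (b t * Y t)" using k b(1)[OF t] Y[OF t] by simp
  moreover have "\<epsilon> * (P t / M3) \<le> \<epsilon> * (P t / c t)" using PM \<epsilon> by (intro mult_left_mono) auto
  moreover have "Z k t = \<epsilon> * (P t / c t) + Q t + k * b t * (2 * \<epsilon> * X t) + k * b t * (b t * Y t)"
    by (simp add: Z_def distrib_left)
  moreover have "x3 + Q t \<le> 2 * z"
    if "- x1 \<le> x3 / 2 + Q t / 2" "0 \<le> x2" "x3 \<le> x4" "z = x4 + Q t + x1 + x2" for x1 x2 x3 x4 z :: real
    using that by linarith
  ultimately have "\<epsilon> * (P t / M3) + Q t \<le> 2 * Z k t" by blast
  then show ?thesis by simp
qed

lemma Z_0_upper:
  assumes k: "0 \<le> k" and "\<epsilon> \<le> 1"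
  shows "Z k 0 \<le> (1 / \<mu> + 1 + k / \<nu> + k + k / \<nu>) * (P 0 + Q 0)"
proof -
  have P0: "0 \<le> P 0" and Q0: "0 \<le> Q 0" using P Q by auto
  have "\<epsilon> * P 0 / c 0 \<le> 1 * P 0 / \<mu>" using assms P0 c(1)[of 0] \<mu> \<epsilon> by (intro frac_le mult_right_mono) auto
  moreover have "k * (2 * \<epsilon> * X 0) \<le> k * (P 0 / \<nu> + Q 0)"
  proof (rule mult_left_mono[OF _ k])
    have "2 * \<epsilon> * X 0 \<le> 2 * \<epsilon> * \<bar>X 0\<bar>" using \<epsilon> by simp
    also have "\<dots> \<le> 2 * 1 * \<bar>X 0\<bar>" using assms by (intro mult_right_mono mult_left_mono) auto
    also have "\<dots> \<le> W 0 + Q 0" using X_le[of 0 1 1] by simp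
    also have "W 0 \<le> P 0 / \<nu>" using WP[of 0] \<nu> by (simp add: field_simps)
    finally show "2 * \<epsilon> * X 0 \<le> P 0 / \<nu> + Q 0" by simp
  qed
  moreover have "k * Y 0 \<le> k * (Q 0 / \<nu>)" using YQ[of 0] \<nu> k by (intro mult_left_mono) (auto simp: field_simps)
  ultimately have "Z k 0 \<le> P 0 / \<mu> + Q 0 + k * (P 0 / \<nu> + Q 0) + k * (Q 0 / \<nu>)"
    unfolding Z_def b(3) by (simp add: distrib_left)
  then have "Z k 0 \<le> P 0 / \<mu> + Q 0 + (k * (P 0 / \<nu>) + k * Q 0) + k * (Q 0 / \<nu>)" by (simp only: distrib_left)
  moreover have "0 \<le> Q 0 / \<mu>" "0 \<le> k * (P 0 / \<nu>)" "0 \<le> k * P 0" "0 \<le> k * (Q 0 / \<nu>)" using P0 Q0 k \<mu> \<nu> by auto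
  moreover have "(1 / \<mu> + 1 + k / \<nu> + k + k / \<nu>) * (P 0 + Q 0) = P 0 / \<mu> + Q 0 / \<mu> + P 0 + Q 0
      + 2 * (k * (P 0 / \<nu>)) + 2 * (k * (Q 0 / \<nu>)) + k * P 0 + k * Q 0"
    by (simp add: distrib_left distrib_right)
  ultimately show ?thesis using P0 by linarith
qed

lemma B_mono: assumes "0 \<le> s" "s \<le> t" shows "B s \<le> B t"
proof -
  have "- B t \<le> - B s"
  proof (rule half_line_nonincreasing[where g = "\<lambda>t. - B t" and g' = "\<lambda>t. - b t"])
    fix r assume "s \<le> r"
    then have r: "0 \<le> r" using assms by simp
    show "((\<lambda>t. - B t) has_real_derivative - b r) (at r within {0..})" by (intro DERIV_minus B(2) r)
    show "- b r \<le> 0" using b(1)[OF r] by simp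
  qed (use assms in auto)
  then show ?thesis by simp
qed

text \<open>The relation \<open>\<nu> * W \<le> P\<close> bounds only \<open>\<epsilon> * W\<close>
  uniformly, so \<open>W\<close> is treated by its own equation. It is damped at a rate of order
  \<open>b / \<epsilon>\<close> and driven by \<open>c * X\<close>; Young's inequality with weights
  \<open>b / c\<close> and \<open>c / b\<close> balances the two.\<close>

lemma W_decay:
  assumes t: "0 \<le> t" and g: "0 \<le> g" "2 * \<epsilon> * g \<le> 1"
    and Qd: "\<And>t. 0 \<le> t \<Longrightarrow> Q t * exp (g * B t) \<le> C"
  shows "(b t)\<^sup>2 * W t * exp (g * B t) \<le> 2 * M3\<^sup>2 * C + W 0"
proof -
  define K where "K = 2 * M3\<^sup>2 * C"
  define w where "w t = (b t)\<^sup>2 * W t * exp (g * B t)" for t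
  define w' where "w' t = (2 * b t * b' t * W t + (b t)\<^sup>2 * (- (2 / \<epsilon>) * (b t * W t + c t * X t))
      + g * b t * ((b t)\<^sup>2 * W t)) * exp (g * B t)" for t
  have wd: "(w has_real_derivative w' s) (at s within {0..})" if s: "0 \<le> s" for s
    unfolding w_def w'_def
    by (rule derivative_eq_intros W'[OF s] B(2)[OF s] b'(1)[OF s] refl)+ (simp add: algebra_simps power2_eq_square)
  \<comment> \<open>Of the damping \<open>2 / \<epsilon>\<close> one half pays for the cross term
    and a quarter for the rate \<open>g\<close>, by \<open>2 * \<epsilon> * g \<le> 1\<close>; the
    rest is \<open>1 / (2 * \<epsilon>)\<close>.\<close>
  have wle: "w' s \<le> - (b s / (2 * \<epsilon>)) * (w s - K)" if s: "0 \<le> s" for s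
  proof -
    have bs: "0 < b s" using b(1)[OF s] .
    have cs: "0 < c s" using c(1)[OF s] \<mu> by simp
    have "2 * b s * b' s * W s \<le> 0" using bs b'(3)[OF s] W[OF s] by (simp add: mult_le_0_iff)
    moreover have "(b s)\<^sup>2 * (- (2 / \<epsilon>) * (c s * X s)) \<le> (1 / \<epsilon>) * (b s * ((b s)\<^sup>2 * W s) + b s * ((c s)\<^sup>2 * Q s))"
    proof -
      have "2 * \<bar>X s\<bar> \<le> (b s / c s) * W s + (c s / b s) * Q s" using X_le[OF s, of "b s / c s" "c s / b s"] bs cs by simp
      then have "((b s)\<^sup>2 * c s) * (- (2 * X s)) \<le> ((b s)\<^sup>2 * c s) * ((b s / c s) * W s + (c s / b s) * Q s)"
        using cs by (intro mult_left_mono) auto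
      also have "\<dots> = b s * ((b s)\<^sup>2 * W s) + b s * ((c s)\<^sup>2 * Q s)"
        using bs cs by (simp add: field_simps power2_eq_square)
      finally have "(1 / \<epsilon>) * (((b s)\<^sup>2 * c s) * (- (2 * X s))) \<le> (1 / \<epsilon>) * (b s * ((b s)\<^sup>2 * W s) + b s * ((c s)\<^sup>2 * Q s))"
        using \<epsilon> by (intro mult_left_mono) auto
      then show ?thesis by (simp add: mult_ac)
    qed
    moreover have "g * b s * ((b s)\<^sup>2 * W s) \<le> (1 / (2 * \<epsilon>)) * (b s * ((b s)\<^sup>2 * W s))"
    proof -
      have "g \<le> 1 / (2 * \<epsilon>)" using g \<epsilon> by (simp add: field_simps)
      then have "g * (b s * ((b s)\<^sup>2 * W s)) \<le> (1 / (2 * \<epsilon>)) * (b s * ((b s)\<^sup>2 * W s))"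
        using bs W[OF s] by (intro mult_right_mono) auto
      then show ?thesis by (simp add: mult_ac)
    qed
    moreover have "(b s)\<^sup>2 * (- (2 / \<epsilon>) * (b s * W s)) = - (2 / \<epsilon>) * (b s * ((b s)\<^sup>2 * W s))" by simp
    moreover have "(b s)\<^sup>2 * (- (2 / \<epsilon>) * (b s * W s + c s * X s))
        = (b s)\<^sup>2 * (- (2 / \<epsilon>) * (b s * W s)) + (b s)\<^sup>2 * (- (2 / \<epsilon>) * (c s * X s))"
      by (simp only: distrib_left)
    ultimately have "2 * b s * b' s * W s + (b s)\<^sup>2 * (- (2 / \<epsilon>) * (b s * W s + c s * X s)) + g * b s * ((b s)\<^sup>2 * W s)
        \<le> - (2 / \<epsilon>) * (b s * ((b s)\<^sup>2 * W s)) + (1 / \<epsilon>) * (b s * ((b s)\<^sup>2 * W s) + b s * ((c s)\<^sup>2 * Q s))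
          + (1 / (2 * \<epsilon>)) * (b s * ((b s)\<^sup>2 * W s))"
      by linarith
    also have "\<dots> = (b s / (2 * \<epsilon>)) * (2 * ((c s)\<^sup>2 * Q s) - (b s)\<^sup>2 * W s)" using \<epsilon> by (simp add: field_simps)
    finally have "w' s \<le> (b s / (2 * \<epsilon>)) * (2 * ((c s)\<^sup>2 * Q s) - (b s)\<^sup>2 * W s) * exp (g * B s)"
      unfolding w'_def by (intro mult_right_mono) auto
    also have "\<dots> = (b s / (2 * \<epsilon>)) * (2 * ((c s)\<^sup>2 * (Q s * exp (g * B s))) - w s)"
      by (simp add: w_def algebra_simps)
    also have "\<dots> \<le> (b s / (2 * \<epsilon>)) * (2 * (M3\<^sup>2 * C) - w s)"
    proof (intro mult_left_mono diff_right_mono)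
      show "(c s)\<^sup>2 * (Q s * exp (g * B s)) \<le> M3\<^sup>2 * C"
        using cs c(2)[OF s] Qd[OF s] Q[OF s] by (intro mult_mono power_mono) auto
    qed (use bs \<epsilon> in auto)
    finally show ?thesis by (simp add: K_def algebra_simps)
  qed
  define \<kappa> where "\<kappa> = 1 / (2 * \<epsilon>)"
  have "(w t - K) * exp (\<kappa> * B t) \<le> (w 0 - K) * exp (\<kappa> * B 0)"
  proof (rule half_line_nonincreasing[where g = "\<lambda>t. (w t - K) * exp (\<kappa> * B t)"
        and g' = "\<lambda>t. (w' t + \<kappa> * b t * (w t - K)) * exp (\<kappa> * B t)"])
    fix s :: real assume s: "0 \<le> s"
    show "((\<lambda>t. (w t - K) * exp (\<kappa> * B t)) has_real_derivative
        (w' s + \<kappa> * b s * (w s - K)) * exp (\<kappa> * B s)) (at s within {0..})"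
      by (rule derivative_eq_intros wd[OF s] B(2)[OF s] refl)+ (simp add: algebra_simps)
    show "(w' s + \<kappa> * b s * (w s - K)) * exp (\<kappa> * B s) \<le> 0"
      using wle[OF s] by (simp add: mult_le_0_iff \<kappa>_def)
  qed (use t in auto)
  moreover have "w 0 = W 0" by (simp add: w_def b(3) B(1))
  ultimately have le: "(w t - K) * exp (\<kappa> * B t) \<le> W 0 - K" by (simp add: B(1))
  have C0: "0 \<le> C" using Qd[of 0] Q[of 0] by (simp add: B(1))
  then have K0: "0 \<le> K" by (simp add: K_def)
  have "w t - K \<le> W 0"
  proof (cases "w t - K \<le> 0")
    case False
    have "0 \<le> B t" using B_mono[of 0 t] t B(1) by simp
    then have "1 \<le> exp (\<kappa> * B t)" using \<epsilon> by (simp add: \<kappa>_def)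
    then have "(w t - K) * 1 \<le> (w t - K) * exp (\<kappa> * B t)" using False by (intro mult_left_mono) auto
    then show ?thesis using le K0 by simp
  qed (use W[of 0] in simp)
  then show ?thesis by (simp add: w_def K_def)
qed

end

text \<open>The threshold and the constant are fixed before \<open>\<epsilon>\<close>,
  \<open>c\<close> and the energies; this is the uniformity in \<open>\<epsilon>\<close>, and it
  also makes one constant valid for all truncations.\<close>

lemma uniform_decay:
  fixes \<mu> M3 M4 \<nu> \<gamma> \<delta> T :: real and b b' B :: "real \<Rightarrow> real"
  assumes pos: "0 < \<mu>" "\<mu> \<le> M3" "0 \<le> M4" "0 < \<nu>" "0 \<le> \<gamma>" "0 < \<delta>" "0 \<le> T"
    and bT: "\<And>t. T \<le> t \<Longrightarrow> \<gamma> * (b t)\<^sup>2 / \<nu> \<le> 2 * \<mu> - \<delta>"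
  shows "\<exists>\<epsilon>1>0. \<exists>C. \<forall>\<epsilon> c c' P Q X Y W R. damped_energy \<epsilon> \<mu> M3 M4 b b' B c c' \<nu> P Q X Y W R \<longrightarrow>
    \<epsilon> < \<epsilon>1 \<longrightarrow> (\<forall>t\<ge>0. (b t)\<^sup>2 * (Q t + \<epsilon> * P t + W t) * exp (\<gamma> * B t) \<le> C * (P 0 + Q 0))"
proof -
  \<comment> \<open>With this \<open>k\<close> the expression in \<open>hq\<close> is at most
    \<open>- k * \<delta> + k * \<delta> / 2 + \<gamma> = - 1\<close>.\<close>
  define k where "k = 2 * (\<gamma> + 1) / \<delta>"
  have k: "0 < k" and k\<delta>: "k * \<delta> = 2 * (\<gamma> + 1)" using pos by (auto simp: k_def)
  define K1 where "K1 = M4 / \<mu> + k * M3 / \<nu> + 2 * k * M3 + \<gamma> + \<gamma> * k * M3 / \<nu>"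
  define K2 where "K2 = (1 + \<gamma>) * 2 / \<delta>"
  define K3 where "K3 = 1 / (2 * \<mu>)"
  define K4 where "K4 = 4 * k\<^sup>2 * M3 / \<nu>"
  \<comment> \<open>The single bound \<open>\<epsilon> < 1 / K\<close> makes each summand times
    \<open>\<epsilon>\<close> at most 1, which covers all smallness conditions.\<close>
  define K where "K = K1 + K2 + K3 + K4 + 1 + 2 * \<gamma>"
  have Ks: "0 \<le> K1" "0 \<le> K2" "0 \<le> K3" "0 \<le> K4" using pos k by (auto simp: K1_def K2_def K3_def K4_def)
  then have K0: "0 < K" using pos by (simp add: K_def)
  define Kz where "Kz = 1 / \<mu> + 1 + k / \<nu> + k + k / \<nu>"
  have Kz: "0 \<le> Kz" using pos k by (simp add: Kz_def)
  define C where "C = (2 + 2 * M3 + 4 * M3\<^sup>2) * (exp (\<gamma> * B T) * Kz) + 1 / \<nu>"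
  have "(b t)\<^sup>2 * (Q t + \<epsilon> * P t + W t) * exp (\<gamma> * B t) \<le> C * (P 0 + Q 0)"
    if de: "damped_energy \<epsilon> \<mu> M3 M4 b b' B c c' \<nu> P Q X Y W R" and small: "\<epsilon> < 1 / K" and t: "0 \<le> t"
    for \<epsilon> c c' P Q X Y W R t
  proof -
    interpret damped_energy \<epsilon> \<mu> M3 M4 b b' B c c' \<nu> P Q X Y W R by fact
    have small': "\<epsilon> * s \<le> 1" if "s \<le> K" for s
    proof -
      have "\<epsilon> * s \<le> \<epsilon> * K" using that \<epsilon> by (intro mult_left_mono) auto
      also have "\<dots> \<le> 1" using small K0 by (simp add: field_simps)
      finally show ?thesis .
    qed
    have e1: "\<epsilon> * K1 \<le> 1" "\<epsilon> * K2 \<le> 1" "\<epsilon> * K3 \<le> 1" "\<epsilon> * K4 \<le> 1" "\<epsilon> * 1 \<le> 1" "\<epsilon> * (2 * \<gamma>) \<le> 1"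
      using Ks pos by (intro small'; simp add: K_def)+
    have hp: "\<epsilon> * (M4 / \<mu> + k * M3 / \<nu> + 2 * k * M3 + \<gamma> + \<gamma> * k * M3 / \<nu>) \<le> 2"
      using e1(1) by (simp add: K1_def)
    have "M4 / \<mu> + k * M3 / \<nu> + 2 * k * M3 \<le> K1" using pos k by (simp add: K1_def)
    then have hp0: "\<epsilon> * (M4 / \<mu> + k * M3 / \<nu> + 2 * k * M3 + 0 + 0 * k * M3 / \<nu>) \<le> 2"
    proof -
      assume "M4 / \<mu> + k * M3 / \<nu> + 2 * k * M3 \<le> K1"
      then have "\<epsilon> * (M4 / \<mu> + k * M3 / \<nu> + 2 * k * M3) \<le> \<epsilon> * K1" using \<epsilon> by (intro mult_left_mono) auto
      then show ?thesis using e1(1) by simp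
    qed
    have \<epsilon>2: "\<epsilon> * (1 + \<gamma>) \<le> \<delta> / 2" using e1(2) pos by (simp add: K2_def field_simps)
    have hq: "- 2 * k * \<mu> + k * \<epsilon> + \<gamma> + \<gamma> * k * \<epsilon> + \<gamma> * k * (b t)\<^sup>2 / \<nu> \<le> 0" if "T \<le> t" for t
    proof -
      have "k * (\<gamma> * (b t)\<^sup>2 / \<nu>) \<le> k * (2 * \<mu> - \<delta>)" using bT[OF that] k by (intro mult_left_mono) auto
      moreover have "k * (\<epsilon> * (1 + \<gamma>)) \<le> k * (\<delta> / 2)" using \<epsilon>2 k by (intro mult_left_mono) auto
      moreover have "- 2 * k * \<mu> + k * \<epsilon> + \<gamma> + \<gamma> * k * \<epsilon> + \<gamma> * k * (b t)\<^sup>2 / \<nu>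
          = - 2 * (k * \<mu>) + k * (\<epsilon> * (1 + \<gamma>)) + \<gamma> + k * (\<gamma> * (b t)\<^sup>2 / \<nu>)" by (simp add: algebra_simps)
      moreover have "k * (2 * \<mu> - \<delta>) = 2 * (k * \<mu>) - 2 * \<gamma> - 2" "k * (\<delta> / 2) = \<gamma> + 1"
        using k\<delta> by (simp_all add: algebra_simps)
      ultimately show ?thesis by linarith
    qed
    \<comment> \<open>With rate 0 the condition holds at all times, so \<open>Z\<close> does not
      increase before \<open>T\<close>; the rate \<open>\<gamma>\<close> is used from
      \<open>T\<close> on, at the price of the factor \<open>exp (\<gamma> * B T)\<close>.\<close>
    have hq0: "- 2 * k * \<mu> + k * \<epsilon> + 0 + 0 * k * \<epsilon> + 0 * k * (b t)\<^sup>2 / \<nu> \<le> 0" for t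
    proof -
      have "\<epsilon> \<le> 2 * \<mu>" using e1(3) pos by (simp add: K3_def field_simps)
      then have "k * \<epsilon> \<le> k * (2 * \<mu>)" using k by (intro mult_left_mono) auto
      then show ?thesis by simp
    qed
    have h4: "4 * k\<^sup>2 * M3 * \<epsilon> \<le> \<nu>" using e1(4) pos by (simp add: K4_def field_simps)
    have lower: "\<epsilon> * P t / M3 + Q t \<le> 2 * Z k t" if "0 \<le> t" for t
      by (rule Z_lower[OF that k h4])
    have PQ: "0 \<le> P s" "0 \<le> Q s" "0 \<le> \<epsilon> * P s / M3" if "0 \<le> s" for s
      using P[OF that] Q[OF that] pos \<epsilon> by auto
    have Z0: "0 \<le> Z k s" if "0 \<le> s" for s using lower[OF that] PQ[OF that] by linarith
    have Zle: "Z k s \<le> Z k 0" if "0 \<le> s" for s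
      using Z_decay[of k 0 0 s, OF less_imp_le[OF k] order_refl order_refl that hp0 hq0] by simp
    define C0 where "C0 = exp (\<gamma> * B T) * Z k 0"
    have Zexp: "Z k s * exp (\<gamma> * B s) \<le> C0" if s: "0 \<le> s" for s
    proof (cases "T \<le> s")
      case True
      have "Z k s * exp (\<gamma> * B s) \<le> Z k T * exp (\<gamma> * B T)"
        by (rule Z_decay[OF less_imp_le[OF k] pos(5,7) True hp hq])
      also have "\<dots> \<le> Z k 0 * exp (\<gamma> * B T)" using Zle[OF pos(7)] by (intro mult_right_mono) auto
      finally show ?thesis by (simp add: C0_def mult.commute)
    next
      case False
      then have "B s \<le> B T" using s by (intro B_mono) auto
      then have "exp (\<gamma> * B s) \<le> exp (\<gamma> * B T)" using pos by (simp add: mult_left_mono)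
      then have "Z k s * exp (\<gamma> * B s) \<le> Z k 0 * exp (\<gamma> * B T)"
        using Zle[OF s] Z0[OF s] Z0[of 0] by (intro mult_mono) auto
      then show ?thesis by (simp add: C0_def mult.commute)
    qed
    have Qd: "Q s * exp (\<gamma> * B s) \<le> 2 * C0" if s: "0 \<le> s" for s
    proof -
      have "Q s \<le> 2 * Z k s" using lower[OF s] PQ[OF s] by linarith
      then have "Q s * exp (\<gamma> * B s) \<le> 2 * Z k s * exp (\<gamma> * B s)" by (intro mult_right_mono) auto
      then show ?thesis using Zexp[OF s] by linarith
    qed
    have Pd: "\<epsilon> * P t * exp (\<gamma> * B t) \<le> 2 * M3 * C0"
    proof -
      have M3: "0 < M3" using pos by linarith
      have "\<epsilon> * P t / M3 \<le> 2 * Z k t" using lower[OF t] PQ[OF t] by linarith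
      then have "\<epsilon> * P t \<le> M3 * (2 * Z k t)" using M3 by (simp add: field_simps)
      then have "\<epsilon> * P t * exp (\<gamma> * B t) \<le> M3 * (2 * Z k t) * exp (\<gamma> * B t)" by (intro mult_right_mono) auto
      also have "\<dots> = 2 * M3 * (Z k t * exp (\<gamma> * B t))" by simp
      also have "\<dots> \<le> 2 * M3 * C0" using Zexp[OF t] M3 by (intro mult_left_mono) auto
      finally show ?thesis .
    qed
    have "2 * \<epsilon> * \<gamma> \<le> 1" using e1(6) by simp
    from W_decay[OF t pos(5) this Qd]
    have Wd: "(b t)\<^sup>2 * W t * exp (\<gamma> * B t) \<le> 4 * M3\<^sup>2 * C0 + W 0" by simp
    have W0: "W 0 \<le> 1 / \<nu> * (P 0 + Q 0)"
    proof -
      have "W 0 \<le> P 0 / \<nu>" using WP[of 0] pos by (simp add: field_simps)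
      also have "\<dots> \<le> (P 0 + Q 0) / \<nu>" using PQ[of 0] pos by (intro divide_right_mono) auto
      finally show ?thesis by simp
    qed
    have C0le: "C0 \<le> exp (\<gamma> * B T) * Kz * (P 0 + Q 0)"
      using Z_0_upper[of k] k e1(5) unfolding C0_def Kz_def mult.assoc by (intro mult_left_mono) auto
    have b2: "(b t)\<^sup>2 \<le> 1" using b(1,2)[OF t] by (simp add: power_le_one)
    have "(b t)\<^sup>2 * (Q t * exp (\<gamma> * B t) + \<epsilon> * P t * exp (\<gamma> * B t)) \<le> 1 * (2 * C0 + 2 * M3 * C0)"
      using PQ[OF t] \<epsilon> by (intro mult_mono[OF b2 add_mono[OF Qd[OF t] Pd]]) auto
    then have "(b t)\<^sup>2 * (Q t + \<epsilon> * P t + W t) * exp (\<gamma> * B t) \<le> 2 * C0 + 2 * M3 * C0 + (4 * M3\<^sup>2 * C0 + W 0)"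
      using Wd by (simp add: algebra_simps)
    also have "\<dots> = (2 + 2 * M3 + 4 * M3\<^sup>2) * C0 + W 0" by (simp add: algebra_simps)
    also have "\<dots> \<le> (2 + 2 * M3 + 4 * M3\<^sup>2) * (exp (\<gamma> * B T) * Kz * (P 0 + Q 0)) + 1 / \<nu> * (P 0 + Q 0)"
      using pos by (intro add_mono mult_left_mono C0le W0) auto
    also have "\<dots> = C * (P 0 + Q 0)" by (simp add: C_def algebra_simps)
    finally show ?thesis .
  qed
  then show ?thesis using K0 by (intro exI[of _ "1 / K"] conjI exI[of _ C]) auto
qed

text \<open>\<open>L\<close> stands for the truncated \<open>A\<close>. Being bounded and defined
  everywhere, it makes the five energies differentiable and \<open>R\<close> meaningful.\<close>

lemma (in damping) damped_energy_of_evolution: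
  fixes u v :: "real \<Rightarrow> 'h::real_inner" and L :: "'h \<Rightarrow> 'h"
  assumes L: "bounded_linear L" and sym: "\<And>x y. L x \<bullet> y = x \<bullet> L y" and \<nu>: "0 < \<nu>"
    and lower: "\<And>t. 0 \<le> t \<Longrightarrow> \<nu> * (u t \<bullet> u t) \<le> L (u t) \<bullet> u t"
      "\<And>t. 0 \<le> t \<Longrightarrow> \<nu> * (v t \<bullet> v t) \<le> L (v t) \<bullet> v t"
    and u: "\<And>t. 0 \<le> t \<Longrightarrow> (u has_vector_derivative v t) (at t within {0..})"
    and v: "\<And>t. 0 \<le> t \<Longrightarrow>
      (v has_vector_derivative - ((1 / \<epsilon>) *\<^sub>R (b t *\<^sub>R v t + c t *\<^sub>R L (u t)))) (at t within {0..})"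
  shows "damped_energy \<epsilon> \<mu> M3 M4 b b' B c c' \<nu> (\<lambda>t. L (v t) \<bullet> v t) (\<lambda>t. L (u t) \<bullet> L (u t))
    (\<lambda>t. v t \<bullet> L (u t)) (\<lambda>t. u t \<bullet> L (u t)) (\<lambda>t. v t \<bullet> v t) (\<lambda>t. L (v t) \<bullet> L (u t))"
proof -
  define v' where "v' t = - ((1 / \<epsilon>) *\<^sub>R (b t *\<^sub>R v t + c t *\<^sub>R L (u t)))" for t
  note Ld = bounded_linear.has_vector_derivative[OF L]
  have inner: "((\<lambda>t. f t \<bullet> g t) has_real_derivative D) (at t within {0..})"
    if "(f has_vector_derivative f') (at t within {0..})" "(g has_vector_derivative g') (at t within {0..})"
      "D = f t \<bullet> g' + f' \<bullet> g t" for f g :: "real \<Rightarrow> 'h" and f' g' D t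
    using bounded_bilinear.has_vector_derivative[OF bounded_bilinear_inner that(1,2)]
    by (simp add: has_real_derivative_iff_has_vector_derivative that(3))
  have vd: "(v has_vector_derivative v' t) (at t within {0..})" if "0 \<le> t" for t
    using v[OF that] by (simp add: v'_def)
  have v'i: "v' t \<bullet> x = - (1 / \<epsilon>) * (b t * (v t \<bullet> x) + c t * (L (u t) \<bullet> x))"
      "x \<bullet> v' t = - (1 / \<epsilon>) * (b t * (v t \<bullet> x) + c t * (L (u t) \<bullet> x))" for t x
    by (simp_all add: v'_def inner_add_left inner_add_right inner_commute)
  show ?thesis
  proof unfold_locales
    fix t :: real assume t: "0 \<le> t"
    have Lv': "L (v' t) \<bullet> v t = v' t \<bullet> L (v t)" and Lvu: "L (v t) \<bullet> u t = v t \<bullet> L (u t)"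
      by (rule sym)+
    show "((\<lambda>t. L (v t) \<bullet> v t) has_real_derivative
        - (2 / \<epsilon>) * (b t * (L (v t) \<bullet> v t) + c t * (L (v t) \<bullet> L (u t)))) (at t within {0..})"
      by (rule inner[OF Ld[OF vd[OF t]] vd[OF t]])
        (simp add: Lv' v'i inner_commute[of "v t" "L (v t)"] inner_commute[of "L (u t)" "L (v t)"]
          diff_divide_distrib add_divide_distrib)
    show "((\<lambda>t. L (u t) \<bullet> L (u t)) has_real_derivative 2 * (L (v t) \<bullet> L (u t))) (at t within {0..})"
      by (rule inner[OF Ld[OF u[OF t]] Ld[OF u[OF t]]]) (simp add: inner_commute)
    show "((\<lambda>t. v t \<bullet> L (u t)) has_real_derivative L (v t) \<bullet> v t
        - 1 / \<epsilon> * (b t * (v t \<bullet> L (u t)) + c t * (L (u t) \<bullet> L (u t)))) (at t within {0..})"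
      by (rule inner[OF vd[OF t] Ld[OF u[OF t]]]) (simp add: v'i inner_commute[of "v t" "L (u t)"] inner_commute[of "v t" "L (v t)"] diff_divide_distrib add_divide_distrib)
    show "((\<lambda>t. u t \<bullet> L (u t)) has_real_derivative 2 * (v t \<bullet> L (u t))) (at t within {0..})"
      by (rule inner[OF u[OF t] Ld[OF u[OF t]]]) (simp add: inner_commute[of "u t" "L (v t)"] Lvu)
    show "((\<lambda>t. v t \<bullet> v t) has_real_derivative
        - (2 / \<epsilon>) * (b t * (v t \<bullet> v t) + c t * (v t \<bullet> L (u t)))) (at t within {0..})"
      by (rule inner[OF vd[OF t] vd[OF t]]) (simp add: v'i inner_commute[of "v t" "L (u t)"] inner_commute[of "v t" "L (v t)"] diff_divide_distrib add_divide_distrib)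
    show "0 \<le> L (u t) \<bullet> L (u t)" "0 \<le> v t \<bullet> v t" by auto
    show "0 \<le> u t \<bullet> L (u t)"
    proof -
      have "0 \<le> \<nu> * (u t \<bullet> u t)" using \<nu> by simp
      then show ?thesis using lower(1)[OF t] by (simp add: inner_commute)
    qed
    show "\<nu> * (v t \<bullet> v t) \<le> L (v t) \<bullet> v t" by (rule lower(2)[OF t])
    show "(v t \<bullet> L (u t))\<^sup>2 \<le> v t \<bullet> v t * (L (u t) \<bullet> L (u t))" by (rule Cauchy_Schwarz_ineq)
    \<comment> \<open>Expanded, this is
      \<open>2 * \<nu> * Y \<le> Q + \<nu>\<^sup>2 * (u \<bullet> u)\<close>, whose last term is at
      most \<open>\<nu> * Y\<close>.\<close>
    have "0 \<le> (L (u t) - \<nu> *\<^sub>R u t) \<bullet> (L (u t) - \<nu> *\<^sub>R u t)" by simp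
    moreover have "\<nu> * (\<nu> * (u t \<bullet> u t)) \<le> \<nu> * (L (u t) \<bullet> u t)" using lower(1)[OF t] \<nu> by (intro mult_left_mono) auto
    ultimately show "\<nu> * (u t \<bullet> L (u t)) \<le> L (u t) \<bullet> L (u t)"
      by (simp add: inner_diff_left inner_diff_right inner_commute[of "L (u t)" "u t"] right_diff_distrib)
  qed (fact \<nu>)
qed

lemma (in positive_self_adjoint) norm_le_norm_A: assumes "x \<in> D" shows "norm x \<le> norm (A x) / \<nu>"
  using A_bounded_below[OF assms] \<nu> by (simp add: field_simps)

lemma (in positive_self_adjoint) norm_le_norm_S: assumes "x \<in> D" shows "norm x \<le> norm (S x) / sqrt \<nu>"
proof (rule power2_le_imp_le)
  have "(norm x)\<^sup>2 \<le> (norm (S x))\<^sup>2 / \<nu>"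
    using lower[OF assms] norm_S[OF assms] \<nu> by (simp add: field_simps)
  then show "(norm x)\<^sup>2 \<le> (norm (S x) / sqrt \<nu>)\<^sup>2" using \<nu> by (simp add: power_divide)
qed (use \<nu> in simp)

lemma (in positive_self_adjoint) norm_S_le_norm_A: assumes "x \<in> D" shows "norm (S x) \<le> norm (A x) / sqrt \<nu>"
proof (rule power2_le_imp_le)
  have "(norm (S x))\<^sup>2 \<le> norm (A x) * norm x" using norm_S[OF assms] norm_cauchy_schwarz[of "A x" x] by simp
  also have "\<dots> \<le> norm (A x) * (norm (A x) / \<nu>)" using norm_le_norm_A[OF assms] by (rule mult_left_mono) simp
  also have "\<dots> = (norm (A x) / sqrt \<nu>)\<^sup>2" using \<nu> by (simp add: power_divide power2_eq_square)
  finally show "(norm (S x))\<^sup>2 \<le> (norm (A x) / sqrt \<nu>)\<^sup>2" .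
qed (use \<nu> in simp)

section \<open>The damped wave equation\<close>

text \<open>One majorant \<open>\<eta>\<close> serves all quantities: \<open>u\<close> and
  \<open>S u\<close> inherit it from \<open>A u\<close>, and \<open>v\<close> from
  \<open>S v\<close>.\<close>

definition loc_Cauchy :: "(nat \<Rightarrow> real) \<Rightarrow> (nat \<Rightarrow> real \<Rightarrow> 'a::real_normed_vector) \<Rightarrow> bool" where
  "loc_Cauchy \<eta> f \<longleftrightarrow> (\<forall>T. \<exists>C\<ge>0. \<forall>m n. \<forall>t\<in>{0..T}. norm (f m t - f n t) \<le> C * (\<eta> m + \<eta> n))"

definition loc_limit :: "(nat \<Rightarrow> real) \<Rightarrow> (nat \<Rightarrow> real \<Rightarrow> 'a::real_normed_vector) \<Rightarrow> (real \<Rightarrow> 'a) \<Rightarrow> bool" where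
  "loc_limit \<eta> f F \<longleftrightarrow> (\<forall>T. \<exists>C\<ge>0. \<forall>n. \<forall>t\<in>{0..T}. norm (f n t - F t) \<le> C * \<eta> n)"

lemma loc_Cauchy_mono:
  assumes "loc_Cauchy \<eta> g" "0 \<le> K"
    and "\<And>m n t. 0 \<le> t \<Longrightarrow> norm (f m t - f n t) \<le> K * norm (g m t - g n t)"
  shows "loc_Cauchy \<eta> f"
  unfolding loc_Cauchy_def
proof
  fix T
  obtain C where C: "C \<ge> 0" "\<And>m n t. t \<in> {0..T} \<Longrightarrow> norm (g m t - g n t) \<le> C * (\<eta> m + \<eta> n)"
    using assms(1) unfolding loc_Cauchy_def by blast
  have "norm (f m t - f n t) \<le> K * C * (\<eta> m + \<eta> n)" if "t \<in> {0..T}" for m n t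
  proof -
    have "norm (f m t - f n t) \<le> K * norm (g m t - g n t)" using that by (intro assms(3)) simp
    also have "\<dots> \<le> K * (C * (\<eta> m + \<eta> n))" using C(2)[OF that] assms(2) by (rule mult_left_mono)
    finally show ?thesis by simp
  qed
  then show "\<exists>C\<ge>0. \<forall>m n. \<forall>t\<in>{0..T}. norm (f m t - f n t) \<le> C * (\<eta> m + \<eta> n)"
    using C(1) assms(2) by (intro exI[of _ "K * C"]) simp
qed

lemma loc_limit_eventually:
  assumes "loc_limit \<eta> f F" "\<eta> \<longlonglongrightarrow> 0" "0 < e"
  shows "\<exists>N. \<forall>n\<ge>N. \<forall>t\<in>{0..T}. norm (f n t - F t) \<le> e"
proof -
  obtain C where C: "\<And>n t. t \<in> {0..T} \<Longrightarrow> norm (f n t - F t) \<le> C * \<eta> n"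
    using assms(1) unfolding loc_limit_def by blast
  have "\<forall>\<^sub>F n in sequentially. C * \<eta> n < e"
    using order_tendstoD(2)[OF tendsto_mult_right_zero[OF assms(2)] assms(3), of C] .
  then obtain N where N: "\<And>n. n \<ge> N \<Longrightarrow> C * \<eta> n < e" by (auto simp: eventually_sequentially)
  have "norm (f n t - F t) \<le> e" if "n \<ge> N" "t \<in> {0..T}" for n t
    using C[OF that(2), of n] N[OF that(1)] by linarith
  then show ?thesis by blast
qed

lemma loc_limit_tendsto:
  assumes "loc_limit \<eta> f F" "\<eta> \<longlonglongrightarrow> 0" "0 \<le> t"
  shows "(\<lambda>n. f n t) \<longlonglongrightarrow> F t"
proof (rule LIMSEQ_I)
  fix e :: real assume "0 < e"
  then have "0 < e / 2" by simp
  from loc_limit_eventually[OF assms(1,2) this, of t]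
  obtain N where N: "\<forall>n\<ge>N. \<forall>s\<in>{0..t}. norm (f n s - F s) \<le> e / 2" by blast
  have "norm (f n t - F t) < e" if "n \<ge> N" for n
  proof -
    have "norm (f n t - F t) \<le> e / 2" using N that assms(3) by simp
    then show ?thesis using \<open>0 < e\<close> by simp
  qed
  then show "\<exists>N. \<forall>n\<ge>N. norm (f n t - F t) < e" by blast
qed

lemma loc_limit_exists:
  fixes f :: "nat \<Rightarrow> real \<Rightarrow> 'a::{real_normed_vector,complete_space}"
  assumes f: "loc_Cauchy \<eta> f" and \<eta>: "\<eta> \<longlonglongrightarrow> 0"
  shows "\<exists>F. loc_limit \<eta> f F"
proof -
  have conv: "convergent (\<lambda>n. f n t)" if t: "0 \<le> t" for t
  proof -
    obtain C where "\<forall>m n. \<forall>s\<in>{0..t}. norm (f m s - f n s) \<le> C * (\<eta> m + \<eta> n)" and C0: "0 \<le> C"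
      using f unfolding loc_Cauchy_def by blast
    then have C: "norm (f m t - f n t) \<le> C * (\<eta> m + \<eta> n)" for m n using t by simp
    have "Cauchy (\<lambda>n. f n t)"
    proof (rule metric_CauchyI)
      fix e :: real assume e: "0 < e"
      have "\<forall>\<^sub>F n in sequentially. C * \<eta> n < e / 2"
        using order_tendstoD(2)[OF tendsto_mult_right_zero[OF \<eta>], of "e / 2" C] e by simp
      then obtain N where N: "\<And>n. n \<ge> N \<Longrightarrow> C * \<eta> n < e / 2" by (auto simp: eventually_sequentially)
      have "dist (f m t) (f n t) < e" if "m \<ge> N" "n \<ge> N" for m n
        using C[of m n] N[OF that(1)] N[OF that(2)] by (simp add: dist_norm distrib_left)
      then show "\<exists>M. \<forall>m\<ge>M. \<forall>n\<ge>M. dist (f m t) (f n t) < e" by blast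
    qed
    then show ?thesis by (simp add: Cauchy_convergent_iff)
  qed
  define F where "F t = lim (\<lambda>n. f n t)" for t
  have F: "(\<lambda>n. f n t) \<longlonglongrightarrow> F t" if "0 \<le> t" for t
    using conv[OF that] unfolding F_def convergent_LIMSEQ_iff .
  have "loc_limit \<eta> f F" unfolding loc_limit_def
  proof
    fix T
    obtain C where C: "0 \<le> C" "\<And>m n t. t \<in> {0..T} \<Longrightarrow> norm (f m t - f n t) \<le> C * (\<eta> m + \<eta> n)"
      using f unfolding loc_Cauchy_def by blast
    have "norm (f n t - F t) \<le> C * \<eta> n" if t: "t \<in> {0..T}" for n t
    proof (rule LIMSEQ_le)
      show "(\<lambda>m. norm (f n t - f m t)) \<longlonglongrightarrow> norm (f n t - F t)"
        using t by (intro tendsto_norm tendsto_diff tendsto_const F) simp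
      have "(\<lambda>m. C * (\<eta> n + \<eta> m)) \<longlonglongrightarrow> C * (\<eta> n + 0)"
        by (intro tendsto_mult tendsto_add tendsto_const \<eta>)
      then show "(\<lambda>m. C * (\<eta> n + \<eta> m)) \<longlonglongrightarrow> C * \<eta> n" by simp
    qed (intro exI[of _ 0] allI impI C(2)[OF t])
    then show "\<exists>C\<ge>0. \<forall>n. \<forall>t\<in>{0..T}. norm (f n t - F t) \<le> C * \<eta> n" using C(1) by blast
  qed
  then show ?thesis by blast
qed

lemma loc_limit_continuous:
  assumes F: "loc_limit \<eta> f F" and \<eta>: "\<eta> \<longlonglongrightarrow> 0" and cont: "\<And>n. continuous_on {0..} (f n)"
  shows "continuous_on {0..} F"
proof -
  have "continuous_on {0..T} F" for T
  proof (rule uniform_limit_theorem)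
    show "\<forall>\<^sub>F n in sequentially. continuous_on {0..T} (f n)"
      by (intro always_eventually allI continuous_on_subset[OF cont]) auto
    show "uniform_limit {0..T} f F sequentially"
      unfolding uniform_limit_sequentially_iff
    proof (intro allI impI)
      fix e :: real assume "0 < e"
      then have "0 < e / 2" by simp
      from loc_limit_eventually[OF F \<eta> this, of T]
      obtain N where N: "\<forall>n\<ge>N. \<forall>s\<in>{0..T}. norm (f n s - F s) \<le> e / 2" by blast
      have "dist (f n s) (F s) < e" if "n \<ge> N" "s \<in> {0..T}" for n s
      proof -
        have "norm (f n s - F s) \<le> e / 2" using N that by blast
        then show ?thesis using \<open>0 < e\<close> by (simp add: dist_norm)
      qed
      then show "\<exists>N. \<forall>n\<ge>N. \<forall>x\<in>{0..T}. dist (f n x) (F x) < e" by blast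
    qed
  qed simp
  then have "continuous (at t within {0..}) F" if "0 \<le> t" for t
  proof -
    have "continuous (at t within {0..t + 1}) F"
      using \<open>\<And>T. continuous_on {0..T} F\<close>[of "t + 1"] that by (simp add: continuous_on_eq_continuous_within)
    then show ?thesis using at_within_Icc_eq_half_line[of t "t + 1"] that
      by (simp add: continuous_within)
  qed
  then show ?thesis by (simp add: continuous_on_eq_continuous_within)
qed

section \<open>Truncated solutions and existence\<close>

locale damped_wave = positive_self_adjoint D A \<nu> + damping \<epsilon> \<mu> M3 M4 b b' B c c'
  for D :: "'h::{real_inner,complete_space} set" and A \<nu> \<epsilon> \<mu> M3 M4 b b' B c c'
begin

text \<open>With \<open>v = u'\<close> and \<open>a = A u\<close> this is the second derivative
  prescribed by the equation.\<close>

definition accel :: "real \<Rightarrow> 'h \<Rightarrow> 'h \<Rightarrow> 'h" where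
  "accel t v a = - ((1 / \<epsilon>) *\<^sub>R (b t *\<^sub>R v + c t *\<^sub>R a))"

lemma accel_diff: "accel t v a - accel t v' a' = accel t (v - v') (a - a')"
  by (simp add: accel_def scaleR_add_right scaleR_diff_right)

lemma accel_bounded_linear: assumes "bounded_linear f" shows "f (accel t v a) = accel t (f v) (f a)"
proof -
  interpret f: bounded_linear f by fact
  show ?thesis by (simp add: accel_def f.neg f.add f.diff f.scaleR)
qed

lemma M3_pos: "0 < M3"
  using c[of 0] \<mu> by simp

lemma M4_nonneg: "0 \<le> M4"
  using c'(2)[of 0] b(3) by simp

lemma accel_norm: assumes "0 \<le> t" shows "norm (accel t v a) \<le> (1 / \<epsilon>) * (norm v + M3 * norm a)"
proof -
  have "norm (b t *\<^sub>R v + c t *\<^sub>R a) \<le> b t * norm v + c t * norm a"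
    using norm_triangle_ineq[of "b t *\<^sub>R v" "c t *\<^sub>R a"] b(1)[OF assms] c(1)[OF assms] \<mu> by simp
  also have "\<dots> \<le> 1 * norm v + M3 * norm a"
    using b(2)[OF assms] c(2)[OF assms] by (intro add_mono mult_right_mono) auto
  finally have "(1 / \<epsilon>) * norm (b t *\<^sub>R v + c t *\<^sub>R a) \<le> (1 / \<epsilon>) * (norm v + M3 * norm a)"
    using \<epsilon> by (intro mult_left_mono) auto
  then show ?thesis using \<epsilon> by (simp add: accel_def)
qed

lemma b_cont: "continuous_on {0..} b" and c_cont: "continuous_on {0..} c"
  using b'(1) c'(1) by (auto intro: DERIV_continuous_on)

lemma accel_cont:
  assumes "continuous_on {0..} v" "continuous_on {0..} a"
  shows "continuous_on {0..} (\<lambda>t. accel t (v t) (a t))"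
  unfolding accel_def by (intro continuous_intros assms b_cont c_cont)

text \<open>Solutions that stay in the range of \<open>E n\<close>, where \<open>A\<close> is
  bounded. The notion survives differences and larger \<open>n\<close>, so truncations of different
  levels are compared at the larger level.\<close>

definition evolves :: "nat \<Rightarrow> (real \<Rightarrow> 'h) \<Rightarrow> (real \<Rightarrow> 'h) \<Rightarrow> bool" where
  "evolves n u v \<longleftrightarrow> (\<forall>t\<ge>0. E (real n) (u t) = u t \<and> E (real n) (v t) = v t \<and>
     (u has_vector_derivative v t) (at t within {0..}) \<and>
     (v has_vector_derivative accel t (v t) (A (u t))) (at t within {0..}))"

lemma L_bl: "bounded_linear (\<lambda>x. A (E (real n) x))"
  by (rule A_E_bounded_linear) simp

lemma L_sym: "A (E l x) \<bullet> y = x \<bullet> A (E l y)"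
proof -
  have "A (E l x) \<bullet> y = A (E l (E l x)) \<bullet> y" by (simp add: E.E_idem)
  also have "\<dots> = A (E l x) \<bullet> E l y" by (simp add: A_E E_D E.E_sym)
  also have "\<dots> = E l x \<bullet> A (E l y)" by (rule A_sym[OF E_D E_D])
  also have "\<dots> = x \<bullet> A (E l (E l y))" by (simp add: A_E E_D E.E_sym)
  finally show ?thesis by (simp add: E.E_idem)
qed

lemma evolvesD:
  assumes "evolves n u v" "0 \<le> t"
  shows "E (real n) (u t) = u t" "E (real n) (v t) = v t" "u t \<in> D" "v t \<in> D"
    "(u has_vector_derivative v t) (at t within {0..})"
    "(v has_vector_derivative accel t (v t) (A (u t))) (at t within {0..})"
  using assms E_D[of "real n" "u t"] E_D[of "real n" "v t"] by (auto simp: evolves_def)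

lemma evolves_energy:
  assumes ev: "evolves n u v"
  shows "damped_energy \<epsilon> \<mu> M3 M4 b b' B c c' \<nu> (\<lambda>t. A (E (real n) (v t)) \<bullet> v t)
    (\<lambda>t. A (E (real n) (u t)) \<bullet> A (E (real n) (u t)))
    (\<lambda>t. v t \<bullet> A (E (real n) (u t))) (\<lambda>t. u t \<bullet> A (E (real n) (u t))) (\<lambda>t. v t \<bullet> v t)
    (\<lambda>t. A (E (real n) (v t)) \<bullet> A (E (real n) (u t)))"
proof (rule damped_energy_of_evolution[OF L_bl L_sym \<nu>])
  fix t :: real assume t: "0 \<le> t"
  note e = evolvesD[OF ev t]
  show "\<nu> * (u t \<bullet> u t) \<le> A (E (real n) (u t)) \<bullet> u t" "\<nu> * (v t \<bullet> v t) \<le> A (E (real n) (v t)) \<bullet> v t"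
    using lower[OF e(3)] lower[OF e(4)] by (simp_all add: e power2_norm_eq_inner)
  show "(u has_vector_derivative v t) (at t within {0..})" by (rule e)
  show "(v has_vector_derivative - ((1 / \<epsilon>) *\<^sub>R (b t *\<^sub>R v t + c t *\<^sub>R A (E (real n) (u t))))) (at t within {0..})"
    using e(6) by (simp add: accel_def e)
qed

lemma evolves_growth:
  assumes ev: "evolves n u v" and t: "0 \<le> t"
  shows "\<epsilon> * (norm (S (v t)))\<^sup>2 + \<mu> * (norm (A (u t)))\<^sup>2
    \<le> exp (M4 / \<mu> * t) * (\<epsilon> * (norm (S (v 0)))\<^sup>2 + M3 * (norm (A (u 0)))\<^sup>2)"
proof -
  note e = evolvesD[OF ev t] and e0 = evolvesD[OF ev order_refl]
  have "\<epsilon> * (A (E (real n) (v t)) \<bullet> v t) + c t * (A (E (real n) (u t)) \<bullet> A (E (real n) (u t)))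
    \<le> exp (M4 / \<mu> * t) * (\<epsilon> * (A (E (real n) (v 0)) \<bullet> v 0) + c 0 * (A (E (real n) (u 0)) \<bullet> A (E (real n) (u 0))))"
    by (rule damped_energy.growth[OF evolves_energy[OF ev] t])
  then have *: "\<epsilon> * (norm (S (v t)))\<^sup>2 + c t * (norm (A (u t)))\<^sup>2
    \<le> exp (M4 / \<mu> * t) * (\<epsilon> * (norm (S (v 0)))\<^sup>2 + c 0 * (norm (A (u 0)))\<^sup>2)"
    by (simp add: e e0 norm_S power2_norm_eq_inner[of "A _"])
  have "\<mu> * (norm (A (u t)))\<^sup>2 \<le> c t * (norm (A (u t)))\<^sup>2" using c(1)[OF t] by (rule mult_right_mono) simp
  moreover have "exp (M4 / \<mu> * t) * (\<epsilon> * (norm (S (v 0)))\<^sup>2 + c 0 * (norm (A (u 0)))\<^sup>2)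
      \<le> exp (M4 / \<mu> * t) * (\<epsilon> * (norm (S (v 0)))\<^sup>2 + M3 * (norm (A (u 0)))\<^sup>2)"
    using c(2)[of 0] by (intro mult_left_mono add_left_mono mult_right_mono) auto
  ultimately show ?thesis using * by linarith
qed

lemma evolves_mono: assumes "evolves n u v" "n \<le> m" shows "evolves m u v"
proof -
  have "E (real m) x = x" if "E (real n) x = x" for x
    using E.E_min[of "real m" "real n" x] that assms(2) by simp
  then show ?thesis using assms(1) unfolding evolves_def by blast
qed

lemma evolves_diff:
  assumes uv: "evolves n u v" and uv': "evolves n u' v'"
  shows "evolves n (\<lambda>t. u t - u' t) (\<lambda>t. v t - v' t)"
  unfolding evolves_def
proof (intro allI impI conjI)
  fix t :: real assume t: "0 \<le> t"
  note e = evolvesD[OF uv t] and e' = evolvesD[OF uv' t]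
  show "E (real n) (u t - u' t) = u t - u' t" "E (real n) (v t - v' t) = v t - v' t"
    by (simp_all add: E.E_diff e e')
  show "((\<lambda>t. u t - u' t) has_vector_derivative v t - v' t) (at t within {0..})"
    by (rule has_vector_derivative_diff[OF e(5) e'(5)])
  show "((\<lambda>t. v t - v' t) has_vector_derivative accel t (v t - v' t) (A (u t - u' t))) (at t within {0..})"
    using has_vector_derivative_diff[OF e(6) e'(6)] by (simp add: accel_diff A_diff e e')
qed

lemma evolves_exists:
  "\<exists>u v. evolves n u v \<and> u 0 = E (real n) x \<and> v 0 = E (real n) y"
proof -
  define L where "L = (\<lambda>x. A (E (real n) x))"
  interpret L: bounded_linear L unfolding L_def by (rule L_bl)
  obtain N where N: "0 \<le> N" "\<And>x. norm (L x) \<le> norm x * N" using L.nonneg_bounded by blast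
  define f where "f t z = (snd z, accel t (snd z) (L (fst z)))" for t and z :: "'h \<times> 'h"
  define K where "K = 1 + (1 / \<epsilon>) * (1 + M3 * N)"
  have K: "0 < K" using \<epsilon> M3_pos N(1) by (simp add: K_def add_pos_nonneg)
  have "\<exists>z. z 0 = (x, y) \<and> (\<forall>t\<ge>0. (z has_vector_derivative f t (z t)) (at t within {0..}))"
  proof (rule ode_solution_exists[OF _ _ K])
    fix t :: real and z z' :: "'h \<times> 'h" assume t: "0 \<le> t"
    define w where "w = z - z'"
    have ww: "norm (fst w) \<le> norm w" "norm (snd w) \<le> norm w"
        using norm_fst_le[of "fst w" "snd w"] norm_snd_le[of "snd w" "fst w"] by simp_all
    have fz: "f t z - f t z' = (snd w, accel t (snd w) (L (fst w)))"
      by (simp add: f_def w_def accel_diff L.diff prod_eq_iff)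
    have "norm (f t z - f t z') \<le> norm (snd w) + norm (accel t (snd w) (L (fst w)))"
      unfolding fz by (rule norm_Pair_le)
    also have "\<dots> \<le> norm (snd w) + (1 / \<epsilon>) * (norm (snd w) + M3 * norm (L (fst w)))"
      using accel_norm[OF t] by (rule add_left_mono)
    also have "\<dots> \<le> norm w + (1 / \<epsilon>) * (norm w + M3 * (norm w * N))"
    proof (intro add_mono mult_left_mono)
      show "norm (snd w) \<le> norm w" by (rule ww)
      have "norm (L (fst w)) \<le> norm (fst w) * N" by (rule N)
      also have "\<dots> \<le> norm w * N" using N(1) by (intro mult_right_mono ww)
      finally show "norm (L (fst w)) \<le> norm w * N" .
    qed (use \<epsilon> M3_pos ww in auto)
    also have "\<dots> = K * norm w" by (simp add: K_def algebra_simps)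
    finally show "norm (f t z - f t z') \<le> K * norm (z - z')" by (simp add: w_def)
  next
    fix z :: "real \<Rightarrow> 'h \<times> 'h" assume "continuous_on {0..} z"
    then show "continuous_on {0..} (\<lambda>t. f t (z t))"
      unfolding f_def by (intro continuous_on_Pair accel_cont L.continuous_on continuous_on_fst continuous_on_snd)
  qed
  then obtain z where z0: "z 0 = (x, y)"
    and z: "\<And>t. 0 \<le> t \<Longrightarrow> (z has_vector_derivative f t (z t)) (at t within {0..})" by blast
  have En: "bounded_linear (E (real n))" by (rule E.E_bl)
  \<comment> \<open>The system was solved in the whole space with \<open>A (E (real n) x)\<close> in
    place of \<open>A x\<close>. Projecting its solution keeps the equation, since
    \<open>E n\<close> commutes with everything in it, and leads into the range of
    \<open>E n\<close>.\<close>
  define u where "u t = E (real n) (fst (z t))" for t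
  define v where "v t = E (real n) (snd (z t))" for t
  have "evolves n u v" unfolding evolves_def
  proof (intro allI impI conjI)
    fix t :: real assume t: "0 \<le> t"
    show "E (real n) (u t) = u t" "E (real n) (v t) = v t" by (simp_all add: u_def v_def E.E_idem)
    show "(u has_vector_derivative v t) (at t within {0..})"
      using bounded_linear.has_vector_derivative[OF bounded_linear_compose[OF En bounded_linear_fst] z[OF t]]
      by (simp add: u_def[abs_def] v_def f_def)
    have "E (real n) (L (fst (z t))) = A (u t)" unfolding L_def u_def
      by (simp add: A_E[symmetric] E_D E.E_idem)
    then show "(v has_vector_derivative accel t (v t) (A (u t))) (at t within {0..})"
      using bounded_linear.has_vector_derivative[OF bounded_linear_compose[OF En bounded_linear_snd] z[OF t]]
      by (simp add: v_def[abs_def] f_def accel_bounded_linear[OF En])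
  qed
  moreover have "u 0 = E (real n) x" "v 0 = E (real n) y" by (simp_all add: u_def v_def z0)
  ultimately show ?thesis by blast
qed

lemma solution_exists:
  assumes u0: "u0 \<in> D" and u1: "u1 \<in> V"
  shows "\<exists>u v. u 0 = u0 \<and> v 0 = u1 \<and> continuous_on {0..} (\<lambda>t. A (u t)) \<and> continuous_on {0..} (\<lambda>t. S (v t)) \<and>
    (\<forall>t\<ge>0. u t \<in> D \<and> v t \<in> V \<and>
      ((\<lambda>t. (u t, S (u t))) has_vector_derivative (v t, S (v t))) (at t within {0..}) \<and>
      (v has_vector_derivative accel t (v t) (A (u t))) (at t within {0..}))"
proof -
  obtain u v where ev: "\<And>n. evolves n (u n) (v n)" and i0: "\<And>n. u n 0 = E (real n) u0" "\<And>n. v n 0 = E (real n) u1"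
    using evolves_exists[of _ u0 u1] by metis
  note D = evolvesD[OF ev]
  have vV: "v n t \<in> V" if "0 \<le> t" for n t using D(4)[OF that] D_subset_V by blast
  have uV: "u n t \<in> V" if "0 \<le> t" for n t using D(3)[OF that] D_subset_V by blast
  \<comment> \<open>The error of the truncated data in the energy norm; by
    \<open>evolves_growth\<close> it controls the difference of two truncations at all later
    times.\<close>
  define \<eta> where "\<eta> n = norm (S (E (real n) u1) - S u1) + norm (A (E (real n) u0) - A u0)" for n
  have "(\<lambda>n. norm (S (E (real n) u1) - S u1)) \<longlonglongrightarrow> norm (S u1 - S u1)"
    by (intro tendsto_norm tendsto_diff tendsto_const S_E_tendsto u1)
  moreover have "(\<lambda>n. norm (A (E (real n) u0) - A u0)) \<longlonglongrightarrow> norm (A u0 - A u0)"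
    by (intro tendsto_norm tendsto_diff tendsto_const A_E_tendsto u0)
  ultimately have "(\<lambda>n. norm (S (E (real n) u1) - S u1) + norm (A (E (real n) u0) - A u0)) \<longlonglongrightarrow> 0 + 0"
    by (intro tendsto_add) simp_all
  then have \<eta>: "\<eta> \<longlonglongrightarrow> 0" by (simp add: \<eta>_def[abs_def])
  have growth: "\<epsilon> * (norm (S (v m t) - S (v n t)))\<^sup>2 + \<mu> * (norm (A (u m t) - A (u n t)))\<^sup>2
      \<le> exp (M4 / \<mu> * t) * ((\<epsilon> + M3) * (\<eta> m + \<eta> n)\<^sup>2)" if t: "0 \<le> t" for m n t
  proof -
    let ?k = "max m n"
    have "evolves ?k (\<lambda>t. u m t - u n t) (\<lambda>t. v m t - v n t)"
      using evolves_mono[OF ev] by (intro evolves_diff) auto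
    from evolves_growth[OF this t] have "\<epsilon> * (norm (S (v m t) - S (v n t)))\<^sup>2 + \<mu> * (norm (A (u m t) - A (u n t)))\<^sup>2
      \<le> exp (M4 / \<mu> * t) * (\<epsilon> * (norm (S (v m 0) - S (v n 0)))\<^sup>2 + M3 * (norm (A (u m 0) - A (u n 0)))\<^sup>2)"
      using t by (simp add: S_diff A_diff D vV)
    also have "\<dots> \<le> exp (M4 / \<mu> * t) * (\<epsilon> * (\<eta> m + \<eta> n)\<^sup>2 + M3 * (\<eta> m + \<eta> n)\<^sup>2)"
    proof (intro mult_left_mono add_mono power_mono)
      have "norm (S (v m 0) - S (v n 0)) \<le> norm (S (v m 0) - S u1) + norm (S (v n 0) - S u1)"
        using norm_triangle_ineq4[of "S (v m 0) - S u1" "S (v n 0) - S u1"] by simp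
      then show "norm (S (v m 0) - S (v n 0)) \<le> \<eta> m + \<eta> n" by (simp add: \<eta>_def i0) (smt (verit) norm_ge_zero)
      have "norm (A (u m 0) - A (u n 0)) \<le> norm (A (u m 0) - A u0) + norm (A (u n 0) - A u0)"
        using norm_triangle_ineq4[of "A (u m 0) - A u0" "A (u n 0) - A u0"] by simp
      then show "norm (A (u m 0) - A (u n 0)) \<le> \<eta> m + \<eta> n" by (simp add: \<eta>_def i0) (smt (verit) norm_ge_zero)
    qed (use \<epsilon> M3_pos in auto)
    finally show ?thesis by (simp add: algebra_simps)
  qed
  have \<eta>0: "0 \<le> \<eta> n" for n by (simp add: \<eta>_def)
  have bound: "norm x \<le> sqrt (exp (M4 / \<mu> * T) * (\<epsilon> + M3) / s) * (\<eta> m + \<eta> n)"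
    if "s * (norm x)\<^sup>2 \<le> exp (M4 / \<mu> * t) * ((\<epsilon> + M3) * (\<eta> m + \<eta> n)\<^sup>2)" "0 < s" "t \<le> T" for x :: 'h and s t T m n
  proof (rule power2_le_imp_le)
    have "exp (M4 / \<mu> * t) \<le> exp (M4 / \<mu> * T)" using that(3) M4_nonneg \<mu> by (simp add: divide_right_mono mult_left_mono)
    then have "exp (M4 / \<mu> * t) * ((\<epsilon> + M3) * (\<eta> m + \<eta> n)\<^sup>2) \<le> exp (M4 / \<mu> * T) * ((\<epsilon> + M3) * (\<eta> m + \<eta> n)\<^sup>2)"
      using \<epsilon> M3_pos by (intro mult_right_mono) auto
    then have "s * (norm x)\<^sup>2 \<le> exp (M4 / \<mu> * T) * ((\<epsilon> + M3) * (\<eta> m + \<eta> n)\<^sup>2)" using that(1) by linarith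
    then have "(norm x)\<^sup>2 \<le> exp (M4 / \<mu> * T) * (\<epsilon> + M3) / s * (\<eta> m + \<eta> n)\<^sup>2"
      using that(2) by (simp add: field_simps)
    then show "(norm x)\<^sup>2 \<le> (sqrt (exp (M4 / \<mu> * T) * (\<epsilon> + M3) / s) * (\<eta> m + \<eta> n))\<^sup>2"
      using that(2) \<epsilon> M3_pos by (simp add: power_mult_distrib)
  qed (use \<eta>0 \<epsilon> M3_pos that(2) in simp)
  have cSv: "loc_Cauchy \<eta> (\<lambda>n t. S (v n t))" unfolding loc_Cauchy_def
  proof
    fix T
    have "norm (S (v m t) - S (v n t)) \<le> sqrt (exp (M4 / \<mu> * T) * (\<epsilon> + M3) / \<epsilon>) * (\<eta> m + \<eta> n)" if t: "t \<in> {0..T}" for m n t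
    proof (rule bound[OF _ \<epsilon>])
      have "0 \<le> \<mu> * (norm (A (u m t) - A (u n t)))\<^sup>2" using \<mu> by simp
      then show "\<epsilon> * (norm (S (v m t) - S (v n t)))\<^sup>2 \<le> exp (M4 / \<mu> * t) * ((\<epsilon> + M3) * (\<eta> m + \<eta> n)\<^sup>2)"
        using growth[of t m n] t by simp
    qed (use t in simp)
    then show "\<exists>C\<ge>0. \<forall>m n. \<forall>t\<in>{0..T}. norm (S (v m t) - S (v n t)) \<le> C * (\<eta> m + \<eta> n)"
      using \<epsilon> M3_pos by (intro exI[of _ "sqrt (exp (M4 / \<mu> * T) * (\<epsilon> + M3) / \<epsilon>)"]) simp
  qed
  have cAu: "loc_Cauchy \<eta> (\<lambda>n t. A (u n t))" unfolding loc_Cauchy_def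
  proof
    fix T
    have "norm (A (u m t) - A (u n t)) \<le> sqrt (exp (M4 / \<mu> * T) * (\<epsilon> + M3) / \<mu>) * (\<eta> m + \<eta> n)" if t: "t \<in> {0..T}" for m n t
    proof (rule bound[OF _ \<mu>])
      have "0 \<le> \<epsilon> * (norm (S (v m t) - S (v n t)))\<^sup>2" using \<epsilon> by simp
      then show "\<mu> * (norm (A (u m t) - A (u n t)))\<^sup>2 \<le> exp (M4 / \<mu> * t) * ((\<epsilon> + M3) * (\<eta> m + \<eta> n)\<^sup>2)"
        using growth[of t m n] t by simp
    qed (use t in simp)
    then show "\<exists>C\<ge>0. \<forall>m n. \<forall>t\<in>{0..T}. norm (A (u m t) - A (u n t)) \<le> C * (\<eta> m + \<eta> n)"
      using \<epsilon> \<mu> M3_pos by (intro exI[of _ "sqrt (exp (M4 / \<mu> * T) * (\<epsilon> + M3) / \<mu>)"]) simp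
  qed
  have dD: "u m t - u n t \<in> D" "v m t - v n t \<in> D" if "0 \<le> t" for m n t
    using D[OF that] D_subspace by (auto intro: subspace_diff)
  have cu: "loc_Cauchy \<eta> u"
  proof (rule loc_Cauchy_mono[OF cAu, of "1 / \<nu>"])
    show "norm (u m t - u n t) \<le> 1 / \<nu> * norm (A (u m t) - A (u n t))" if "0 \<le> t" for m n t
      using norm_le_norm_A[OF dD(1)[OF that, of m n]] D[OF that] by (simp add: A_diff)
  qed (use \<nu> in simp)
  have cSu: "loc_Cauchy \<eta> (\<lambda>n t. S (u n t))"
  proof (rule loc_Cauchy_mono[OF cAu, of "1 / sqrt \<nu>"])
    show "norm (S (u m t) - S (u n t)) \<le> 1 / sqrt \<nu> * norm (A (u m t) - A (u n t))" if "0 \<le> t" for m n t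
      using norm_S_le_norm_A[OF dD(1)[OF that, of m n]] D[OF that] uV[OF that] by (simp add: A_diff S_diff)
  qed (use \<nu> in simp)
  have cv: "loc_Cauchy \<eta> v"
  proof (rule loc_Cauchy_mono[OF cSv, of "1 / sqrt \<nu>"])
    show "norm (v m t - v n t) \<le> 1 / sqrt \<nu> * norm (S (v m t) - S (v n t))" if "0 \<le> t" for m n t
      using norm_le_norm_S[OF dD(2)[OF that, of m n]] vV[OF that] by (simp add: S_diff)
  qed (use \<nu> in simp)
  obtain U where U: "loc_limit \<eta> u U" using loc_limit_exists[OF cu \<eta>] by blast
  obtain W where W: "loc_limit \<eta> v W" using loc_limit_exists[OF cv \<eta>] by blast
  obtain SU where SU: "loc_limit \<eta> (\<lambda>n t. S (u n t)) SU" using loc_limit_exists[OF cSu \<eta>] by blast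
  obtain SW where SW: "loc_limit \<eta> (\<lambda>n t. S (v n t)) SW" using loc_limit_exists[OF cSv \<eta>] by blast
  obtain AU where AU: "loc_limit \<eta> (\<lambda>n t. A (u n t)) AU" using loc_limit_exists[OF cAu \<eta>] by blast
  have UD: "U t \<in> D \<and> A (U t) = AU t" if t: "0 \<le> t" for t
    by (rule A_closed[where x = "\<lambda>n. u n t"]) (auto intro: D(3)[OF t] loc_limit_tendsto[OF U \<eta> t] loc_limit_tendsto[OF AU \<eta> t])
  have US: "S (U t) = SU t" if t: "0 \<le> t" for t
    using S_closed[where X = "\<lambda>n. u n t", OF uV[OF t] loc_limit_tendsto[OF U \<eta> t] loc_limit_tendsto[OF SU \<eta> t]] by blast
  have WS: "W t \<in> V \<and> S (W t) = SW t" if t: "0 \<le> t" for t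
    using S_closed[where X = "\<lambda>n. v n t", OF vV[OF t] loc_limit_tendsto[OF W \<eta> t] loc_limit_tendsto[OF SW \<eta> t]] .
  \<comment> \<open>\<open>S\<close> is unbounded and does not pass through derivatives; on the
    truncated functions it agrees with the bounded map \<open>S\<close> after \<open>E n\<close>, so
    the pairs are differentiable for each \<open>n\<close> before the limit is taken.\<close>
  have SE_bl: "bounded_linear (\<lambda>x. S (E (real n) x))" for n
  proof (rule bounded_linear_intro)
    show "S (E (real n) (x + y)) = S (E (real n) x) + S (E (real n) y)" for x y by (simp add: E.E_add S_add E_V)
    show "S (E (real n) (r *\<^sub>R x)) = r *\<^sub>R S (E (real n) x)" for r x by (simp add: E.E_scale S_scale E_V)
    show "norm (S (E (real n) x)) \<le> norm x * (real n powr (1 / 2))" for x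
      using S.op_truncated[of "real n" x] by (simp add: S_op mult.commute)
  qed
  have pair_bl: "bounded_linear (\<lambda>x. (x, S (E (real n) x)))" for n
    by (rule bounded_linear_Pair[OF bounded_linear_ident SE_bl])
  have d1: "((\<lambda>t. (U t, S (U t))) has_vector_derivative (W t, S (W t))) (at t within {0..})" if t: "0 \<le> t" for t
  proof (rule has_vector_derivative_limit[where w = "\<lambda>n t. (u n t, S (E (real n) (u n t)))" and
        g = "\<lambda>n t. (v n t, S (E (real n) (v n t)))" and W = "\<lambda>t. (U t, S (U t))" and G = "\<lambda>t. (W t, S (W t))", OF _ _ _ t])
    fix s :: real assume s: "0 \<le> s"
    show "((\<lambda>t. (u n t, S (E (real n) (u n t)))) has_vector_derivative (v n s, S (E (real n) (v n s)))) (at s within {0..})" for n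
      by (rule bounded_linear.has_vector_derivative[OF pair_bl D(5)[OF s]])
    show "(\<lambda>n. (u n s, S (E (real n) (u n s)))) \<longlonglongrightarrow> (U s, S (U s))"
      unfolding D(1)[OF s] US[OF s] by (intro tendsto_Pair loc_limit_tendsto[OF U \<eta> s] loc_limit_tendsto[OF SU \<eta> s])
  next
    fix T e :: real assume e: "0 < e"
    then have e2: "0 < e / 2" by simp
    obtain N1 where N1: "\<forall>n\<ge>N1. \<forall>t\<in>{0..T}. norm (v n t - W t) \<le> e / 2" using loc_limit_eventually[OF W \<eta> e2] by blast
    obtain N2 where N2: "\<forall>n\<ge>N2. \<forall>t\<in>{0..T}. norm (S (v n t) - SW t) \<le> e / 2" using loc_limit_eventually[OF SW \<eta> e2] by blast
    have "norm ((v n s, S (E (real n) (v n s))) - (W s, S (W s))) \<le> e" if n: "n \<ge> max N1 N2" and s: "s \<in> {0..T}" for n s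
    proof -
      have s0: "0 \<le> s" using s by simp
      have "norm ((v n s, S (E (real n) (v n s))) - (W s, S (W s))) \<le> norm (v n s - W s) + norm (S (v n s) - SW s)"
        using WS[OF s0] D(2)[OF s0] by (simp add: norm_Pair_le)
      also have "\<dots> \<le> e / 2 + e / 2" using N1 N2 n s by (intro add_mono) auto
      finally show ?thesis by simp
    qed
    then show "\<exists>N. \<forall>n\<ge>N. \<forall>t\<in>{0..T}. norm ((v n t, S (E (real n) (v n t))) - (W t, S (W t))) \<le> e" by blast
  qed
  have d2: "(W has_vector_derivative accel t (W t) (A (U t))) (at t within {0..})" if t: "0 \<le> t" for t
  proof (rule has_vector_derivative_limit[where w = v and g = "\<lambda>n t. accel t (v n t) (A (u n t))"
        and G = "\<lambda>t. accel t (W t) (A (U t))", OF _ _ _ t])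
    fix s :: real assume s: "0 \<le> s"
    show "(v n has_vector_derivative accel s (v n s) (A (u n s))) (at s within {0..})" for n by (rule D(6)[OF s])
    show "(\<lambda>n. v n s) \<longlonglongrightarrow> W s" by (rule loc_limit_tendsto[OF W \<eta> s])
  next
    fix T e :: real assume e: "0 < e"
    define d where "d = e * \<epsilon> / (1 + M3)"
    have d: "0 < d" using e \<epsilon> M3_pos by (simp add: d_def)
    obtain N1 where N1: "\<forall>n\<ge>N1. \<forall>t\<in>{0..T}. norm (v n t - W t) \<le> d" using loc_limit_eventually[OF W \<eta> d] by blast
    obtain N2 where N2: "\<forall>n\<ge>N2. \<forall>t\<in>{0..T}. norm (A (u n t) - AU t) \<le> d" using loc_limit_eventually[OF AU \<eta> d] by blast
    have "norm (accel s (v n s) (A (u n s)) - accel s (W s) (A (U s))) \<le> e" if n: "n \<ge> max N1 N2" and s: "s \<in> {0..T}" for n s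
    proof -
      have s0: "0 \<le> s" using s by simp
      have "norm (accel s (v n s) (A (u n s)) - accel s (W s) (A (U s))) \<le> (1 / \<epsilon>) * (norm (v n s - W s) + M3 * norm (A (u n s) - AU s))"
        using UD[OF s0] accel_norm[OF s0] by (simp add: accel_diff)
      also have "\<dots> \<le> (1 / \<epsilon>) * (d + M3 * d)"
        using N1 N2 n s M3_pos \<epsilon> by (intro mult_left_mono add_mono) auto
      also have "\<dots> = (1 / \<epsilon>) * (d * (1 + M3))" by (simp add: algebra_simps)
      also have "\<dots> = e" using \<epsilon> M3_pos by (simp add: d_def)
      finally show ?thesis .
    qed
    then show "\<exists>N. \<forall>n\<ge>N. \<forall>t\<in>{0..T}. norm (accel t (v n t) (A (u n t)) - accel t (W t) (A (U t))) \<le> e" by blast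
  qed
  have un_cont: "continuous_on {0..} (u n)" "continuous_on {0..} (v n)" for n
    using D(5) D(6) by (auto intro!: continuous_on_vector_derivative)
  have "continuous_on {0..} AU"
  proof (rule loc_limit_continuous[OF AU \<eta>])
    fix n
    have "continuous_on {0..} (\<lambda>t. A (E (real n) (u n t)))"
      by (rule bounded_linear.continuous_on[OF L_bl un_cont(1)])
    then show "continuous_on {0..} (\<lambda>t. A (u n t))"
      by (rule continuous_on_eq) (simp add: D(1))
  qed
  then have c1: "continuous_on {0..} (\<lambda>t. A (U t))" by (rule continuous_on_eq) (simp add: UD)
  have "continuous_on {0..} SW"
  proof (rule loc_limit_continuous[OF SW \<eta>])
    fix n
    have "continuous_on {0..} (\<lambda>t. S (E (real n) (v n t)))"
      by (rule bounded_linear.continuous_on[OF SE_bl un_cont(2)])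
    then show "continuous_on {0..} (\<lambda>t. S (v n t))"
      by (rule continuous_on_eq) (simp add: D(2))
  qed
  then have c2: "continuous_on {0..} (\<lambda>t. S (W t))" by (rule continuous_on_eq) (simp add: WS)
  have "(\<lambda>n. E (real n) u0) \<longlonglongrightarrow> U 0" "(\<lambda>n. E (real n) u1) \<longlonglongrightarrow> W 0"
    unfolding i0[symmetric] by (rule loc_limit_tendsto[OF U \<eta>] loc_limit_tendsto[OF W \<eta>], simp)+
  then have "U 0 = u0" "W 0 = u1" using LIMSEQ_unique[OF _ E.E_seq] by blast+
  then show ?thesis using c1 c2 UD WS d1 d2 by (intro exI[of _ U] exI[of _ W]) auto
qed

end

section \<open>From solutions to evolutions: uniqueness and decay\<close>

lemma hderiv_eq:
  assumes "(f has_vector_derivative f') (at t within {0..})" "0 \<le> t"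
  shows "hderiv f t = f'"
proof -
  have "at t within {0..} \<noteq> bot"
    using at_within_Icc_eq_half_line[of t "t + 1"] assms(2) by (simp flip: at_within_Icc_eq_half_line[of t "t + 1"] add: trivial_limit_within islimpt_Icc)
  then show ?thesis unfolding hderiv_def by (rule vector_derivative_within[OF _ assms(1)])
qed

lemma C1_half_has_vector_derivative:
  assumes "C1_half f" "0 \<le> t"
  shows "(f has_vector_derivative hderiv f t) (at t within {0..})"
  using assms unfolding C1_half_def differentiable_on_def hderiv_def
  by (simp add: vector_derivative_works)

lemma C1_halfI:
  assumes d: "\<And>t. 0 \<le> t \<Longrightarrow> (f has_vector_derivative f' t) (at t within {0..})"
    and cont: "continuous_on {0..} f'"
  shows "C1_half f"
  unfolding C1_half_def
proof
  show "f differentiable_on {0..}"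
    unfolding differentiable_on_def using d by (auto intro: differentiableI_vector)
  show "continuous_on {0..} (hderiv f)"
    by (rule continuous_on_eq[OF cont]) (rule hderiv_eq[OF d, symmetric]; simp)
qed

context damped_wave begin

lemma is_solutionI:
  assumes bp: "\<And>t. b t = 1 / (1 + t) powr p"
    and init: "u 0 = u0" "v 0 = u1"
    and cAu: "continuous_on {0..} (\<lambda>t. A (u t))" and cSv: "continuous_on {0..} (\<lambda>t. S (v t))"
    and D: "\<And>t. 0 \<le> t \<Longrightarrow> u t \<in> D" and V: "\<And>t. 0 \<le> t \<Longrightarrow> v t \<in> V"
    and d1: "\<And>t. 0 \<le> t \<Longrightarrow> ((\<lambda>t. (u t, S (u t))) has_vector_derivative (v t, S (v t))) (at t within {0..})"
    and d2: "\<And>t. 0 \<le> t \<Longrightarrow> (v has_vector_derivative accel t (v t) (A (u t))) (at t within {0..})"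
  shows "is_solution D A p \<epsilon> c u0 u1 u"
proof -
  have du: "(u has_vector_derivative v t) (at t within {0..})" if "0 \<le> t" for t
    using bounded_linear.has_vector_derivative[OF bounded_linear_fst d1[OF that]] by simp
  have cu: "continuous_on {0..} u" and cv: "continuous_on {0..} v"
    using du d2 by (auto intro!: continuous_on_vector_derivative)
  have hu: "hderiv u t = v t" if "0 \<le> t" for t using hderiv_eq[OF du] that by simp
  have dhu: "(hderiv u has_vector_derivative accel t (v t) (A (u t))) (at t within {0..})" if "0 \<le> t" for t
    by (rule has_vector_derivative_transform[OF _ _ d2[OF that]]) (use that hu in auto)
  have hhu: "hderiv (hderiv u) t = accel t (v t) (A (u t))" if "0 \<le> t" for t
    using hderiv_eq[OF dhu] that by simp
  have "C1_half u" by (rule C1_halfI[OF du cv])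
  moreover have "C1_half (hderiv u)" by (rule C1_halfI[OF dhu accel_cont[OF cv cAu]])
  moreover have "C0_half_graph V S v"
    unfolding C0_half_graph_def using V by (intro conjI allI impI continuous_on_Pair cv cSv) auto
  then have "C1_half_graph V S u"
    unfolding C1_half_graph_def using D D_subset_V d1 by blast
  moreover have "C0_half_graph D A u"
    unfolding C0_half_graph_def using D by (intro conjI allI impI continuous_on_Pair cu cAu) auto
  moreover have "\<epsilon> *\<^sub>R hderiv (hderiv u) t + (1 / (1 + t) powr p) *\<^sub>R hderiv u t + c t *\<^sub>R A (u t) = 0" if "0 \<le> t" for t
    using \<epsilon> by (simp add: hhu[OF that] hu[OF that] accel_def flip: bp)
  moreover have "hderiv u 0 = u1" using hu[of 0] init by simp
  ultimately show ?thesis unfolding is_solution_def C2_half_def using init by blast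
qed

lemma is_solutionD:
  assumes bp: "\<And>t. b t = 1 / (1 + t) powr p"
    and sol: "is_solution D A p \<epsilon> c u0 u1 u"
  shows "u 0 = u0" "hderiv u 0 = u1"
    and "0 \<le> t \<Longrightarrow> u t \<in> D" "0 \<le> t \<Longrightarrow> hderiv u t \<in> V"
    and "0 \<le> t \<Longrightarrow> (u has_vector_derivative hderiv u t) (at t within {0..})"
    and "0 \<le> t \<Longrightarrow> (hderiv u has_vector_derivative accel t (hderiv u t) (A (u t))) (at t within {0..})"
proof -
  note s = sol[unfolded is_solution_def C2_half_def]
  show "u 0 = u0" "hderiv u 0 = u1" using s by auto
  assume t: "0 \<le> t"
  show "u t \<in> D" using s t by (simp add: C0_half_graph_def)
  show "(u has_vector_derivative hderiv u t) (at t within {0..})"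
    using s t by (intro C1_half_has_vector_derivative) auto
  \<comment> \<open>The graph-norm derivative has \<open>hderiv u t\<close> as its first component,
    which places \<open>hderiv u t\<close> in \<open>V\<close>.\<close>
  obtain v where v: "C0_half_graph V S v"
    and d: "((\<lambda>t. (u t, S (u t))) has_vector_derivative (v t, S (v t))) (at t within {0..})"
    using s t unfolding C1_half_graph_def by blast
  have "(u has_vector_derivative v t) (at t within {0..})"
    using bounded_linear.has_vector_derivative[OF bounded_linear_fst d] by simp
  then have "hderiv u t = v t" using t by (rule hderiv_eq)
  then show "hderiv u t \<in> V" using v t by (simp add: C0_half_graph_def)
  have "\<epsilon> *\<^sub>R hderiv (hderiv u) t + b t *\<^sub>R hderiv u t + c t *\<^sub>R A (u t) = 0"
    using s t by (simp add: bp)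
  then have "\<epsilon> *\<^sub>R hderiv (hderiv u) t = - (b t *\<^sub>R hderiv u t + c t *\<^sub>R A (u t))"
    by (simp only: eq_neg_iff_add_eq_0 add.assoc)
  then have "(1 / \<epsilon>) *\<^sub>R (\<epsilon> *\<^sub>R hderiv (hderiv u) t) = accel t (hderiv u t) (A (u t))"
    by (simp only: accel_def scaleR_minus_right)
  then have "hderiv (hderiv u) t = accel t (hderiv u t) (A (u t))" using \<epsilon> by simp
  moreover have "(hderiv u has_vector_derivative hderiv (hderiv u) t) (at t within {0..})"
    using s t by (intro C1_half_has_vector_derivative) auto
  ultimately show "(hderiv u has_vector_derivative accel t (hderiv u t) (A (u t))) (at t within {0..})" by simp
qed

lemma evolves_truncation:
  assumes D: "\<And>t. 0 \<le> t \<Longrightarrow> u t \<in> D"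
    and u: "\<And>t. 0 \<le> t \<Longrightarrow> (u has_vector_derivative v t) (at t within {0..})"
    and v: "\<And>t. 0 \<le> t \<Longrightarrow> (v has_vector_derivative accel t (v t) (A (u t))) (at t within {0..})"
  shows "evolves n (\<lambda>t. E (real n) (u t)) (\<lambda>t. E (real n) (v t))"
  unfolding evolves_def
proof (intro allI impI conjI)
  fix t :: real assume t: "0 \<le> t"
  show "((\<lambda>t. E (real n) (u t)) has_vector_derivative E (real n) (v t)) (at t within {0..})"
    by (rule bounded_linear.has_vector_derivative[OF E.E_bl u[OF t]])
  show "((\<lambda>t. E (real n) (v t)) has_vector_derivative accel t (E (real n) (v t)) (A (E (real n) (u t)))) (at t within {0..})"
    using bounded_linear.has_vector_derivative[OF E.E_bl v[OF t], of "real n"]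
    by (simp add: accel_bounded_linear[OF E.E_bl] A_E[OF D[OF t]])
qed (simp_all add: E.E_idem)

text \<open>The truncated differences have zero data, so \<open>evolves_growth\<close> makes them
  vanish, and \<open>E n\<close> tends strongly to the identity.\<close>

lemma solution_unique:
  assumes bp: "\<And>t. b t = 1 / (1 + t) powr p"
    and sol: "is_solution D A p \<epsilon> c u0 u1 u" "is_solution D A p \<epsilon> c u0 u1 w" and t: "0 \<le> t"
  shows "w t = u t"
proof -
  note U = is_solutionD[OF bp sol(1)] and W = is_solutionD[OF bp sol(2)]
  have "E (real n) (w t) = E (real n) (u t)" for n
  proof -
    let ?w = "\<lambda>t. E (real n) (w t) - E (real n) (u t)"
    have ev: "evolves n ?w (\<lambda>t. E (real n) (hderiv w t) - E (real n) (hderiv u t))"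
      by (intro evolves_diff evolves_truncation U(3,5,6) W(3,5,6))
    have "0 \<le> \<epsilon> * (norm (S (E (real n) (hderiv w t) - E (real n) (hderiv u t))))\<^sup>2" using \<epsilon> by simp
    moreover have "S 0 = 0" using norm_S[of 0] D_subspace A_0 by (simp add: subspace_0)
    ultimately have "\<mu> * (norm (A (?w t)))\<^sup>2 \<le> 0"
      using evolves_growth[OF ev t] by (simp add: U(1,2) W(1,2) A_0)
    then have "A (?w t) = 0" using \<mu> by (simp add: mult_le_0_iff)
    moreover have "?w t \<in> D" using E_D D_subspace by (intro subspace_diff)
    ultimately have "?w t = 0" using norm_le_norm_A[of "?w t"] by simp
    then show ?thesis by simp
  qed
  then have "(\<lambda>n. E (real n) (w t)) \<longlonglongrightarrow> u t" using E.E_seq[of "u t"] by simp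
  from LIMSEQ_unique[OF E.E_seq this] show ?thesis .
qed

text \<open>The estimate holds for every truncation with the same constant and passes to the limit;
  the energies of the data converge because \<open>u0\<close> is in \<open>D\<close> and
  \<open>u1\<close> in \<open>V\<close>. The factor \<open>1 / \<nu>\<^sup>2 + 1 / \<nu> + 1\<close>
  comes from bounding \<open>u\<close> and \<open>S u\<close> by \<open>A u\<close>.\<close>

lemma solution_decay:
  assumes bp: "\<And>t. b t = 1 / (1 + t) powr p"
    and sol: "is_solution D A p \<epsilon> c u0 u1 u" and u0: "u0 \<in> D" and u1: "u1 \<in> V"
    and dec: "\<And>P Q X Y W R. damped_energy \<epsilon> \<mu> M3 M4 b b' B c c' \<nu> P Q X Y W R \<Longrightarrow>
      (b t)\<^sup>2 * (Q t + \<epsilon> * P t + W t) * exp (\<gamma> * B t) \<le> C * (P 0 + Q 0)"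
    and t: "0 \<le> t"
  shows "Gamma_energy D A \<epsilon> u t * ((b t)\<^sup>2 * exp (\<gamma> * B t))
    \<le> (1 / \<nu>\<^sup>2 + 1 / \<nu> + 1) * (C * ((norm (S u1))\<^sup>2 + (norm (A u0))\<^sup>2))"
proof -
  note U = is_solutionD[OF bp sol]
  define v where "v = hderiv u"
  have uD: "u t \<in> D" and vV: "v t \<in> V" using U(3,4)[OF t] by (auto simp: v_def)
  have le: "(b t)\<^sup>2 * ((norm (A (E (real n) (u t))))\<^sup>2 + \<epsilon> * (norm (S (E (real n) (v t))))\<^sup>2 + (norm (E (real n) (v t)))\<^sup>2) * exp (\<gamma> * B t)
      \<le> C * ((norm (S (E (real n) u1)))\<^sup>2 + (norm (A (E (real n) u0)))\<^sup>2)" for n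
  proof -
    have ev: "evolves n (\<lambda>t. E (real n) (u t)) (\<lambda>t. E (real n) (v t))"
      unfolding v_def by (intro evolves_truncation U(3,5,6))
    from dec[OF evolves_energy[OF ev]] show ?thesis
      by (simp add: E.E_idem norm_S E_D power2_norm_eq_inner[of "A _"] power2_norm_eq_inner[of "E _ _"] U(1) v_def U(2))
  qed
  have lim: "(b t)\<^sup>2 * ((norm (A (u t)))\<^sup>2 + \<epsilon> * (norm (S (v t)))\<^sup>2 + (norm (v t))\<^sup>2) * exp (\<gamma> * B t)
      \<le> C * ((norm (S u1))\<^sup>2 + (norm (A u0))\<^sup>2)"
  proof (rule LIMSEQ_le)
    show "(\<lambda>n. (b t)\<^sup>2 * ((norm (A (E (real n) (u t))))\<^sup>2 + \<epsilon> * (norm (S (E (real n) (v t))))\<^sup>2 + (norm (E (real n) (v t)))\<^sup>2) * exp (\<gamma> * B t))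
      \<longlonglongrightarrow> (b t)\<^sup>2 * ((norm (A (u t)))\<^sup>2 + \<epsilon> * (norm (S (v t)))\<^sup>2 + (norm (v t))\<^sup>2) * exp (\<gamma> * B t)"
      by (intro tendsto_mult tendsto_add tendsto_const tendsto_power tendsto_norm
          A_E_tendsto[OF uD] S_E_tendsto[OF vV] E.E_seq)
    show "(\<lambda>n. C * ((norm (S (E (real n) u1)))\<^sup>2 + (norm (A (E (real n) u0)))\<^sup>2))
      \<longlonglongrightarrow> C * ((norm (S u1))\<^sup>2 + (norm (A u0))\<^sup>2)"
      by (intro tendsto_mult tendsto_add tendsto_const tendsto_power tendsto_norm
          A_E_tendsto[OF u0] S_E_tendsto[OF u1])
  qed (use le in blast)
  define G where "G = (norm (A (u t)))\<^sup>2 + \<epsilon> * (norm (S (v t)))\<^sup>2 + (norm (v t))\<^sup>2"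
  define K where "K = 1 / \<nu>\<^sup>2 + 1 / \<nu> + 1"
  have "(norm (u t))\<^sup>2 \<le> (norm (A (u t)) / \<nu>)\<^sup>2" using norm_le_norm_A[OF uD] by (rule power_mono) simp
  moreover have "(norm (S (u t)))\<^sup>2 \<le> (norm (A (u t)) / sqrt \<nu>)\<^sup>2" using norm_S_le_norm_A[OF uD] by (rule power_mono) simp
  moreover have "0 \<le> (1 / \<nu>\<^sup>2 + 1 / \<nu>) * (\<epsilon> * (norm (S (v t)))\<^sup>2 + (norm (v t))\<^sup>2)" using \<epsilon> \<nu> by simp
  ultimately have "Gamma_energy D A \<epsilon> u t \<le> K * G"
    using \<nu> unfolding Gamma_energy_def K_def G_def v_def by (simp add: power_divide algebra_simps)
  then have "Gamma_energy D A \<epsilon> u t * ((b t)\<^sup>2 * exp (\<gamma> * B t)) \<le> K * G * ((b t)\<^sup>2 * exp (\<gamma> * B t))"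
    by (intro mult_right_mono) auto
  also have "\<dots> = K * ((b t)\<^sup>2 * G * exp (\<gamma> * B t))" by simp
  also have "\<dots> \<le> K * (C * ((norm (S u1))\<^sup>2 + (norm (A u0))\<^sup>2))"
    using lim \<nu> by (intro mult_left_mono) (auto simp: G_def K_def)
  finally show ?thesis by (simp add: K_def)
qed

end

section \<open>Power-law damping and the decay rates\<close>

lemma op_lower_bound_le:
  assumes sa: "self_adjoint_op D A" and \<nu>: "ereal \<nu>0 \<le> op_lower_bound D A" and u: "u \<in> D"
  shows "\<nu>0 * (norm u)\<^sup>2 \<le> A u \<bullet> u"
proof (cases "u = 0")
  case False
  define w where "w = (1 / norm u) *\<^sub>R u"
  have lin: "subspace D" "\<And>r x. x \<in> D \<Longrightarrow> A (r *\<^sub>R x) = r *\<^sub>R A x"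
    using sa by (auto simp: self_adjoint_op_def linear_op_def)
  have wD: "w \<in> D" unfolding w_def using lin u by (intro subspace_scale)
  have "op_lower_bound D A \<le> ereal (A w \<bullet> w)"
    unfolding op_lower_bound_def using wD False by (intro INF_lower) (simp add: w_def)
  then have "\<nu>0 \<le> A w \<bullet> w" using \<nu> by (metis ereal_less_eq(3) order_trans)
  also have "A w \<bullet> w = (A u \<bullet> u) / (norm u)\<^sup>2" using lin(2)[OF u] by (simp add: w_def power2_eq_square)
  finally show ?thesis using False by (simp add: field_simps)
next
  case True
  have "A 0 = 0 *\<^sub>R A u"
    using sa u unfolding self_adjoint_op_def linear_op_def by (metis scale_zero_left)
  then show ?thesis using True by simp
qed

text \<open>The primitive of \<open>(1 + t) powr (- p)\<close> that vanishes at 0.\<close>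

definition damping_integral :: "real \<Rightarrow> real \<Rightarrow> real" where
  "damping_integral p t = (if p = 1 then ln (1 + t) else ((1 + t) powr (1 - p) - 1) / (1 - p))"

lemma damping_powr:
  assumes p: "0 \<le> p" "p \<le> 1" and pos: "0 < \<epsilon>" "0 < \<mu>"
    and c1: "C1_half c" and cb: "\<And>t. 0 \<le> t \<Longrightarrow> \<mu> \<le> c t \<and> c t \<le> M3"
    and c': "\<And>t. 0 \<le> t \<Longrightarrow> \<bar>hderiv c t\<bar> \<le> M4 / (1 + t) powr p"
  shows "damping \<epsilon> \<mu> M3 M4 (\<lambda>t. 1 / (1 + t) powr p) (\<lambda>t. - p / (1 + t) powr (p + 1)) (damping_integral p) c (hderiv c)"
proof (unfold_locales)
  fix t :: real assume t: "0 \<le> t"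
  have t1: "1 \<le> 1 + t" "0 < 1 + t" using t by auto
  show "0 < 1 / (1 + t) powr p" using t1 by simp
  show "1 / (1 + t) powr p \<le> 1" using ge_one_powr_ge_zero[OF t1(1) p(1)] t1 by simp
  have "((\<lambda>t. (1 + t) powr (- p)) has_real_derivative - p * (1 + t) powr (- p - 1)) (at t within {0..})"
    using t1 by (auto intro!: derivative_eq_intros)
  then show "((\<lambda>t. 1 / (1 + t) powr p) has_real_derivative - p / (1 + t) powr (p + 1)) (at t within {0..})"
    using t1 by (simp add: powr_minus_divide powr_diff powr_add)
  have "(1 + t) powr (p * 2) \<le> (1 + t) powr (p + 1)" using t1 p by (intro powr_mono) auto
  then have "((1 + t) powr p)\<^sup>2 \<le> (1 + t) powr (p + 1)" using t1 by (simp add: powr_powr flip: powr_numeral)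
  then have "p / (1 + t) powr (p + 1) \<le> 1 / ((1 + t) powr p)\<^sup>2" using p t1 by (intro frac_le) auto
  then show "- (1 / (1 + t) powr p)\<^sup>2 \<le> - p / (1 + t) powr (p + 1)" by (simp add: power_divide)
  show "- p / (1 + t) powr (p + 1) \<le> 0" using p by simp
  show "(damping_integral p has_real_derivative 1 / (1 + t) powr p) (at t within {0..})"
  proof (cases "p = 1")
    case True
    then show ?thesis unfolding damping_integral_def[abs_def] using t1
      by (auto intro!: derivative_eq_intros simp: powr_one)
  next
    case False
    have "((\<lambda>t. ((1 + t) powr (1 - p) - 1) / (1 - p)) has_real_derivative (1 + t) powr (- p)) (at t within {0..})"
      using t1 False by (auto intro!: derivative_eq_intros)
    then show ?thesis unfolding damping_integral_def[abs_def] using False by (simp add: powr_minus_divide)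
  qed
  show "\<mu> \<le> c t" "c t \<le> M3" using cb[OF t] by auto
  show "(c has_real_derivative hderiv c t) (at t within {0..})"
    using C1_half_has_vector_derivative[OF c1 t] by (simp add: has_real_derivative_iff_has_vector_derivative)
  show "\<bar>hderiv c t\<bar> \<le> M4 * (1 / (1 + t) powr p)" using c'[OF t] by simp
qed (use pos in \<open>auto simp: damping_integral_def\<close>)

text \<open>For \<open>p \<le> 1\<close> the damping integral dominates \<open>ln (1 + t)\<close>;
  if \<open>p < 1\<close> this is \<open>1 + x \<le> exp x\<close> at
  \<open>x = (1 - p) * ln (1 + t)\<close>. So the loss of two powers of \<open>b\<close> costs at
  most 2 in the rate.\<close>

lemma powr_2_le_exp_damping_integral:
  assumes p: "0 < p" "p \<le> 1" and t: "0 \<le> t"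
  shows "((1 + t) powr p)\<^sup>2 \<le> exp (2 * damping_integral p t)"
proof -
  have t1: "1 \<le> 1 + t" "0 < 1 + t" using t by auto
  have "ln (1 + t) \<le> damping_integral p t"
  proof (cases "p = 1")
    case False
    then have q: "0 < 1 - p" using p by simp
    have "1 + (1 - p) * ln (1 + t) \<le> exp ((1 - p) * ln (1 + t))" by (rule exp_ge_add_one_self)
    also have "\<dots> = (1 + t) powr (1 - p)" using t1 by (simp add: powr_def)
    finally show ?thesis using q by (simp add: damping_integral_def field_simps)
  qed (simp add: damping_integral_def)
  moreover have "p * ln (1 + t) \<le> 1 * ln (1 + t)" using p t by (intro mult_right_mono) auto
  ultimately have "2 * (p * ln (1 + t)) \<le> 2 * damping_integral p t" by simp
  then have "exp (2 * (p * ln (1 + t))) \<le> exp (2 * damping_integral p t)" by simp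
  also have "exp (2 * (p * ln (1 + t))) = ((1 + t) powr p)\<^sup>2"
    using t1 by (simp add: powr_def exp_double)
  finally show ?thesis .
qed

theorem theorem2p9:
  fixes D :: "'h::{real_inner, complete_space} set"
    and A :: "'h \<Rightarrow> 'h"
    and \<nu> :: ereal
    and p \<epsilon>0 \<mu> M3 M4 :: real
    and u0 u1 :: 'h
    and c :: "real \<Rightarrow> real \<Rightarrow> real"
  assumes "self_adjoint_op D A"
    and "\<nu> = op_lower_bound D A" and "\<nu> > 0"
    and "p \<in> {0..1}"
    and "u0 \<in> D" and "u1 \<in> power_dom D A (1/2)"
    and "\<epsilon>0 > 0"
    and "\<And>\<epsilon>. \<epsilon> \<in> {0<..<\<epsilon>0} \<Longrightarrow> C1_half (c \<epsilon>)"
    and "\<mu> > 0"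
    and "\<And>\<epsilon> t. \<epsilon> \<in> {0<..<\<epsilon>0} \<Longrightarrow> t \<ge> 0 \<Longrightarrow> \<mu> \<le> c \<epsilon> t \<and> c \<epsilon> t \<le> M3"
    and "\<And>\<epsilon> t. \<epsilon> \<in> {0<..<\<epsilon>0} \<Longrightarrow> t \<ge> 0 \<Longrightarrow> \<bar>hderiv (c \<epsilon>) t\<bar> \<le> M4 / (1 + t) powr p"
  shows "\<exists>u :: real \<Rightarrow> real \<Rightarrow> 'h.
    (\<forall>\<epsilon>\<in>{0<..<\<epsilon>0}. is_solution D A p \<epsilon> (c \<epsilon>) u0 u1 (u \<epsilon>) \<and>
       (\<forall>v. is_solution D A p \<epsilon> (c \<epsilon>) u0 u1 v \<longrightarrow> (\<forall>t\<ge>0. v t = u \<epsilon> t))) \<and>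
    (p = 0 \<longrightarrow> (\<forall>\<beta>::real. ereal \<beta> < ereal (2 * \<mu>) * \<nu> \<longrightarrow>
       (\<exists>\<epsilon>1 C. \<epsilon>1 \<in> {0<..\<epsilon>0} \<and> (\<forall>t\<ge>0. \<forall>\<epsilon>\<in>{0<..<\<epsilon>1}.
          Gamma_energy D A \<epsilon> (u \<epsilon>) t \<le> C * exp (- \<beta> * t))))) \<and>
    (p \<in> {0<..<1} \<longrightarrow> (\<forall>\<beta>>0.
       (\<exists>\<epsilon>1 C. \<epsilon>1 \<in> {0<..\<epsilon>0} \<and> (\<forall>t\<ge>0. \<forall>\<epsilon>\<in>{0<..<\<epsilon>1}.
          Gamma_energy D A \<epsilon> (u \<epsilon>) t \<le> C * exp (- \<beta> * (1 + t) powr (1 - p)))))) \<and>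
    (p = 1 \<longrightarrow> (\<forall>\<beta>>0.
       (\<exists>\<epsilon>1 C. \<epsilon>1 \<in> {0<..\<epsilon>0} \<and> (\<forall>t\<ge>0. \<forall>\<epsilon>\<in>{0<..<\<epsilon>1}.
          Gamma_energy D A \<epsilon> (u \<epsilon>) t \<le> C / (1 + t) powr \<beta>))))"
proof -
  note sa = assms(1) and \<nu>_def = assms(2) and \<nu>_pos = assms(3) and \<epsilon>0 = assms(7) and \<mu> = assms(9)
  have p: "0 \<le> p" "p \<le> 1" using assms(4) by auto
  define b where "b = (\<lambda>t. 1 / (1 + t) powr p)"
  define b' where "b' = (\<lambda>t. - p / (1 + t) powr (p + 1))"
  define B where "B = damping_integral p"
  have wave: "damped_wave D A n \<epsilon> \<mu> M3 M4 b b' B (c \<epsilon>) (hderiv (c \<epsilon>))"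
    if \<epsilon>: "\<epsilon> \<in> {0<..<\<epsilon>0}" and n: "0 < n" "ereal n \<le> \<nu>" for \<epsilon> n
    unfolding b_def b'_def B_def
  proof (intro damped_wave.intro positive_self_adjoint.intro damping_powr p \<mu> sa n(1))
    show "n * (norm u)\<^sup>2 \<le> A u \<bullet> u" if "u \<in> D" for u
      using op_lower_bound_le[OF sa _ that] n(2) \<nu>_def by simp
  qed (use \<epsilon> assms(8,10,11) in auto)
  \<comment> \<open>\<open>\<nu>\<close> is infinite on the zero space, so a positive real below it
    is fixed; any such number serves existence, uniqueness and the case
    \<open>p > 0\<close>.\<close>
  obtain n0 :: real where n0: "0 < n0" "ereal n0 \<le> \<nu>"
  proof (cases \<nu>)
    case (real r)
    then show ?thesis using that[of r] \<nu>_pos by simp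
  next
    case PInf
    then show ?thesis using that[of 1] by simp
  qed (use \<nu>_pos in auto)
  have bp: "b t = 1 / (1 + t) powr p" for t by (simp add: b_def)
  have ex: "\<exists>u. is_solution D A p \<epsilon> (c \<epsilon>) u0 u1 u" if \<epsilon>: "\<epsilon> \<in> {0<..<\<epsilon>0}" for \<epsilon>
  proof -
    interpret damped_wave D A n0 \<epsilon> \<mu> M3 M4 b b' B "c \<epsilon>" "hderiv (c \<epsilon>)" by (rule wave[OF \<epsilon> n0])
    obtain u v where "u 0 = u0" "v 0 = u1" "continuous_on {0..} (\<lambda>t. A (u t))" "continuous_on {0..} (\<lambda>t. S (v t))"
      "\<And>t. 0 \<le> t \<Longrightarrow> u t \<in> D" "\<And>t. 0 \<le> t \<Longrightarrow> v t \<in> V"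
      "\<And>t. 0 \<le> t \<Longrightarrow> ((\<lambda>t. (u t, S (u t))) has_vector_derivative (v t, S (v t))) (at t within {0..})"
      "\<And>t. 0 \<le> t \<Longrightarrow> (v has_vector_derivative accel t (v t) (A (u t))) (at t within {0..})"
      using solution_exists[OF assms(5,6)] by blast
    then show ?thesis by (intro exI[of _ u] is_solutionI[OF bp])
  qed
  define u where "u \<epsilon> = (SOME w. is_solution D A p \<epsilon> (c \<epsilon>) u0 u1 w)" for \<epsilon>
  have sol: "is_solution D A p \<epsilon> (c \<epsilon>) u0 u1 (u \<epsilon>)" if "\<epsilon> \<in> {0<..<\<epsilon>0}" for \<epsilon>
    unfolding u_def by (rule someI_ex[OF ex[OF that]])
  have uniq: "v t = u \<epsilon> t" if \<epsilon>: "\<epsilon> \<in> {0<..<\<epsilon>0}" and v: "is_solution D A p \<epsilon> (c \<epsilon>) u0 u1 v" "0 \<le> t" for \<epsilon> v t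
    by (rule damped_wave.solution_unique[OF wave[OF \<epsilon> n0] bp sol[OF \<epsilon>] v])
  have M: "\<mu> \<le> M3" "0 \<le> M4"
  proof -
    have h: "\<epsilon>0 / 2 \<in> {0<..<\<epsilon>0}" using \<epsilon>0 by simp
    show "\<mu> \<le> M3" using assms(10)[OF h, of 0] by simp
    show "0 \<le> M4" using assms(11)[OF h, of 0] by simp
  qed
  \<comment> \<open>The lower bound \<open>n\<close> stays a parameter, since for
    \<open>p = 0\<close> it has to be matched to the rate.\<close>
  have decay: "\<exists>\<epsilon>1 C. \<epsilon>1 \<in> {0<..\<epsilon>0} \<and> 0 \<le> C \<and> (\<forall>t\<ge>0. \<forall>\<epsilon>\<in>{0<..<\<epsilon>1}.
      Gamma_energy D A \<epsilon> (u \<epsilon>) t \<le> C * (((1 + t) powr p)\<^sup>2 * exp (- \<gamma> * B t)))"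
    if n: "0 < n" "ereal n \<le> \<nu>" and \<gamma>: "0 \<le> \<gamma>" and \<delta>: "0 < \<delta>" and T: "0 \<le> T"
      "\<And>t. T \<le> t \<Longrightarrow> \<gamma> * (b t)\<^sup>2 / n \<le> 2 * \<mu> - \<delta>" for n \<gamma> \<delta> T
  proof -
    have "\<exists>\<epsilon>1>0. \<exists>C. \<forall>\<epsilon> c c' P Q X Y W R. damped_energy \<epsilon> \<mu> M3 M4 b b' B c c' n P Q X Y W R \<longrightarrow>
        \<epsilon> < \<epsilon>1 \<longrightarrow> (\<forall>t\<ge>0. (b t)\<^sup>2 * (Q t + \<epsilon> * P t + W t) * exp (\<gamma> * B t) \<le> C * (P 0 + Q 0))"
      by (rule uniform_decay[OF \<mu> M n(1) \<gamma> \<delta> T(1)]) (rule T(2))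
    then obtain \<epsilon>2 C where \<epsilon>2: "0 < \<epsilon>2" and dec: "\<forall>\<epsilon> c c' P Q X Y W R.
        damped_energy \<epsilon> \<mu> M3 M4 b b' B c c' n P Q X Y W R \<longrightarrow>
        \<epsilon> < \<epsilon>2 \<longrightarrow> (\<forall>t\<ge>0. (b t)\<^sup>2 * (Q t + \<epsilon> * P t + W t) * exp (\<gamma> * B t) \<le> C * (P 0 + Q 0))"
      by (elim exE conjE)
    note C = dec[rule_format]
    define K where "K = (1 / n\<^sup>2 + 1 / n + 1) * (C * ((norm (power_op D A (1 / 2) u1))\<^sup>2 + (norm (A u0))\<^sup>2))"
    have "Gamma_energy D A \<epsilon> (u \<epsilon>) t \<le> \<bar>K\<bar> * (((1 + t) powr p)\<^sup>2 * exp (- \<gamma> * B t))"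
      if \<epsilon>: "\<epsilon> \<in> {0<..<min \<epsilon>2 \<epsilon>0}" and t: "0 \<le> t" for \<epsilon> t
    proof -
      have \<epsilon>': "\<epsilon> \<in> {0<..<\<epsilon>0}" "\<epsilon> < \<epsilon>2" using \<epsilon> by auto
      interpret damped_wave D A n \<epsilon> \<mu> M3 M4 b b' B "c \<epsilon>" "hderiv (c \<epsilon>)" by (rule wave[OF \<epsilon>'(1) n])
      have "Gamma_energy D A \<epsilon> (u \<epsilon>) t * ((b t)\<^sup>2 * exp (\<gamma> * B t)) \<le> K"
        unfolding K_def
      proof (rule solution_decay[OF bp sol[OF \<epsilon>'(1)] assms(5,6) _ t])
        fix P Q X Y W R
        assume "damped_energy \<epsilon> \<mu> M3 M4 b b' B (c \<epsilon>) (hderiv (c \<epsilon>)) n P Q X Y W R"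
        from C[OF this \<epsilon>'(2) t]
        show "(b t)\<^sup>2 * (Q t + \<epsilon> * P t + W t) * exp (\<gamma> * B t) \<le> C * (P 0 + Q 0)" .
      qed
      also have "K \<le> \<bar>K\<bar>" by simp
      finally have "Gamma_energy D A \<epsilon> (u \<epsilon>) t \<le> \<bar>K\<bar> / ((b t)\<^sup>2 * exp (\<gamma> * B t))"
        using b(1)[OF t] by (simp add: pos_le_divide_eq)
      also have "\<dots> = \<bar>K\<bar> * (((1 + t) powr p)\<^sup>2 * exp (- \<gamma> * B t))"
        using t by (simp add: bp power_divide exp_minus field_simps)
      finally show ?thesis .
    qed
    then show ?thesis using \<epsilon>2 \<epsilon>0 by (intro exI[of _ "min \<epsilon>2 \<epsilon>0"] exI[of _ "\<bar>K\<bar>"]) auto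
  qed
  have decay_pos: "\<exists>\<epsilon>1 C. \<epsilon>1 \<in> {0<..\<epsilon>0} \<and> 0 \<le> C \<and> (\<forall>t\<ge>0. \<forall>\<epsilon>\<in>{0<..<\<epsilon>1}.
      Gamma_energy D A \<epsilon> (u \<epsilon>) t \<le> C * exp (- \<gamma> * B t))" if p0: "0 < p" and \<gamma>: "0 \<le> \<gamma>" for \<gamma>
  proof -
    \<comment> \<open>Once \<open>(b t)\<^sup>2 \<le> s\<close>, the rate
      \<open>\<gamma> + 2\<close> meets the condition of \<open>decay\<close> with
      \<open>\<delta> = \<mu>\<close>; the extra 2 pays for
      \<open>powr_2_le_exp_damping_integral\<close>.\<close>
    define s where "s = \<mu> * n0 / (\<gamma> + 2)"
    have s: "0 < s" using \<mu> n0 \<gamma> by (simp add: s_def)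
    have "((\<lambda>t. (1 + t) powr (- (2 * p))) \<longlongrightarrow> 0) at_top"
      by (rule tendsto_neg_powr) (use p0 in \<open>auto intro: filterlim_tendsto_add_at_top[OF tendsto_const filterlim_ident]\<close>)
    then have "\<forall>\<^sub>F t in at_top. (1 + t) powr (- (2 * p)) < s" using s by (intro order_tendstoD(2))
    then obtain T0 where T0: "\<And>t. T0 \<le> t \<Longrightarrow> (1 + t) powr (- (2 * p)) < s"
      by (auto simp: eventually_at_top_linorder)
    have bT: "(\<gamma> + 2) * (b t)\<^sup>2 / n0 \<le> 2 * \<mu> - \<mu>" if t: "max T0 0 \<le> t" for t
    proof -
      have "(b t)\<^sup>2 = (1 + t) powr (- (2 * p))"
        using t by (simp add: bp powr_minus_divide power_divide powr_powr mult.commute flip: powr_numeral)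
      also have "\<dots> \<le> s" using T0[of t] t by simp
      finally have "(\<gamma> + 2) * (b t)\<^sup>2 \<le> (\<gamma> + 2) * s" using \<gamma> by (intro mult_left_mono) auto
      also have "\<dots> = \<mu> * n0" using \<gamma> by (simp add: s_def)
      finally show ?thesis using n0 by (simp add: field_simps)
    qed
    have "0 \<le> \<gamma> + 2" using \<gamma> by simp
    then have "\<exists>\<epsilon>1 C. \<epsilon>1 \<in> {0<..\<epsilon>0} \<and> 0 \<le> C \<and> (\<forall>t\<ge>0. \<forall>\<epsilon>\<in>{0<..<\<epsilon>1}.
        Gamma_energy D A \<epsilon> (u \<epsilon>) t \<le> C * (((1 + t) powr p)\<^sup>2 * exp (- (\<gamma> + 2) * B t)))"
      by (rule decay[OF n0 _ \<mu> max.cobounded2[of 0 T0]]) (rule bT)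
    then obtain \<epsilon>1 C where \<epsilon>1: "\<epsilon>1 \<in> {0<..\<epsilon>0}" "0 \<le> C" and G': "\<forall>t\<ge>0. \<forall>\<epsilon>\<in>{0<..<\<epsilon>1}.
        Gamma_energy D A \<epsilon> (u \<epsilon>) t \<le> C * (((1 + t) powr p)\<^sup>2 * exp (- (\<gamma> + 2) * B t))"
      by (elim exE conjE)
    note G = G'[rule_format]
    have "Gamma_energy D A \<epsilon> (u \<epsilon>) t \<le> C * exp (- \<gamma> * B t)" if t: "0 \<le> t" and \<epsilon>: "\<epsilon> \<in> {0<..<\<epsilon>1}" for t \<epsilon>
    proof -
      have "((1 + t) powr p)\<^sup>2 * exp (- (\<gamma> + 2) * B t) \<le> exp (2 * B t) * exp (- (\<gamma> + 2) * B t)"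
        unfolding B_def using powr_2_le_exp_damping_integral[OF p0 p(2) t] by (rule mult_right_mono) simp
      also have "\<dots> = exp (- \<gamma> * B t)" by (simp add: algebra_simps flip: exp_add)
      finally have "C * (((1 + t) powr p)\<^sup>2 * exp (- (\<gamma> + 2) * B t)) \<le> C * exp (- \<gamma> * B t)"
        using \<epsilon>1(2) by (rule mult_left_mono)
      then show ?thesis using G[OF t \<epsilon>] by linarith
    qed
    then show ?thesis using \<epsilon>1 by blast
  qed
  have case0: "\<exists>\<epsilon>1 C. \<epsilon>1 \<in> {0<..\<epsilon>0} \<and> (\<forall>t\<ge>0. \<forall>\<epsilon>\<in>{0<..<\<epsilon>1}.
      Gamma_energy D A \<epsilon> (u \<epsilon>) t \<le> C * exp (- \<beta> * t))"
    if p0: "p = 0" and \<beta>: "ereal \<beta> < ereal (2 * \<mu>) * \<nu>" for \<beta>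
  proof -
    \<comment> \<open>\<open>\<beta>\<close> may be negative, while \<open>decay\<close> takes
      nonnegative rates.\<close>
    define \<gamma> where "\<gamma> = max \<beta> 0"
    obtain n where n: "0 < n" "ereal n \<le> \<nu>" "\<gamma> < 2 * \<mu> * n"
    proof (cases \<nu>)
      case (real r)
      then have "0 < r" "\<beta> < 2 * \<mu> * r" using \<nu>_pos \<beta> by auto
      then show ?thesis using that[of r] real \<mu> by (simp add: \<gamma>_def)
    next
      case PInf
      \<comment> \<open>For \<open>\<nu> = \<infinity>\<close> every positive \<open>n\<close> is
        admissible; this one gives \<open>2 * \<mu> * n = \<gamma> + 1\<close>.\<close>
      have "\<gamma> < 2 * \<mu> * ((\<gamma> + 1) / (2 * \<mu>))" using \<mu> by simp
      moreover have "0 < (\<gamma> + 1) / (2 * \<mu>)" using \<mu> by (simp add: \<gamma>_def)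
      ultimately show ?thesis using that PInf by simp
    qed (use \<nu>_pos in auto)
    have \<delta>: "0 < 2 * \<mu> - \<gamma> / n" using n by (simp add: field_simps)
    have "\<gamma> * (b t)\<^sup>2 / n \<le> 2 * \<mu> - (2 * \<mu> - \<gamma> / n)" if "0 \<le> t" for t using that by (simp add: bp p0)
    moreover have "0 \<le> \<gamma>" by (simp add: \<gamma>_def)
    ultimately have "\<exists>\<epsilon>1 C. \<epsilon>1 \<in> {0<..\<epsilon>0} \<and> 0 \<le> C \<and> (\<forall>t\<ge>0. \<forall>\<epsilon>\<in>{0<..<\<epsilon>1}.
        Gamma_energy D A \<epsilon> (u \<epsilon>) t \<le> C * (((1 + t) powr p)\<^sup>2 * exp (- \<gamma> * B t)))"
      by (intro decay[OF n(1,2) _ \<delta> order_refl])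
    then obtain \<epsilon>1 C where \<epsilon>1: "\<epsilon>1 \<in> {0<..\<epsilon>0}" "0 \<le> C" and G': "\<forall>t\<ge>0. \<forall>\<epsilon>\<in>{0<..<\<epsilon>1}.
        Gamma_energy D A \<epsilon> (u \<epsilon>) t \<le> C * (((1 + t) powr p)\<^sup>2 * exp (- \<gamma> * B t))"
      by (elim exE conjE)
    note G = G'[rule_format]
    have "Gamma_energy D A \<epsilon> (u \<epsilon>) t \<le> C * exp (- \<beta> * t)" if t: "0 \<le> t" and \<epsilon>: "\<epsilon> \<in> {0<..<\<epsilon>1}" for t \<epsilon>
    proof -
      have "\<beta> * t \<le> \<gamma> * t" using t by (intro mult_right_mono) (auto simp: \<gamma>_def)
      then have "C * exp (- \<gamma> * t) \<le> C * exp (- \<beta> * t)" using \<epsilon>1(2) by (intro mult_left_mono) auto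
      then show ?thesis using G[OF t \<epsilon>] t by (simp add: p0 B_def damping_integral_def)
    qed
    then show ?thesis using \<epsilon>1(1) by blast
  qed
  have case01: "\<exists>\<epsilon>1 C. \<epsilon>1 \<in> {0<..\<epsilon>0} \<and> (\<forall>t\<ge>0. \<forall>\<epsilon>\<in>{0<..<\<epsilon>1}.
      Gamma_energy D A \<epsilon> (u \<epsilon>) t \<le> C * exp (- \<beta> * (1 + t) powr (1 - p)))"
    if p01: "p \<in> {0<..<1}" and \<beta>: "0 < \<beta>" for \<beta>
  proof -
    \<comment> \<open>\<open>(1 - p) * B t\<close> equals \<open>(1 + t) powr (1 - p) - 1\<close>,
      so the rate \<open>\<beta> * (1 - p)\<close> in \<open>B\<close> is the rate
      \<open>\<beta>\<close> in the power; the \<open>- 1\<close> contributes the factor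
      \<open>exp \<beta>\<close> to the constant.\<close>
    have "0 < p" "0 \<le> \<beta> * (1 - p)" using p01 \<beta> by auto
    from decay_pos[OF this]
    obtain \<epsilon>1 C where \<epsilon>1: "\<epsilon>1 \<in> {0<..\<epsilon>0}" and G: "\<forall>t\<ge>0. \<forall>\<epsilon>\<in>{0<..<\<epsilon>1}.
        Gamma_energy D A \<epsilon> (u \<epsilon>) t \<le> C * exp (- (\<beta> * (1 - p)) * B t)"
      by (elim exE conjE)
    have eq: "C * exp (- (\<beta> * (1 - p)) * B t) = C * exp \<beta> * exp (- \<beta> * (1 + t) powr (1 - p))" for t
    proof -
      have "(1 - p) * B t = (1 + t) powr (1 - p) - 1" using p01 by (simp add: B_def damping_integral_def)
      then have "- \<beta> * ((1 - p) * B t) = \<beta> + - \<beta> * (1 + t) powr (1 - p)"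
        by (simp only: right_diff_distrib)
      then have "- (\<beta> * (1 - p)) * B t = \<beta> + - \<beta> * (1 + t) powr (1 - p)" by (simp only: mult_minus_left mult.assoc)
      then show ?thesis unfolding mult.assoc[of C] exp_add[symmetric] by (simp only:)
    qed
    show ?thesis using \<epsilon>1 G[unfolded eq] by (intro exI conjI)
  qed
  have case1: "\<exists>\<epsilon>1 C. \<epsilon>1 \<in> {0<..\<epsilon>0} \<and> (\<forall>t\<ge>0. \<forall>\<epsilon>\<in>{0<..<\<epsilon>1}.
      Gamma_energy D A \<epsilon> (u \<epsilon>) t \<le> C / (1 + t) powr \<beta>)"
    if p1: "p = 1" and \<beta>: "0 < \<beta>" for \<beta>
  proof -
    have "0 < p" using p1 by simp
    from decay_pos[OF this less_imp_le[OF \<beta>]]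
    obtain \<epsilon>1 C where \<epsilon>1: "\<epsilon>1 \<in> {0<..\<epsilon>0}" and G: "\<forall>t\<ge>0. \<forall>\<epsilon>\<in>{0<..<\<epsilon>1}.
        Gamma_energy D A \<epsilon> (u \<epsilon>) t \<le> C * exp (- \<beta> * B t)"
      by (elim exE conjE)
    have "Gamma_energy D A \<epsilon> (u \<epsilon>) t \<le> C / (1 + t) powr \<beta>" if t: "0 \<le> t" and \<epsilon>: "\<epsilon> \<in> {0<..<\<epsilon>1}" for t \<epsilon>
      using G[rule_format, OF t \<epsilon>] t by (simp add: p1 B_def damping_integral_def powr_def exp_minus field_simps)
    then show ?thesis using \<epsilon>1 by blast
  qed
  show ?thesis using sol uniq case0 case01 case1 by (intro exI[of _ u]) blast
qed

end
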